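(* Let $\mathcal A$ be an infinite set and for each $T\geq 1$ let $\chi_T:\mathcal A\to[0,\infty)$ be a function such that $\{a\in\mathcal A:\chi_T(a)>0\}$ is finite for every $T\geq 1$, and such that $\lim_{T\to+\infty}\sum_{a\in\mathcal A}\chi_T(a)=+\infty$. Let $\mathfrak C=(c_a)_{a\in\mathcal A}$ be a sequence of strictly positive integers. Assume that $\mathfrak C$ is equidistributed (see context) with respect to some positive constants $\theta,\xi,\kappa,\lambda_1,\lambda_2,B,K$ and functions $M(T)$ and $h_T\in\mathcal D(\kappa,\lambda_1,\lambda_2,B,K)$. Fix any $A>1$ and assume that $f:\mathbb N\to[0,\infty)$ is a function such that for every $\epsilon>0$ there exists $C>0$ for which $f\in\mathcal M(A,\epsilon,C)$. Assume that there exist $\alpha>0$ and $\widetilde B>0$ such that for all $T\geq 1$ one has $$\sup\{c_a: a\in\mathcal A,\ \chi_T(a)>0\}\leq \widetilde B\, M(T)^\alpha .$$ Then for all $T\geq 1$ we have $$\sum_{a\in\mathcal A}\chi_T(a) f(c_a)\ll M(T)\prod_{B<p\leq M(T)}(1-h_T(p))\sum_{a\leq M(T)} f(a)h_T(a),$$ where the product is over primes $p$, the sum on the right is over positive integers $a\leq M(T)$, and the implied constant is allowed to depend on $\alpha,A,B,\widetilde B,\theta,\xi,K,\kappa,\lambda_1,\lambda_2$, the function $f$ and the implied constants in the definition of equidistribution, but is independent of $T$ and $M(T)$.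
   Context: Notation: $p$ always denotes a prime; $\Omega(n)=\sum_{p\mid n}v_p(n)$ is the number of prime factors counted with multiplicity; empty products equal $1$. Density functions. For fixed $\kappa,\lambda_1,\lambda_2,B,K>0$, $\mathcal D(\kappa,\lambda_1,\lambda_2,B,K)$ is the set of multiplicative functions $h:\mathbb N\to\mathbb R_{\geq 0}$ such that: (1) for all $B<w<z$, $\prod_{w\leq p<z}(1-h(p))^{-1}\leq \left(\frac{\log z}{\log w}\right)^\kappa\left(1+\frac{K}{\log w}\right)$; (2) for every prime $p>B$ and every integer $e\geq 1$, $h(p^e)\leq B/p$; (3) for every prime $p$ and every integer $e\geq 1$, $h(p^e)\leq p^{-e\lambda_1+\lambda_2}$. Class of functions. For fixed $A\geq 1$, $\epsilon>0$, $C>0$, $\mathcal M(A,\epsilon,C)$ is the set of functions $f:\mathbb N\to[0,\infty)$ such that $f(mn)\leq f(m)\min\{A^{\Omega(n)},Cn^\epsilon\}$ for all coprime $m,n\in\mathbb N$. Equidistribution. For a non-zero integer $d$ and $T\geq 1$ put $C_d(T)=\sum_{a\in\mathcal A,\ c_a\equiv 0\bmod d}\chi_T(a)$. The sequence $\mathfrak C=(c_a)_{a\in\mathcal A}$ is called equidistributed if there exist positive real numbers $\theta,\xi,\kappa,\lambda_1,\lambda_2,B,K$ (all independent of $T$) with $\max\{\theta,\xi\}<1$, a function $M:\mathbb R_{\geq 1}\to\mathbb R_{\geq 1}$, and for each $T$ a function $h_T\in\mathcal D(\kappa,\lambda_1,\lambda_2,B,K)$ such that $$C_d(T)=h_T(d)M(T)\Bigg\{1+O\Bigg(\prod_{B<p\leq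 M(T),\ p\nmid d}(1-h_T(p))^2\Bigg)\Bigg\}+O(M(T)^{1-\xi})$$ for every $T\geq 1$ and every positive integer $d\leq M(T)^\theta$, where the implied constants are independent of $d$ and $T$. *)

theory Defs
  imports Complex_Main "HOL-Computational_Algebra.Computational_Algebra"
begin

text \<open>
  Arithmetic functions are total functions on \<open>nat\<close>; they stand for functions on the positive
  integers, and nothing is ever required of their value at 0.
\<close>

definition big_omega :: "nat \<Rightarrow> nat" where
  "big_omega n = (\<Sum>p\<in>prime_factors n. multiplicity p n)"

definition multiplicative_fun :: "(nat \<Rightarrow> real) \<Rightarrow> bool" where
  "multiplicative_fun h \<longleftrightarrow>
     h 1 = 1 \<and> (\<forall>m n. m > 0 \<longrightarrow> n > 0 \<longrightarrow> coprime m n \<longrightarrow> h (m * n) = h m * h n)"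

text \<open>
  The first condition below is only meaningful for \<open>w > 1\<close>, where \<open>ln w > 0\<close>; the extra guard
  matters only if \<open>B < 1\<close>. All the factors \<open>1 - h p\<close> occurring there are positive, because
  \<open>h p \<le> B / p < 1\<close> for the primes \<open>p > B\<close> by the second condition.
\<close>

definition density_class ::
  "real \<Rightarrow> real \<Rightarrow> real \<Rightarrow> real \<Rightarrow> real \<Rightarrow> (nat \<Rightarrow> real) set" where
  "density_class \<kappa> l1 l2 B K = {h.
     multiplicative_fun h \<and> (\<forall>n>0. h n \<ge> 0) \<and>
     (\<forall>w z. B < w \<longrightarrow> 1 < w \<longrightarrow> w < z \<longrightarrow>
        (\<Prod>p | prime p \<and> w \<le> real p \<and> real p < z. inverse (1 - h p))
          \<le> (ln z / ln w) powr \<kappa> * (1 + K / ln w)) \<and>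
     (\<forall>p e. prime p \<longrightarrow> real p > B \<longrightarrow> e \<ge> 1 \<longrightarrow> h (p ^ e) \<le> B / real p) \<and>
     (\<forall>p e. prime p \<longrightarrow> e \<ge> 1 \<longrightarrow> h (p ^ e) \<le> real p powr (- real e * l1 + l2))}"

definition growth_class :: "real \<Rightarrow> real \<Rightarrow> real \<Rightarrow> (nat \<Rightarrow> real) set" where
  "growth_class A \<epsilon> C = {f.
     (\<forall>n>0. f n \<ge> 0) \<and>
     (\<forall>m n. m > 0 \<longrightarrow> n > 0 \<longrightarrow> coprime m n \<longrightarrow>
        f (m * n) \<le> f m * min (A ^ big_omega n) (C * real n powr \<epsilon>))}"

text \<open>
  Sums over \<open>\<A>\<close> weighted by \<open>\<chi> T\<close> are restricted to the support of \<open>\<chi> T\<close>, which is finite.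
\<close>

definition weight_support :: "'a set \<Rightarrow> (real \<Rightarrow> 'a \<Rightarrow> real) \<Rightarrow> real \<Rightarrow> 'a set" where
  "weight_support \<A> \<chi> T = {a \<in> \<A>. \<chi> T a > 0}"

definition congruence_sum ::
  "'a set \<Rightarrow> (real \<Rightarrow> 'a \<Rightarrow> real) \<Rightarrow> ('a \<Rightarrow> nat) \<Rightarrow> nat \<Rightarrow> real \<Rightarrow> real" where
  "congruence_sum \<A> \<chi> c d T = (\<Sum>a | a \<in> weight_support \<A> \<chi> T \<and> d dvd c a. \<chi> T a)"

text \<open>
  The parameters \<open>k1\<close> and \<open>k2\<close> are the constants implied by the two error terms \<open>E1\<close> and \<open>E2\<close>.
\<close>

definition equidistributed_wrt ::
  "'a set \<Rightarrow> (real \<Rightarrow> 'a \<Rightarrow> real) \<Rightarrow> ('a \<Rightarrow> nat) \<Rightarrow>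
   real \<Rightarrow> real \<Rightarrow> real \<Rightarrow> real \<Rightarrow> real \<Rightarrow> real \<Rightarrow> real \<Rightarrow>
   (real \<Rightarrow> real) \<Rightarrow> (real \<Rightarrow> nat \<Rightarrow> real) \<Rightarrow> real \<Rightarrow> real \<Rightarrow> bool" where
  "equidistributed_wrt \<A> \<chi> c \<theta> \<xi> \<kappa> l1 l2 B K M h k1 k2 \<longleftrightarrow>
     \<theta> > 0 \<and> \<xi> > 0 \<and> \<kappa> > 0 \<and> l1 > 0 \<and> l2 > 0 \<and> B > 0 \<and> K > 0 \<and> max \<theta> \<xi> < 1 \<and>
     (\<forall>T\<ge>1. M T \<ge> 1 \<and> h T \<in> density_class \<kappa> l1 l2 B K) \<and>
     (\<forall>T\<ge>1. \<forall>d::nat. d > 0 \<longrightarrow> real d \<le> M T powr \<theta> \<longrightarrow>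
        (\<exists>E1 E2.
           congruence_sum \<A> \<chi> c d T = h T d * M T * (1 + E1) + E2 \<and>
           \<bar>E1\<bar> \<le> k1 * (\<Prod>p | prime p \<and> B < real p \<and> real p \<le> M T \<and> \<not> p dvd d. (1 - h T p)\<^sup>2) \<and>
           \<bar>E2\<bar> \<le> k2 * M T powr (1 - \<xi>)))"

end

theory Submission
  imports Defs
begin

text \<open>
  The argument follows Shiu and Nair--Tenenbaum. Write \<open>Z\<close> for a small power of \<open>M\<close> and let
  \<open>z_r = w^(2^r)\<close> for a large constant \<open>w\<close>. Taking the primes of \<open>c_a\<close> in increasing order for as
  long as the product \<open>d\<close> of their full powers stays below \<open>Z\<close>, one writes \<open>c_a = d b\<close>, and the first
  prime \<open>q\<close> left out lies in some \<open>[z_r, z_(r+1))\<close>. Then \<open>f (c_a) \<le> f d A^\<Omega>(b)\<close>, where \<open>\<Omega>(b)\<close> is at most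
  a constant times \<open>ln M / ln z_r\<close>, and the number of \<open>a\<close> with given \<open>d\<close> is bounded by a sieve up
  to \<open>z_r\<close>. Unless \<open>q\<close> exceeds a small power of \<open>M\<close>, either \<open>d > sqrt Z\<close> is \<open>z_(r+1)\<close>-smooth, and
  Rankin's trick gains a factor \<open>exp (- N ln Z / ln z_r)\<close> with \<open>N\<close> as large as we like, or \<open>c_a\<close> is
  divisible by a large power of a small prime, which is so rare that a power of \<open>M\<close> is saved.
\<close>

subsection \<open>Truncated inclusion-exclusion over blocks\<close>

text \<open>The first error term of equidistribution carries the squares \<open>(1 - h p)^2\<close>.
  Under sieve coefficients of modulus at most 1 it contributes no more than the sum, over all sets
  \<open>S\<close> of sieving primes, of the product of \<open>h\<close> over \<open>S\<close> and
  of the squares off \<open>S\<close>; this is the product of the \<open>h p + (1 - h p)^2\<close>.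
  Each factor equals \<open>1 - h p\<close> up to second order, so the error has the size of the
  expected main term. The exponents of the levels double so that the first condition in
  \<open>density_class\<close> bounds the product of \<open>1 / (1 - h p)\<close> over a block by a
  constant. At primes up to \<open>B\<close> the values of \<open>h\<close> may exceed 1, so the
  sieve starts at \<open>w \<ge> 2 * B\<close>, where \<open>h p \<le> 1 / 2\<close>. Full prime
  powers are moved together because the growth condition on \<open>f\<close> concerns coprime
  factors. The constants are fixed in the order \<theta>1, \<eta>, \<open>N\<close>,
  \<open>w\<close>, \<tau>: the losses that \<open>N\<close> must beat depend on \<eta> but not on
  \<open>w\<close>, whereas the power of \<open>M\<close> saved at the primes below \<open>w\<close>
  shrinks with \<open>w\<close>. Bounded \<open>M\<close> is a separate, trivial case.\<close>

definition truncated_sum :: "('a \<Rightarrow> real) \<Rightarrow> nat \<Rightarrow> 'a set \<Rightarrow> real" where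
  "truncated_sum g m P = (\<Sum>S | S \<subseteq> P \<and> card S \<le> m. \<Prod>p\<in>S. - g p)"

definition elem_sym :: "('a \<Rightarrow> real) \<Rightarrow> nat \<Rightarrow> 'a set \<Rightarrow> real" where
  "elem_sym g m P = (\<Sum>S | S \<subseteq> P \<and> card S = m. \<Prod>p\<in>S. g p)"

text \<open>The subsets are sorted by whether they contain \<open>p\<close>. The predicate
  \<open>Q\<close> on cardinalities lets one lemma serve both \<open>truncated_sum\<close> (bounded
  size) and \<open>elem_sym\<close> (exact size).\<close>

lemma sum_subsets_card_insert:
  fixes f :: "'a set \<Rightarrow> real"
  assumes "finite P" "p \<notin> P"
  shows "(\<Sum>S | S \<subseteq> insert p P \<and> Q (card S). f S)
    = (\<Sum>S | S \<subseteq> P \<and> Q (card S). f S) + (\<Sum>S | S \<subseteq> P \<and> Q (Suc (card S)). f (insert p S))"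
proof -
  have eq: "{S. S \<subseteq> insert p P \<and> Q (card S)} =
      {S. S \<subseteq> P \<and> Q (card S)} \<union> insert p ` {S. S \<subseteq> P \<and> Q (Suc (card S))}" (is "?L = ?R")
  proof (intro equalityI subsetI)
    fix S assume S: "S \<in> ?L"
    show "S \<in> ?R"
    proof (cases "p \<in> S")
      case True
      have SP: "S \<subseteq> insert p P" "Q (card S)" using S by simp_all
      have "finite S" by (rule finite_subset[OF SP(1)]) (simp add: assms(1))
      hence card: "card S = Suc (card (S - {p}))" using True by (rule card.remove)
      have "S - {p} \<in> {S. S \<subseteq> P \<and> Q (Suc (card S))}" using SP card by auto
      hence "insert p (S - {p}) \<in> ?R" by blast
      moreover have "insert p (S - {p}) = S" using True by auto
      ultimately show ?thesis by (simp only:)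
    next
      case False
      hence "S \<in> {S. S \<subseteq> P \<and> Q (card S)}" using S by blast
      thus ?thesis by (rule UnI1)
    qed
  next
    fix S assume "S \<in> ?R"
    thus "S \<in> ?L"
    proof
      assume "S \<in> insert p ` {S. S \<subseteq> P \<and> Q (Suc (card S))}"
      then obtain U where U: "S = insert p U" "U \<subseteq> P" "Q (Suc (card U))" by auto
      have "card S = Suc (card U)"
        using U assms by (metis card_insert_disjoint finite_subset subsetD)
      thus ?thesis using U by auto
    qed auto
  qed
  have inj: "inj_on (insert p) {S. S \<subseteq> P \<and> Q (Suc (card S))}"
    using assms(2) by (auto simp: inj_on_def)
  have "(\<Sum>S\<in>?L. f S) = (\<Sum>S | S \<subseteq> P \<and> Q (card S). f S)
      + (\<Sum>S\<in>insert p ` {S. S \<subseteq> P \<and> Q (Suc (card S))}. f S)"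
    unfolding eq using assms by (intro sum.union_disjoint) auto
  also have "(\<Sum>S\<in>insert p ` {S. S \<subseteq> P \<and> Q (Suc (card S))}. f S)
      = (\<Sum>S | S \<subseteq> P \<and> Q (Suc (card S)). f (insert p S))"
    by (simp add: sum.reindex[OF inj])
  finally show ?thesis .
qed

lemma truncated_sum_0 [simp]: "finite P \<Longrightarrow> truncated_sum g 0 P = 1"
proof -
  assume "finite P"
  hence "{S. S \<subseteq> P \<and> card S \<le> 0} = {{}}" by (auto dest: finite_subset)
  thus ?thesis by (simp add: truncated_sum_def)
qed

lemma truncated_sum_insert:
  assumes "finite P" "p \<notin> P"
  shows "truncated_sum g (Suc m) (insert p P) = truncated_sum g (Suc m) P - g p * truncated_sum g m P"
proof -
  have "truncated_sum g (Suc m) (insert p P) = truncated_sum g (Suc m) P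
      + (\<Sum>S | S \<subseteq> P \<and> card S \<le> m. \<Prod>q\<in>insert p S. - g q)"
    unfolding truncated_sum_def
    using sum_subsets_card_insert[OF assms, where Q = "\<lambda>n. n \<le> Suc m" and f = "\<lambda>S. \<Prod>p\<in>S. - g p"] by simp
  also have "(\<Sum>S | S \<subseteq> P \<and> card S \<le> m. \<Prod>q\<in>insert p S. - g q)
      = (\<Sum>S | S \<subseteq> P \<and> card S \<le> m. - g p * (\<Prod>q\<in>S. - g q))"
    using assms by (intro sum.cong refl prod.insert) (auto dest: finite_subset)
  also have "\<dots> = - (g p * truncated_sum g m P)"
    unfolding truncated_sum_def by (simp add: sum_distrib_left sum_negf)
  finally show ?thesis by simp
qed

lemma elem_sym_0 [simp]: "finite P \<Longrightarrow> elem_sym g 0 P = 1"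
proof -
  assume "finite P"
  hence "{S. S \<subseteq> P \<and> card S = 0} = {{}}" by (auto dest: finite_subset)
  thus ?thesis by (simp add: elem_sym_def)
qed

lemma elem_sym_insert:
  assumes "finite P" "p \<notin> P"
  shows "elem_sym g (Suc m) (insert p P) = elem_sym g (Suc m) P + g p * elem_sym g m P"
proof -
  have "elem_sym g (Suc m) (insert p P) = elem_sym g (Suc m) P
      + (\<Sum>S | S \<subseteq> P \<and> card S = m. \<Prod>q\<in>insert p S. g q)"
    unfolding elem_sym_def
    using sum_subsets_card_insert[OF assms, where Q = "\<lambda>n. n = Suc m" and f = "\<lambda>S. \<Prod>p\<in>S. g p"] by simp
  also have "(\<Sum>S | S \<subseteq> P \<and> card S = m. \<Prod>q\<in>insert p S. g q)
      = (\<Sum>S | S \<subseteq> P \<and> card S = m. g p * (\<Prod>q\<in>S. g q))"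
    using assms by (intro sum.cong refl prod.insert) (auto dest: finite_subset)
  also have "\<dots> = g p * elem_sym g m P"
    unfolding elem_sym_def by (simp add: sum_distrib_left)
  finally show ?thesis by simp
qed

text \<open>Bonferroni's inequalities for weights in [0,1]. The recursion subtracts
  \<open>g p\<close> times the defect one level lower; that defect has the opposite sign by
  induction, so both contributions point the same way.\<close>

lemma truncated_sum_alternates:
  assumes "finite P" "\<And>p. p \<in> P \<Longrightarrow> 0 \<le> g p \<and> g p \<le> 1"
  shows "0 \<le> (-1) ^ m * (truncated_sum g m P - (\<Prod>p\<in>P. 1 - g p))"
  using assms
proof (induction P arbitrary: m rule: finite_induct)
  case empty
  have "{S. S \<subseteq> {} \<and> card S \<le> m} = {{}::'a set}" by auto
  thus ?case by (simp add: truncated_sum_def)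
next
  case (insert p P)
  show ?case
  proof (cases m)
    case 0
    have "(\<Prod>p\<in>insert p P. 1 - g p) \<le> 1"
      using insert.prems by (intro prod_le_1) auto
    thus ?thesis using 0 insert.hyps by simp
  next
    case (Suc k)
    have "0 \<le> (-1) ^ Suc k * (truncated_sum g (Suc k) P - (\<Prod>p\<in>P. 1 - g p))"
         "0 \<le> g p * ((-1) ^ k * (truncated_sum g k P - (\<Prod>p\<in>P. 1 - g p)))"
      using insert by (auto intro!: mult_nonneg_nonneg simp del: power_Suc)
    thus ?thesis using Suc insert.hyps
      by (simp add: truncated_sum_insert algebra_simps)
  qed
qed

text \<open>Each set of size \<open>m\<close> occurs \<open>m!\<close> times, as ordered tuples, in
  the expanded power. For the induction the two lowest terms in \<open>g p\<close> of the binomial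
  expansion suffice (\<open>tangent\<close>).\<close>

lemma elem_sym_le:
  assumes "finite P" "\<And>p. p \<in> P \<Longrightarrow> 0 \<le> g p"
  shows "elem_sym g m P \<le> (\<Sum>p\<in>P. g p) ^ m / fact m"
  using assms
proof (induction P arbitrary: m rule: finite_induct)
  case empty
  show ?case
  proof (cases m)
    case (Suc k)
    have "{S. S \<subseteq> {} \<and> card S = m} = ({}::'a set set)" using Suc by auto
    thus ?thesis by (simp only: elem_sym_def) simp
  qed simp
next
  case (insert p P)
  show ?case
  proof (cases m)
    case (Suc k)
    define x where "x = (\<Sum>p\<in>P. g p)"
    have nn: "0 \<le> x" "0 \<le> g p" unfolding x_def using insert.prems by (auto intro: sum_nonneg)
    have tangent: "x ^ Suc k + real (Suc k) * g p * x ^ k \<le> (g p + x) ^ Suc k"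
    proof (induction k)
      case (Suc k)
      have "x ^ Suc (Suc k) + real (Suc (Suc k)) * g p * x ^ Suc k
          \<le> (g p + x) * (x ^ Suc k + real (Suc k) * g p * x ^ k)"
        using nn by (simp add: algebra_simps)
      also have "\<dots> \<le> (g p + x) * (g p + x) ^ Suc k"
        using Suc nn by (intro mult_left_mono) auto
      finally show ?case by simp
    qed simp
    have "elem_sym g m (insert p P) = elem_sym g (Suc k) P + g p * elem_sym g k P"
      using insert.hyps Suc by (simp add: elem_sym_insert)
    also have "\<dots> \<le> x ^ Suc k / fact (Suc k) + g p * (x ^ k / fact k)"
      unfolding x_def using insert.IH[of "Suc k"] insert.IH[of k] insert.prems
      by (intro add_mono mult_left_mono) (simp_all del: power_Suc fact_Suc)
    also have "\<dots> = (x ^ Suc k + real (Suc k) * g p * x ^ k) / fact (Suc k)"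
      by (simp add: field_simps del: power_Suc of_nat_Suc)
    also have "\<dots> \<le> (g p + x) ^ Suc k / fact (Suc k)"
      using tangent by (intro divide_right_mono) auto
    finally show ?thesis using Suc insert.hyps by (simp add: x_def)
  qed (use insert.hyps in simp)
qed

lemma truncated_sum_Suc:
  assumes "finite P"
  shows "truncated_sum g (Suc m) P = truncated_sum g m P + (-1) ^ Suc m * elem_sym g (Suc m) P"
proof -
  have "{S. S \<subseteq> P \<and> card S \<le> Suc m} = {S. S \<subseteq> P \<and> card S \<le> m} \<union> {S. S \<subseteq> P \<and> card S = Suc m}"
    by auto
  hence "truncated_sum g (Suc m) P = truncated_sum g m P
      + (\<Sum>S | S \<subseteq> P \<and> card S = Suc m. \<Prod>p\<in>S. - g p)"
    unfolding truncated_sum_def using assms by (subst sum.union_disjoint [symmetric]) auto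
  also have "(\<Sum>S | S \<subseteq> P \<and> card S = Suc m. \<Prod>p\<in>S. - g p) = (-1) ^ Suc m * elem_sym g (Suc m) P"
    unfolding elem_sym_def sum_distrib_left
    by (intro sum.cong refl) (auto simp: prod_uminus)
  finally show ?thesis .
qed

text \<open>The next, odd truncation lies below the product and differs from the even one by a
  single elementary symmetric sum, which therefore bounds the overshoot.\<close>

lemma truncated_sum_even_le:
  assumes "finite P" "\<And>p. p \<in> P \<Longrightarrow> 0 \<le> g p \<and> g p \<le> 1"
  shows "truncated_sum g (2 * k) P
    \<le> (\<Prod>p\<in>P. 1 - g p) + (\<Sum>p\<in>P. g p) ^ Suc (2 * k) / fact (Suc (2 * k))"
  using truncated_sum_alternates[OF assms, where m = "Suc (2 * k)"] elem_sym_le[of P g, where m = "Suc (2 * k)"]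
    truncated_sum_Suc[OF assms(1), where m = "2 * k" and g = g] assms by force

lemma truncated_sum_even_ge:
  assumes "finite P" "\<And>p. p \<in> P \<Longrightarrow> 0 \<le> g p \<and> g p \<le> 1"
  shows "(\<Prod>p\<in>P. 1 - g p) \<le> truncated_sum g (2 * k) P"
  using truncated_sum_alternates[OF assms, where m = "2 * k"] by simp

text \<open>The even bound \<open>2 * k j\<close> makes the truncated sum of each block an upper
  bound, hence nonnegative; only such bounds may be multiplied over the blocks.\<close>

definition block_family :: "(nat \<Rightarrow> 'a set) \<Rightarrow> (nat \<Rightarrow> nat) \<Rightarrow> nat \<Rightarrow> 'a set set" where
  "block_family P k R = {S. S \<subseteq> (\<Union>j<R. P j) \<and> (\<forall>j<R. card (S \<inter> P j) \<le> 2 * k j)}"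

lemma finite_block_family [simp]: "(\<And>j. finite (P j)) \<Longrightarrow> finite (block_family P k R)"
  unfolding block_family_def by (rule finite_subset[of _ "Pow (\<Union>j<R. P j)"]) auto

text \<open>Multiplying out: a member of the family is determined by its traces on the disjoint
  blocks.\<close>

lemma sum_block_family:
  assumes "\<And>j. finite (P j)" "\<And>i j. i \<noteq> j \<Longrightarrow> P i \<inter> P j = {}"
  shows "(\<Sum>S\<in>block_family P k R. \<Prod>p\<in>S. - g p) = (\<Prod>j<R. truncated_sum g (2 * k j) (P j))"
proof (induction R)
  case 0
  have "block_family P k 0 = {{}}" by (auto simp: block_family_def)
  thus ?case by simp
next
  case (Suc R)
  let ?B = "{S. S \<subseteq> P R \<and> card S \<le> 2 * k R}"
  have disj: "P j \<inter> P R = {}" if "j < R" for j using assms(2) that by auto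
  have "(\<Prod>j<Suc R. truncated_sum g (2 * k j) (P j))
      = (\<Sum>S\<in>block_family P k R. \<Prod>p\<in>S. - g p) * (\<Sum>S\<in>?B. \<Prod>p\<in>S. - g p)"
    by (simp add: Suc truncated_sum_def)
  also have "\<dots> = (\<Sum>(S, U)\<in>block_family P k R \<times> ?B. (\<Prod>p\<in>S. - g p) * (\<Prod>p\<in>U. - g p))"
    by (simp add: sum_product sum.cartesian_product)
  also have "\<dots> = (\<Sum>S\<in>block_family P k (Suc R). \<Prod>p\<in>S. - g p)"
  proof (rule sum.reindex_bij_witness[where i = "\<lambda>S. (S \<inter> (\<Union>j<R. P j), S \<inter> P R)"
        and j = "\<lambda>(S, U). S \<union> U"])
    fix a assume "a \<in> block_family P k R \<times> ?B"
    then obtain S U where a: "a = (S, U)" and S: "S \<subseteq> (\<Union>j<R. P j)"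
        "\<And>j. j < R \<Longrightarrow> card (S \<inter> P j) \<le> 2 * k j" and U: "U \<subseteq> P R" "card U \<le> 2 * k R"
      by (auto simp: block_family_def)
    have SR: "S \<inter> P R = {}" using S(1) disj by blast
    have Uj: "U \<inter> P j = {}" if "j < R" for j using U(1) disj[OF that] by blast
    have UU: "U \<inter> (\<Union>j<R. P j) = {}" using Uj by blast
    show "((case a of (S, U) \<Rightarrow> S \<union> U) \<inter> (\<Union>j<R. P j), (case a of (S, U) \<Rightarrow> S \<union> U) \<inter> P R) = a"
      using SR UU S(1) U(1) unfolding a by auto
    have "card ((S \<union> U) \<inter> P j) \<le> 2 * k j" if "j < Suc R" for j
    proof (cases "j = R")
      case True
      have "(S \<union> U) \<inter> P R = U" using SR U by blast
      thus ?thesis using True U by simp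
    next
      case False
      hence "(S \<union> U) \<inter> P j = S \<inter> P j" using Uj[of j] that by auto
      thus ?thesis using S(2)[of j] False that by simp
    qed
    thus "(case a of (S, U) \<Rightarrow> S \<union> U) \<in> block_family P k (Suc R)"
      using S(1) U(1) unfolding a block_family_def by (auto simp: lessThan_Suc)
    have "finite S" "finite U" using S(1) U(1) assms(1)
      by (auto intro: finite_subset[OF S(1)] finite_subset[OF U(1)])
    thus "(\<Prod>p\<in>(case a of (S, U) \<Rightarrow> S \<union> U). - g p)
        = (case a of (S, U) \<Rightarrow> (\<Prod>p\<in>S. - g p) * (\<Prod>p\<in>U. - g p))"
      unfolding a using SR U(1) by (simp, intro prod.union_disjoint) auto
  next
    fix S assume "S \<in> block_family P k (Suc R)"
    hence S: "S \<subseteq> (\<Union>j<Suc R. P j)" "\<And>j. j < Suc R \<Longrightarrow> card (S \<inter> P j) \<le> 2 * k j"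
      by (auto simp: block_family_def)
    show "(case (S \<inter> (\<Union>j<R. P j), S \<inter> P R) of (S, U) \<Rightarrow> S \<union> U) = S"
      using S(1) by (auto simp: lessThan_Suc)
    have "S \<inter> (\<Union>j<R. P j) \<inter> P j = S \<inter> P j" if "j < R" for j using that by auto
    thus "(S \<inter> (\<Union>j<R. P j), S \<inter> P R) \<in> block_family P k R \<times> ?B"
      using S(2) by (auto simp: block_family_def)
  qed
  finally show ?case by simp
qed

text \<open>Controls the size of the moduli to which equidistribution will be applied.\<close>

lemma prod_block_family_le:
  fixes y :: "nat \<Rightarrow> nat" and P :: "nat \<Rightarrow> nat set"
  assumes "S \<in> block_family P k R" "\<And>j. finite (P j)" "\<And>i j. i \<noteq> j \<Longrightarrow> P i \<inter> P j = {}"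
    and "\<And>j p. p \<in> P j \<Longrightarrow> p \<le> y j" "\<And>j. 1 \<le> y j"
  shows "\<Prod>S \<le> (\<Prod>j<R. y j ^ (2 * k j))"
proof -
  have S: "S \<subseteq> (\<Union>j<R. P j)" "\<And>j. j < R \<Longrightarrow> card (S \<inter> P j) \<le> 2 * k j"
    using assms(1) by (auto simp: block_family_def)
  have "S = (\<Union>j<R. S \<inter> P j)" using S(1) by auto
  hence "\<Prod>S = \<Prod>(\<Union>j<R. S \<inter> P j)" by simp
  also have "\<dots> = (\<Prod>j<R. \<Prod>(S \<inter> P j))"
    using assms(2,3) by (subst prod.UNION_disjoint) auto
  also have "\<dots> \<le> (\<Prod>j<R. y j ^ (2 * k j))"
  proof (intro prod_mono conjI)
    fix j assume "j \<in> {..<R}"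
    have "\<Prod>(S \<inter> P j) \<le> (\<Prod>p\<in>S \<inter> P j. y j)"
      using assms(4) by (intro prod_mono) auto
    also have "\<dots> = y j ^ card (S \<inter> P j)" by simp
    also have "\<dots> \<le> y j ^ (2 * k j)"
      using S(2)[of j] assms(5)[of j] \<open>j \<in> {..<R}\<close> by (intro power_increasing) auto
    finally show "\<Prod>(S \<inter> P j) \<le> y j ^ (2 * k j)" .
  qed simp
  finally show ?thesis .
qed

subsection \<open>Perturbing sums of multiplicative type; Shiu's decomposition\<close>

lemma multiplicity_mult_prime_power_other:
  assumes "prime (p::nat)" "prime q" "p \<noteq> q" "m > 0"
  shows "multiplicity q (m * p ^ e) = multiplicity q m"
  using assms by (subst prime_elem_multiplicity_mult_distrib)
    (auto simp: multiplicity_distinct_prime_power)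

text \<open>The twist is introduced one prime at a time. With \<open>d = m * p ^ e\<close> and
  \<open>p\<close> not dividing \<open>m\<close>, the excess \<open>\<gamma> p e - 1\<close> is
  charged to \<open>m\<close>, which lies in \<open>D\<close> again by \<open>closed\<close>, so
  that \<open>p\<close> costs one factor. Only an upper bound for \<open>u (m * p ^ e)\<close>
  enters, as \<open>f\<close> is merely submultiplicative.\<close>

lemma sum_perturb:
  fixes u :: "nat \<Rightarrow> real" and \<phi> \<gamma> :: "nat \<Rightarrow> nat \<Rightarrow> real"
  assumes "finite P" "\<And>p. p \<in> P \<Longrightarrow> prime p" "finite D" "0 \<notin> D"
    and closed: "\<And>p d. prime p \<Longrightarrow> d \<in> D \<Longrightarrow> d div p ^ multiplicity p d \<in> D"
    and "\<And>d. d \<in> D \<Longrightarrow> 0 \<le> u d"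
    and u_le: "\<And>p m e. prime p \<Longrightarrow> m \<in> D \<Longrightarrow> 0 < e \<Longrightarrow> \<not> p dvd m \<Longrightarrow> u (m * p ^ e) \<le> u m * \<phi> p e"
    and "\<And>p e. prime p \<Longrightarrow> 0 < e \<Longrightarrow> 0 \<le> \<phi> p e"
    and "\<And>p e. prime p \<Longrightarrow> 1 \<le> \<gamma> p e" "\<And>p. \<gamma> p 0 = 1"
    and n: "\<And>p d. prime p \<Longrightarrow> d \<in> D \<Longrightarrow> multiplicity p d \<le> n"
  shows "(\<Sum>d\<in>D. u d * (\<Prod>p\<in>P. \<gamma> p (multiplicity p d)))
    \<le> (\<Prod>p\<in>P. 1 + (\<Sum>e=1..n. \<phi> p e * (\<gamma> p e - 1))) * (\<Sum>d\<in>D. u d)"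
  using assms(1,2)
proof (induction P rule: finite_induct)
  case (insert p P)
  define G where "G d = (\<Prod>p\<in>P. \<gamma> p (multiplicity p d))" for d
  have p: "prime p" using insert.prems by simp
  have G_ge: "1 \<le> G d" for d unfolding G_def using assms(9) insert.prems by (intro prod_ge_1) auto
  define t where "t = (\<Sum>e=1..n. \<phi> p e * (\<gamma> p e - 1))"
  have t0: "0 \<le> t" unfolding t_def using assms(8)[OF p] assms(9)[OF p]
    by (intro sum_nonneg mult_nonneg_nonneg) auto
  let ?D = "{d\<in>D. p dvd d}"
  have "(\<Sum>d\<in>?D. u d * G d * (\<gamma> p (multiplicity p d) - 1))
      \<le> (\<Sum>(e, m)\<in>{1..n} \<times> D. (\<phi> p e * (\<gamma> p e - 1)) * (u m * G m))"
  \<comment> \<open>The right-hand side runs over all pairs, including those with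
    \<open>m * p ^ e\<close> outside \<open>D\<close> or \<open>p\<close> dividing \<open>m\<close>;
    this is harmless because its terms are nonnegative.\<close>
  proof (rule sum_le_included[where i = "\<lambda>(e, m). m * p ^ e"])
    show "\<forall>y\<in>{1..n} \<times> D. 0 \<le> (case y of (e, m) \<Rightarrow> \<phi> p e * (\<gamma> p e - 1) * (u m * G m))"
    proof clarify
      fix e m assume "e \<in> {1..n}" "m \<in> D"
      thus "0 \<le> \<phi> p e * (\<gamma> p e - 1) * (u m * G m)"
        using assms(6)[of m] assms(8)[OF p, of e] assms(9)[OF p, of e] G_ge[of m]
        by (intro mult_nonneg_nonneg) auto
    qed
    show "\<forall>d\<in>?D. \<exists>y\<in>{1..n} \<times> D. (case y of (e, m) \<Rightarrow> m * p ^ e) = d \<and>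
        u d * G d * (\<gamma> p (multiplicity p d) - 1)
          \<le> (case y of (e, m) \<Rightarrow> \<phi> p e * (\<gamma> p e - 1) * (u m * G m))"
    proof
      fix d assume d: "d \<in> ?D"
      define e m where "e = multiplicity p d" and "m = d div p ^ e"
      have d0: "d \<noteq> 0" using d assms(4) by (cases "d = 0") auto
      have dm: "d = m * p ^ e" by (simp add: m_def e_def multiplicity_dvd)
      have m0: "m > 0" using d0 dm by (cases m) auto
      have pm: "\<not> p dvd m" unfolding m_def e_def
        using d0 p by (intro multiplicity_decompose) auto
      have e: "e \<in> {1..n}"
        using n[OF p, of d] d d0 p by (auto simp: e_def Suc_le_eq prime_multiplicity_gt_zero_iff intro!: Nat.gr0I)
      have mD: "m \<in> D" unfolding m_def e_def using closed[OF p] d by auto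
      have "G d = G m" unfolding G_def dm using insert m0
        by (intro prod.cong refl) (metis multiplicity_mult_prime_power_other insertCI)
      moreover have "u d \<le> u m * \<phi> p e" unfolding dm using u_le[OF p mD] e pm by auto
      ultimately have "u d * G d * (\<gamma> p e - 1) \<le> (u m * \<phi> p e) * G m * (\<gamma> p e - 1)"
        using G_ge[of m] assms(9)[OF p, of e] by (intro mult_right_mono) auto
      hence le: "u d * G d * (\<gamma> p (multiplicity p d) - 1) \<le> \<phi> p e * (\<gamma> p e - 1) * (u m * G m)"
        by (simp add: e_def[symmetric] mult_ac)
      show "\<exists>y\<in>{1..n} \<times> D. (case y of (e, m) \<Rightarrow> m * p ^ e) = d \<and>
        u d * G d * (\<gamma> p (multiplicity p d) - 1)
          \<le> (case y of (e, m) \<Rightarrow> \<phi> p e * (\<gamma> p e - 1) * (u m * G m))"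
        by (rule bexI[of _ "(e, m)"]) (use e mD le dm[symmetric] in simp_all)
    qed
  qed (use assms(3) in auto)
  also have "\<dots> = t * (\<Sum>d\<in>D. u d * G d)"
    unfolding t_def by (simp add: sum_product sum.cartesian_product)
  finally have *: "(\<Sum>d\<in>?D. u d * G d * (\<gamma> p (multiplicity p d) - 1)) \<le> t * (\<Sum>d\<in>D. u d * G d)" .
  have "(\<Sum>d\<in>D. u d * (\<Prod>p\<in>insert p P. \<gamma> p (multiplicity p d)))
      = (\<Sum>d\<in>D. u d * G d + u d * G d * (\<gamma> p (multiplicity p d) - 1))"
    using insert.hyps by (intro sum.cong refl) (simp add: G_def algebra_simps)
  \<comment> \<open>For \<open>d\<close> prime to \<open>p\<close> the twist is
    \<open>\<gamma> p 0 = 1\<close>, so the excess lives on the multiples of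
    \<open>p\<close>.\<close>
  also have "\<dots> = (\<Sum>d\<in>D. u d * G d) + (\<Sum>d\<in>?D. u d * G d * (\<gamma> p (multiplicity p d) - 1))"
    unfolding sum.distrib using assms(3,10)
    by (intro arg_cong2[where f = "(+)"] refl sum.mono_neutral_right)
      (auto simp: not_dvd_imp_multiplicity_0)
  also have "\<dots> \<le> (1 + t) * (\<Sum>d\<in>D. u d * G d)" using * by (simp add: algebra_simps)
  also have "\<dots> \<le> (1 + t) * ((\<Prod>p\<in>P. 1 + (\<Sum>e=1..n. \<phi> p e * (\<gamma> p e - 1))) * (\<Sum>d\<in>D. u d))"
    using insert t0 unfolding G_def by (intro mult_left_mono) auto
  also have "\<dots> = (\<Prod>p\<in>insert p P. 1 + (\<Sum>e=1..n. \<phi> p e * (\<gamma> p e - 1))) * (\<Sum>d\<in>D. u d)"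
    using insert.hyps by (simp add: t_def mult.assoc)
  finally show ?case .
qed simp

section \<open>Elementary sums over integers and primes\<close>

lemma sum_inverse_squares_le: "(\<Sum>n=1..N. 1 / (real n)\<^sup>2) \<le> 2 - 1 / real N"
proof (induction N)
  case (Suc N)
  show ?case
  proof (cases "N = 0")
    case False
    have "1 / (real (Suc N))\<^sup>2 \<le> 1 / (real N * real (Suc N))"
      using False by (intro divide_left_mono) (auto simp: power2_eq_square)
    also have "\<dots> = 1 / real N - 1 / real (Suc N)"
      using False by (simp add: field_simps)
    finally have "1 / (real (Suc N))\<^sup>2 \<le> 1 / real N - 1 / real (Suc N)" .
    thus ?thesis using Suc by simp
  qed simp
qed simp

lemma sum_primes_inverse_square_le:
  assumes "finite P" "\<And>p. p \<in> P \<Longrightarrow> prime (p::nat)"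
  shows "(\<Sum>p\<in>P. 1 / (real p)\<^sup>2) \<le> 2"
proof -
  obtain N where N: "P \<subseteq> {..N}" using assms(1) finite_nat_set_iff_bounded_le by (metis atMost_iff subsetI)
  have "(\<Sum>p\<in>P. 1 / (real p)\<^sup>2) \<le> (\<Sum>n=1..N. 1 / (real n)\<^sup>2)"
    using N assms prime_ge_1_nat by (intro sum_mono2) auto
  also have "\<dots> \<le> 2" using sum_inverse_squares_le[of N] by (smt (verit) divide_nonneg_nonneg of_nat_0_le_iff)
  finally show ?thesis .
qed

lemma card_multiples_ge:
  assumes "0 < p" "p \<le> n"
  shows "real n / (2 * real p) \<le> real (card {m\<in>{1..n}. p dvd m})"
proof -
  have "(\<lambda>i. i * p) ` {1..n div p} \<subseteq> {m\<in>{1..n}. p dvd m}"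
    using assms by (auto simp: less_eq_div_iff_mult_less_eq)
  hence "card ((\<lambda>i. i * p) ` {1..n div p}) \<le> card {m\<in>{1..n}. p dvd m}"
    by (intro card_mono) auto
  moreover have "card ((\<lambda>i. i * p) ` {1..n div p}) = n div p"
    using assms by (subst card_image) (auto simp: inj_on_def)
  ultimately have "n div p \<le> card {m\<in>{1..n}. p dvd m}" by simp
  moreover have "n \<le> 2 * p * (n div p)"
  proof -
    have "n = p * (n div p) + n mod p" by simp
    moreover have "n mod p < p" using assms by simp
    moreover have "1 \<le> n div p" using assms by (simp add: Suc_le_eq div_greater_zero_iff)
    hence "p * 1 \<le> p * (n div p)" by (intro mult_le_mono2)
    ultimately show ?thesis by linarith
  qed
  ultimately have "n \<le> 2 * p * card {m\<in>{1..n}. p dvd m}"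
    by (meson le_trans mult_le_mono2)
  hence "real n \<le> real (2 * p * card {m\<in>{1..n}. p dvd m})" by (simp only: of_nat_le_iff)
  thus ?thesis using assms by (simp add: divide_le_eq mult_ac)
qed

text \<open>
  Chebyshev's double count of \<open>\<Sum>m\<le>n. ln m\<close>, which only needs \<open>n div p \<ge> n / (2 p)\<close>.
\<close>

lemma sum_ln_prime_div_le:
  assumes "1 \<le> (n::nat)"
  shows "(\<Sum>p | prime p \<and> p \<le> n. ln (real p) / real p) \<le> 2 * ln (real n)"
proof -
  let ?P = "{p. prime p \<and> p \<le> n}"
  have fin: "finite ?P" by simp
  have "(\<Sum>p\<in>?P. ln (real p) * (real n / (2 * real p)))
      \<le> (\<Sum>p\<in>?P. ln (real p) * real (card {m\<in>{1..n}. p dvd m}))"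
    using card_multiples_ge prime_gt_0_nat prime_ge_1_nat
    by (intro sum_mono mult_left_mono) (auto intro!: ln_ge_zero)
  also have "\<dots> = (\<Sum>p\<in>?P. \<Sum>m\<in>{1..n}. if p dvd m then ln (real p) else 0)"
    by (intro sum.cong refl) (simp add: sum.inter_filter[symmetric])
  also have "\<dots> = (\<Sum>m\<in>{1..n}. \<Sum>p\<in>?P. if p dvd m then ln (real p) else 0)"
    by (rule sum.swap)
  also have "\<dots> \<le> (\<Sum>m\<in>{1..n}. ln (real n))"
  proof (intro sum_mono)
    fix m assume m: "m \<in> {1..n}"
    have eq: "{p\<in>?P. p dvd m} = prime_factors m"
      using m by (auto simp: prime_factors_dvd dest: dvd_imp_le)
    have "(\<Sum>p\<in>?P. if p dvd m then ln (real p) else 0) = (\<Sum>p\<in>prime_factors m. ln (real p))"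
      unfolding eq[symmetric] by (subst sum.inter_filter) auto
    also have "\<dots> = ln (real (\<Prod>(prime_factors m)))"
      using prime_gt_0_nat by (subst of_nat_prod, subst ln_prod) (auto dest: in_prime_factors_imp_prime)
    also have "\<Prod>(prime_factors m) \<le> (\<Prod>p\<in>prime_factors m. p ^ multiplicity p m)"
    proof (intro prod_mono conjI)
      fix p assume "p \<in> prime_factors m"
      hence "prime p" "1 \<le> multiplicity p m"
        using prime_factors_multiplicity[of m] by auto
      thus "p \<le> p ^ multiplicity p m" using prime_ge_1_nat[of p]
        by (metis power_increasing power_one_right)
    qed simp
    hence "ln (real (\<Prod>(prime_factors m))) \<le> ln (real m)"
      using m prime_gt_0_nat prime_factorization_nat[of m]
      by (subst ln_le_cancel_iff) (auto intro!: prod_pos dest: in_prime_factors_imp_prime simp del: of_nat_prod)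
    also have "\<dots> \<le> ln (real n)" using m by simp
    finally show "(\<Sum>p\<in>?P. if p dvd m then ln (real p) else 0) \<le> ln (real n)" by simp
  qed
  also have "\<dots> = real n * ln (real n)" by simp
  finally have "(real n / 2) * (\<Sum>p\<in>?P. ln (real p) / real p) \<le> (real n / 2) * (2 * ln (real n))"
    by (simp add: sum_distrib_left mult_ac)
  thus ?thesis using assms by (subst (asm) mult_le_cancel_left_pos) auto
qed

section \<open>Cutting an integer at a given size of its primes\<close>

definition below_part :: "nat \<Rightarrow> nat \<Rightarrow> nat" where
  "below_part q c = (\<Prod>p | p \<in> prime_factors c \<and> p < q. p ^ multiplicity p c)"

text \<open>Because \<open>below_part\<close> takes full prime powers, the cofactor is coprime to
  it, as the growth condition on \<open>f\<close> demands.\<close>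

lemma below_part_decompose:
  assumes "c > 0"
  obtains b where "c = below_part q c * b" "coprime (below_part q c) b"
    "\<And>p. prime p \<Longrightarrow> p dvd b \<Longrightarrow> q \<le> p"
proof -
  let ?L = "{p\<in>prime_factors c. p < q}" and ?H = "{p\<in>prime_factors c. \<not> p < q}"
  define b where "b = (\<Prod>p\<in>?H. p ^ multiplicity p c)"
  have "c = (\<Prod>p\<in>prime_factors c. p ^ multiplicity p c)"
    using assms by (rule prime_factorization_nat)
  also have "prime_factors c = ?L \<union> ?H" by auto
  also have "(\<Prod>p\<in>?L \<union> ?H. p ^ multiplicity p c) = below_part q c * b"
    unfolding below_part_def b_def by (intro prod.union_disjoint) auto
  finally have "c = below_part q c * b" .
  moreover have "coprime (below_part q c) b"
    unfolding below_part_def b_def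
    by (intro prod_coprime_left prod_coprime_right)
      (auto intro!: primes_coprime dest: in_prime_factors_imp_prime)
  moreover have "q \<le> p" if p: "prime p" "p dvd b" for p
  proof -
    obtain r where r: "r \<in> ?H" "p dvd r ^ multiplicity r c"
      using p unfolding b_def by (subst (asm) prime_dvd_prod_iff) auto
    hence "p = r" using p(1) by (metis (mono_tags, lifting) in_prime_factors_imp_prime mem_Collect_eq prime_dvd_power primes_dvd_imp_eq)
    thus ?thesis using r by auto
  qed
  ultimately show ?thesis using that by blast
qed

lemma prime_dvd_below_part:
  assumes "prime p" "p dvd below_part q c"
  shows "p < q"
proof -
  obtain r where r: "r \<in> prime_factors c" "r < q" "p dvd r ^ multiplicity r c"
    using assms unfolding below_part_def by (subst (asm) prime_dvd_prod_iff) auto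
  hence "p = r" using assms(1) by (metis in_prime_factors_imp_prime prime_dvd_power primes_dvd_imp_eq)
  thus ?thesis using r by simp
qed

lemma below_part_Suc:
  "below_part (Suc q) c = below_part q c * (if q \<in> prime_factors c then q ^ multiplicity q c else 1)"
proof (cases "q \<in> prime_factors c")
  case True
  have "{p. p \<in> prime_factors c \<and> p < Suc q} = insert q {p. p \<in> prime_factors c \<and> p < q}"
    using True by auto
  thus ?thesis using True by (simp add: below_part_def mult.commute)
next
  case False
  hence "{p. p \<in> prime_factors c \<and> p < Suc q} = {p. p \<in> prime_factors c \<and> p < q}"
    using less_Suc_eq by auto
  thus ?thesis using False by (simp add: below_part_def)
qed

text \<open>Counts the primes below \<open>q\<close> by the integers below \<open>w\<close>. This is
  crude but enough, as \<open>w\<close> will be a constant, and it yields the third alternative of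
  the decomposition.\<close>

lemma below_part_le_power:
  fixes Y :: real
  assumes "1 \<le> Y" "q \<le> w" "\<And>p. prime p \<Longrightarrow> p < q \<Longrightarrow> real (p ^ multiplicity p c) \<le> Y"
  shows "real (below_part q c) \<le> Y ^ w"
proof -
  let ?L = "{p. p \<in> prime_factors c \<and> p < q}"
  have "real (below_part q c) = (\<Prod>p\<in>?L. real (p ^ multiplicity p c))"
    by (simp add: below_part_def)
  also have "\<dots> \<le> (\<Prod>p\<in>?L. Y)"
    using assms(3) by (intro prod_mono) (auto dest: in_prime_factors_imp_prime)
  also have "\<dots> = Y ^ card ?L" by simp
  also have "\<dots> \<le> Y ^ w"
  proof (intro power_increasing)
    have "card ?L \<le> card {..<q}" by (intro card_mono) auto
    thus "card ?L \<le> w" using assms(2) by simp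
  qed (use assms(1) in auto)
  finally show ?thesis .
qed

lemma level_exists:
  assumes "2 \<le> (w::nat)" "w \<le> q" "q < w ^ 2 ^ R"
  shows "\<exists>r<R. w ^ 2 ^ r \<le> q \<and> q < w ^ 2 ^ Suc r"
  using assms(3)
proof (induction R)
  case (Suc R)
  show ?case
  proof (cases "q < w ^ 2 ^ R")
    case True
    thus ?thesis using Suc.IH less_SucI by blast
  next
    case False
    thus ?thesis using Suc.prems by (intro exI[of _ R]) auto
  qed
qed (use assms in simp)

text \<open>
  Shiu's decomposition: the primes of \<open>c\<close> are taken in increasing order for as long as the
  product of their full powers stays below \<open>Z\<close>.
\<close>

lemma shiu_decomposition:
  fixes Z :: real and c w R :: nat
  assumes "c > 0" "1 \<le> Z" "2 \<le> w"
  shows "(\<exists>d b. c = d * b \<and> coprime d b \<and> real d \<le> Z \<and> (\<forall>p. prime p \<longrightarrow> p dvd b \<longrightarrow> w ^ 2 ^ R \<le> p)) \<or>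
    (\<exists>q e. prime q \<and> q < w ^ 2 ^ R \<and> q ^ e dvd c \<and> sqrt Z < real (q ^ e)) \<or>
    (\<exists>q e. prime q \<and> q < w \<and> q ^ e dvd c \<and> Z powr (1 / (2 * real w)) < real (q ^ e)) \<or>
    (\<exists>r<R. \<exists>d b. c = d * b \<and> coprime d b \<and> sqrt Z < real d \<and> real d \<le> Z \<and>
      (\<forall>p. prime p \<longrightarrow> p dvd d \<longrightarrow> p < w ^ 2 ^ Suc r) \<and> (\<forall>p. prime p \<longrightarrow> p dvd b \<longrightarrow> w ^ 2 ^ r \<le> p))"
    (is "?I \<or> ?II \<or> ?III \<or> ?IV")
proof (cases "real c \<le> Z")
  case True
  hence ?I by (intro exI[of _ c] exI[of _ 1]) (auto dest: prime_gt_1_nat)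
  thus ?thesis by blast
next
  case False
  have "below_part (Suc c) c = c"
  proof -
    have "{p. p \<in> prime_factors c \<and> p < Suc c} = prime_factors c"
      using assms(1) by (auto simp: prime_factors_dvd dest: dvd_imp_le)
    thus ?thesis using prime_factorization_nat[OF assms(1)] by (simp add: below_part_def)
  qed
  hence ex: "Z < real (below_part (Suc c) c)" using False by simp
  \<comment> \<open>The least cut-off at which the part below it exceeds \<open>Z\<close>. Its
    predecessor \<open>q\<close> has to be a prime factor of \<open>c\<close>, since
    \<open>below_part\<close> changes only there.\<close>
  define y where "y = (LEAST y. Z < real (below_part y c))"
  have y: "Z < real (below_part y c)" unfolding y_def using ex by (rule LeastI)
  have "y \<noteq> 0" using y assms(2) by (intro notI) (simp add: below_part_def)
  then obtain q where q: "y = Suc q" by (cases y) auto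
  define d where "d = below_part q c"
  have dZ: "real d \<le> Z" unfolding d_def using not_less_Least[of q "\<lambda>y. Z < real (below_part y c)"] q y_def by auto
  have qc: "q \<in> prime_factors c" and dq: "Z < real d * real (q ^ multiplicity q c)"
    using y dZ unfolding q below_part_Suc d_def by (auto split: if_splits)
  have pq: "prime q" using qc by (rule in_prime_factors_imp_prime)
  obtain b where b: "c = d * b" "coprime d b" "\<And>p. prime p \<Longrightarrow> p dvd b \<Longrightarrow> q \<le> p"
    using below_part_decompose[OF assms(1), of q] unfolding d_def by metis
  have dvd: "p ^ multiplicity p c dvd c" for p by (rule multiplicity_dvd)
  show ?thesis
  proof (cases "w ^ 2 ^ R \<le> q")
    case True
    hence ?I using b dZ by (intro exI[of _ d] exI[of _ b]) (auto intro: le_trans)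
    thus ?thesis by blast
  next
    case qR: False
    show ?thesis
    \<comment> \<open>As \<open>d\<close> times the full power of \<open>q\<close> exceeds
      \<open>Z\<close>, one of the two factors exceeds \<open>sqrt Z\<close>.\<close>
    proof (cases "real d \<le> sqrt Z")
      case True
      have "sqrt Z * sqrt Z < sqrt Z * real (q ^ multiplicity q c)"
        using dq mult_right_mono[OF True, of "real (q ^ multiplicity q c)"] assms(2) by simp
      hence "sqrt Z < real (q ^ multiplicity q c)" using assms(2) by (subst (asm) mult_less_cancel_left_pos) auto
      hence ?II using pq qR dvd[of q] by (intro exI[of _ q] exI[of _ "multiplicity q c"]) auto
      thus ?thesis by blast
    next
      case dlarge: False
      show ?thesis
      proof (cases "q < w")
        case True
        \<comment> \<open>Chosen so that \<open>?Y ^ w = sqrt Z\<close>: if every prime power below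
          \<open>q\<close> stayed under it, \<open>d\<close> would be at most
          \<open>sqrt Z\<close>.\<close>
        let ?Y = "Z powr (1 / (2 * real w))"
        have "?III"
        proof (rule ccontr)
          assume no: "\<not> ?III"
          have "real d \<le> ?Y ^ w" unfolding d_def
          proof (rule below_part_le_power)
            show "1 \<le> ?Y" using assms(2) by (simp add: ge_one_powr_ge_zero)
            show "real (p ^ multiplicity p c) \<le> ?Y" if "prime p" "p < q" for p
              using no that True dvd[of p] by (metis less_trans not_le)
          qed (use True in simp)
          also have "?Y ^ w = sqrt Z"
            using assms by (simp add: powr_power powr_half_sqrt)
          finally show False using dlarge by simp
        qed
        thus ?thesis by blast
      next
        case False
        then obtain r where r: "r < R" "w ^ 2 ^ r \<le> q" "q < w ^ 2 ^ Suc r"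
          using level_exists[of w q R] assms(3) qR by auto
        have "p < w ^ 2 ^ Suc r" if "prime p" "p dvd d" for p
          using prime_dvd_below_part[of p q c] that r unfolding d_def by linarith
        moreover have "w ^ 2 ^ r \<le> p" if "prime p" "p dvd b" for p
          using b(3)[OF that] r by linarith
        ultimately have ?IV using r(1) b(1,2) dlarge dZ
          by (intro exI[of _ r] conjI exI[of _ d] exI[of _ b]) auto
        thus ?thesis by blast
      qed
    qed
  qed
qed

subsection \<open>An upper bound sieve for equidistributed sequences\<close>

lemma coprime_mult_dvd_iff: "coprime (a::nat) b \<Longrightarrow> a * b dvd n \<longleftrightarrow> a dvd n \<and> b dvd n"
  by (auto intro: divides_mult dest: dvd_mult_left dvd_mult_right)

lemma prod_primes_dvd_iff:
  assumes "finite S" "\<And>p. p \<in> S \<Longrightarrow> prime (p::nat)"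
  shows "\<Prod>S dvd n \<longleftrightarrow> (\<forall>p\<in>S. p dvd n)"
  using assms
proof (induction S rule: finite_induct)
  case (insert p S)
  have "coprime p (\<Prod>S)"
    using insert by (intro prod_coprime_right) (auto intro!: primes_coprime)
  hence "p * \<Prod>S dvd n \<longleftrightarrow> p dvd n \<and> \<Prod>S dvd n"
    by (rule coprime_mult_dvd_iff)
  thus ?case using insert by simp
qed simp

lemma prod_primes_inj:
  assumes "finite S" "\<And>p. p \<in> S \<Longrightarrow> prime (p::nat)"
    and "finite U" "\<And>p. p \<in> U \<Longrightarrow> prime p" and "\<Prod>S = \<Prod>U"
  shows "S = U"
proof -
  have "{p. prime p \<and> p dvd \<Prod>V} = V" if "finite V" "\<And>p. p \<in> V \<Longrightarrow> prime p" for V :: "nat set"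
    using that by (auto simp: prime_dvd_prod_iff primes_dvd_imp_eq intro: dvd_prodI)
      (metis primes_dvd_imp_eq that(2))
  thus ?thesis using assms by metis
qed

text \<open>These are distinct terms of the exponential series. With truncation
  \<open>2 * (R - j)\<close> in block \<open>j\<close> the total truncation loss thus stays bounded
  independently of the number \<open>R\<close> of blocks.\<close>

lemma sum_odd_exp_terms_le:
  fixes x :: real
  assumes "0 \<le> x"
  shows "(\<Sum>j<R. x ^ Suc (2 * (R - j)) / fact (Suc (2 * (R - j)))) \<le> exp x"
proof -
  have inj: "inj_on (\<lambda>j. Suc (2 * (R - j))) {..<R}" by (auto simp: inj_on_def)
  have "(\<Sum>j<R. x ^ Suc (2 * (R - j)) / fact (Suc (2 * (R - j))))
      = (\<Sum>n\<in>(\<lambda>j. Suc (2 * (R - j))) ` {..<R}. x ^ n /\<^sub>R fact n)"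
    by (subst sum.reindex[OF inj]) (simp add: divide_inverse mult.commute del: power_Suc fact_Suc)
  also have "\<dots> \<le> (\<Sum>n. x ^ n /\<^sub>R fact n)"
    using assms by (intro sum_le_suminf summable_exp_generic) auto
  also have "\<dots> = exp x" by (simp add: exp_def)
  finally show ?thesis .
qed

text \<open>The sum is the exponent of \<open>w\<close> in the largest sieve modulus when block
  \<open>j\<close> supplies at most \<open>2 * (R - j)\<close> primes below
  \<open>w^(2^(j+1))\<close>. Few primes are allowed in the high blocks, so the modulus stays below
  the eighth power of the top level. The closed form is arranged without subtraction of
  naturals.\<close>

lemma sieve_level_exponent: "(\<Sum>j<R. 2 ^ Suc j * (2 * (R - j))) + 4 * R + 8 = 8 * 2 ^ R"
proof (induction R)
  case (Suc R)
  have "(\<Sum>j<Suc R. 2 ^ Suc j * (2 * (Suc R - j))) = (\<Sum>j<Suc R. 2 ^ Suc j * (2 * (R - j)) + 4 * 2 ^ j)"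
  proof (intro sum.cong refl)
    fix j assume "j \<in> {..<Suc R}"
    hence "j \<le> R" by simp
    then obtain i where "R = j + i" using le_Suc_ex by blast
    thus "2 ^ Suc j * (2 * (Suc R - j)) = 2 ^ Suc j * (2 * (R - j)) + 4 * 2 ^ j" by simp
  qed
  also have "\<dots> = (\<Sum>j<R. 2 ^ Suc j * (2 * (R - j))) + 4 * (\<Sum>j<Suc R. 2 ^ j)"
    by (simp add: sum.distrib sum_distrib_left)
  also have "(\<Sum>j<n. 2 ^ j) = (2::nat) ^ n - 1" for n
    by (induction n) auto
  finally show ?case using Suc by simp
qed simp

lemma density_classD:
  assumes "h \<in> density_class \<kappa> l1 l2 B K"
  shows "h 1 = 1"
    and "\<And>m n. m > 0 \<Longrightarrow> n > 0 \<Longrightarrow> coprime m n \<Longrightarrow> h (m * n) = h m * h n"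
    and "\<And>n. n > 0 \<Longrightarrow> 0 \<le> h n"
    and "\<And>y z. B < y \<Longrightarrow> 1 < y \<Longrightarrow> y < z \<Longrightarrow> (\<Prod>p | prime p \<and> y \<le> real p \<and> real p < z. inverse (1 - h p))
          \<le> (ln z / ln y) powr \<kappa> * (1 + K / ln y)"
    and "\<And>p e. prime p \<Longrightarrow> real p > B \<Longrightarrow> e \<ge> 1 \<Longrightarrow> h (p ^ e) \<le> B / real p"
    and "\<And>p e. prime p \<Longrightarrow> e \<ge> 1 \<Longrightarrow> h (p ^ e) \<le> real p powr (- real e * l1 + l2)"
  using assms unfolding density_class_def multiplicative_fun_def by auto

lemma density_prod_primes:
  assumes h: "h \<in> density_class \<kappa> l1 l2 B K"
    and "finite S" "\<And>p. p \<in> S \<Longrightarrow> prime p \<and> \<not> p dvd d" "d > 0"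
  shows "h (d * \<Prod>S) = h d * (\<Prod>p\<in>S. h p)"
  using assms(2,3)
proof (induction S rule: finite_induct)
  case (insert p S)
  have pos: "0 < d * \<Prod>S" using insert assms(4) prime_gt_0_nat by (auto intro!: prod_pos)
  have "\<not> p dvd d * \<Prod>S"
  proof
    assume "p dvd d * \<Prod>S"
    hence "p dvd \<Prod>S" using insert.prems[of p] by (simp add: prime_dvd_mult_iff)
    then obtain q where "q \<in> S" "p dvd q"
      using insert.hyps insert.prems[of p] by (auto simp: prime_dvd_prod_iff)
    thus False using insert.hyps insert.prems[of p] insert.prems[of q] by (auto dest: primes_dvd_imp_eq)
  qed
  hence "coprime (d * \<Prod>S) p"
    using insert by (metis coprime_commute insertI1 prime_imp_coprime)
  hence "h (d * \<Prod>S * p) = h (d * \<Prod>S) * h p"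
    using pos insert prime_gt_0_nat by (intro density_classD(2)[OF h]) auto
  thus ?case using insert by (simp add: mult_ac)
qed simp

text \<open>One value of \<open>T\<close> is frozen: \<open>Sp\<close> is the support of
  \<open>\<chi> T\<close>, while \<open>M\<close> and \<open>h\<close> stand for \<open>M T\<close>
  and \<open>h T\<close>. Uniformity in \<open>T\<close> then amounts to constants that do not
  involve \<open>Sp\<close>, \<open>\<chi>\<close>, \<open>c\<close>, \<open>M\<close> or
  \<open>h\<close>.\<close>

locale weighted_sequence =
  fixes Sp :: "'a set" and \<chi> :: "'a \<Rightarrow> real" and c :: "'a \<Rightarrow> nat" and M :: real
    and h :: "nat \<Rightarrow> real" and \<theta> \<xi> \<kappa> l1 l2 B K k1 k2 :: real
  assumes finite_Sp: "finite Sp"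
    and weight_nonneg: "\<And>a. a \<in> Sp \<Longrightarrow> 0 \<le> \<chi> a"
    and c_pos: "\<And>a. a \<in> Sp \<Longrightarrow> 0 < c a"
    and M_ge: "1 \<le> M"
    and h_density: "h \<in> density_class \<kappa> l1 l2 B K"
    and pos: "0 < \<theta>" "0 < \<xi>" "0 < \<kappa>" "0 < l1" "0 < l2" "0 < B" "0 < K" "0 \<le> k1" "0 \<le> k2"
    and equidistributed: "\<And>d. 0 < d \<Longrightarrow> real d \<le> M powr \<theta> \<Longrightarrow>
      \<exists>E1 E2. (\<Sum>a | a \<in> Sp \<and> d dvd c a. \<chi> a) = h d * M * (1 + E1) + E2 \<and>
        \<bar>E1\<bar> \<le> k1 * (\<Prod>p | prime p \<and> B < real p \<and> real p \<le> M \<and> \<not> p dvd d. (1 - h p)\<^sup>2) \<and>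
        \<bar>E2\<bar> \<le> k2 * M powr (1 - \<xi>)"
begin

lemma h_prime_le: "prime p \<Longrightarrow> B < real p \<Longrightarrow> h p \<le> B / real p"
  using density_classD(5)[OF h_density, of p 1] by simp

lemma h_nonneg: "0 < n \<Longrightarrow> 0 \<le> h n"
  by (rule density_classD(3)[OF h_density])

lemma h_prime_less_1:
  assumes "prime p" "B < real p"
  shows "0 \<le> h p" "h p < 1"
proof -
  show "0 \<le> h p" using assms prime_gt_0_nat h_nonneg by auto
  have "B / real p < 1" using assms pos prime_gt_0_nat[of p] by simp
  thus "h p < 1" using h_prime_le[OF assms] by linarith
qed

text \<open>All factors of the error product lie in [0,1], so it may be restricted to any convenient
  subset \<open>Q\<close> of its primes.\<close>

lemma congruence_sum_dist:
  assumes "0 < d" "real d \<le> M powr \<theta>"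
    and "Q \<subseteq> {p. prime p \<and> B < real p \<and> real p \<le> M \<and> \<not> p dvd d}"
  shows "\<bar>(\<Sum>a | a \<in> Sp \<and> d dvd c a. \<chi> a) - h d * M\<bar>
    \<le> h d * M * k1 * (\<Prod>p\<in>Q. (1 - h p)\<^sup>2) + k2 * M powr (1 - \<xi>)"
proof -
  let ?P = "{p. prime p \<and> B < real p \<and> real p \<le> M \<and> \<not> p dvd d}"
  obtain E1 E2 where E: "(\<Sum>a | a \<in> Sp \<and> d dvd c a. \<chi> a) = h d * M * (1 + E1) + E2"
    "\<bar>E1\<bar> \<le> k1 * (\<Prod>p\<in>?P. (1 - h p)\<^sup>2)" "\<bar>E2\<bar> \<le> k2 * M powr (1 - \<xi>)"
    using equidistributed[OF assms(1,2)] by blast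
  have fin: "finite ?P"
    by (rule finite_subset[of _ "{..nat \<lfloor>M\<rfloor>}"]) (auto simp: le_nat_floor)
  have "(\<Prod>p\<in>?P. (1 - h p)\<^sup>2) = (\<Prod>p\<in>Q. (1 - h p)\<^sup>2) * (\<Prod>p\<in>?P - Q. (1 - h p)\<^sup>2)"
    using prod.subset_diff[OF assms(3) fin, of "\<lambda>p. (1 - h p)\<^sup>2"] by (simp add: mult.commute)
  also have "\<dots> \<le> (\<Prod>p\<in>Q. (1 - h p)\<^sup>2) * 1"
    using h_prime_less_1
    by (intro mult_left_mono prod_le_1 prod_nonneg) (auto intro!: power_le_one simp: less_imp_le)
  finally have "k1 * (\<Prod>p\<in>?P. (1 - h p)\<^sup>2) \<le> k1 * (\<Prod>p\<in>Q. (1 - h p)\<^sup>2)"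
    using pos by (intro mult_left_mono) auto
  hence "\<bar>E1\<bar> \<le> k1 * (\<Prod>p\<in>Q. (1 - h p)\<^sup>2)" using E(2) by linarith
  hence "h d * M * \<bar>E1\<bar> \<le> h d * M * (k1 * (\<Prod>p\<in>Q. (1 - h p)\<^sup>2))"
    using h_nonneg[OF assms(1)] M_ge by (intro mult_left_mono) auto
  moreover have "(\<Sum>a | a \<in> Sp \<and> d dvd c a. \<chi> a) - h d * M = h d * M * E1 + E2"
    using E(1) by (simp add: algebra_simps)
  moreover have "\<bar>h d * M * E1 + E2\<bar> \<le> h d * M * \<bar>E1\<bar> + \<bar>E2\<bar>"
    using h_nonneg[OF assms(1)] M_ge abs_triangle_ineq[of "h d * M * E1" E2] by (simp add: abs_mult)
  ultimately show ?thesis using E(3) by (simp add: mult.assoc)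
qed

lemma congruence_sum_le:
  assumes "0 < d" "real d \<le> M powr \<theta>"
  shows "(\<Sum>a | a \<in> Sp \<and> d dvd c a. \<chi> a) \<le> (1 + k1) * h d * M + k2 * M powr (1 - \<xi>)"
  using congruence_sum_dist[OF assms, of "{}"] by (simp add: algebra_simps)

text \<open>Omitted factors are at least 1, which allows any subset \<open>P\<close>. Passing from
  \<open>y\<close> to a smaller \<open>w\<close> in the last factor makes that factor a
  constant.\<close>

lemma inverse_prod_le:
  assumes "B < y" "1 < w" "w \<le> y" "y < z" "P \<subseteq> {p. prime p \<and> y \<le> real p \<and> real p < z}"
  shows "(\<Prod>p\<in>P. inverse (1 - h p)) \<le> (ln z / ln y) powr \<kappa> * (1 + K / ln w)"
proof -
  let ?P = "{p. prime p \<and> y \<le> real p \<and> real p < z}"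
  have fin: "finite ?P"
    by (rule finite_subset[of _ "{..nat \<lfloor>z\<rfloor>}"]) (auto simp: le_nat_floor)
  have ge: "1 \<le> inverse (1 - h p)" if "p \<in> ?P" for p
    using h_prime_less_1[of p] that assms(1) by (auto simp: one_le_inverse)
  have "(\<Prod>p\<in>P. inverse (1 - h p)) * 1 \<le> (\<Prod>p\<in>P. inverse (1 - h p)) * (\<Prod>p\<in>?P - P. inverse (1 - h p))"
  proof (intro mult_left_mono prod_ge_1 prod_nonneg ge)
    show "0 \<le> inverse (1 - h p)" if "p \<in> P" for p
    proof -
      have "1 \<le> inverse (1 - h p)" using ge[of p] that assms(5) by blast
      thus ?thesis by linarith
    qed
  qed auto
  also have "\<dots> = (\<Prod>p\<in>?P. inverse (1 - h p))"
    using prod.subset_diff[OF assms(5) fin, of "\<lambda>p. inverse (1 - h p)"] by (simp add: mult.commute)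
  also have "\<dots> \<le> (ln z / ln y) powr \<kappa> * (1 + K / ln y)"
    using assms by (intro density_classD(4)[OF h_density]) auto
  also have "\<dots> \<le> (ln z / ln y) powr \<kappa> * (1 + K / ln w)"
    using assms pos by (intro mult_left_mono add_left_mono divide_left_mono) auto
  finally show ?thesis by simp
qed

end

text \<open>Bounds the product of \<open>1 / (1 - h p)\<close> over one block: the logarithms of
  consecutive levels have ratio 2.\<close>

definition block_factor :: "real \<Rightarrow> real \<Rightarrow> nat \<Rightarrow> real" where
  "block_factor \<kappa> K w = 2 powr \<kappa> * (1 + K / ln (real w))"

text \<open>The first summand comes from truncating the main term, the second from the first error
  term of equidistribution.\<close>

definition sieve_const :: "real \<Rightarrow> real \<Rightarrow> real \<Rightarrow> real \<Rightarrow> nat \<Rightarrow> real" where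
  "sieve_const \<kappa> B K k1 w = exp (block_factor \<kappa> K w * block_factor \<kappa> K w) + k1 * exp (4 * B\<^sup>2)"

definition sieve_block :: "nat \<Rightarrow> nat \<Rightarrow> nat \<Rightarrow> nat set" where
  "sieve_block w d j = {p. prime p \<and> w ^ 2 ^ j \<le> p \<and> p < w ^ 2 ^ Suc j \<and> \<not> p dvd d}"

definition sieve_range :: "nat \<Rightarrow> nat \<Rightarrow> nat \<Rightarrow> nat set" where
  "sieve_range w d R = {p. prime p \<and> w \<le> p \<and> p < w ^ 2 ^ R \<and> \<not> p dvd d}"

lemma finite_sieve_block [simp]: "finite (sieve_block w d j)"
  unfolding sieve_block_def by (rule finite_subset[of _ "{..<w ^ 2 ^ Suc j}"]) auto

lemma finite_sieve_range [simp]: "finite (sieve_range w d R)"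
  unfolding sieve_range_def by (rule finite_subset[of _ "{..<w ^ 2 ^ R}"]) auto

lemma level_mono: "2 \<le> (w::nat) \<Longrightarrow> i \<le> j \<Longrightarrow> w ^ 2 ^ i \<le> w ^ 2 ^ j"
  by (intro power_increasing) auto

lemma sieve_block_disjoint:
  assumes "2 \<le> w" "i \<noteq> j"
  shows "sieve_block w d i \<inter> sieve_block w d j = {}"
proof -
  have "sieve_block w d i \<inter> sieve_block w d j = {}" if "i < j" for i j
  proof -
    have "w ^ 2 ^ Suc i \<le> w ^ 2 ^ j" using that by (intro level_mono[OF assms(1)]) simp
    thus ?thesis unfolding sieve_block_def by (auto simp del: power_Suc)
  qed
  thus ?thesis using assms(2) by (metis Int_commute nat_neq_iff)
qed

lemma sieve_range_blocks:
  assumes "2 \<le> w"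
  shows "(\<Union>j<R. sieve_block w d j) = sieve_range w d R"
proof (intro equalityI subsetI)
  fix p assume "p \<in> (\<Union>j<R. sieve_block w d j)"
  then obtain j where "j < R" "p \<in> sieve_block w d j" by blast
  thus "p \<in> sieve_range w d R"
    using level_mono[OF assms, of 0 j] level_mono[OF assms, of "Suc j" R]
    unfolding sieve_block_def sieve_range_def by (auto simp del: power_Suc)
next
  fix p assume "p \<in> sieve_range w d R"
  thus "p \<in> (\<Union>j<R. sieve_block w d j)"
    using level_exists[OF assms, of p R] unfolding sieve_block_def sieve_range_def by blast
qed

context weighted_sequence
begin

lemma sieve_range_prime_bounds:
  assumes "2 * B \<le> real w" "p \<in> sieve_range w d R"
  shows "prime p" "B < real p" "0 \<le> h p" "h p \<le> 1 / 2" "h p \<le> B / real p"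
proof -
  show p: "prime p" using assms by (simp add: sieve_range_def)
  have "w \<le> p" using assms by (simp add: sieve_range_def)
  hence wp: "2 * B \<le> real p" using assms(1) by linarith
  thus Bp: "B < real p" using pos by linarith
  show "0 \<le> h p" using h_prime_less_1[OF p Bp] by simp
  show "h p \<le> B / real p" by (rule h_prime_le[OF p Bp])
  also have "\<dots> \<le> 1 / 2" using wp Bp pos by (simp add: field_simps)
  finally show "h p \<le> 1 / 2" .
qed

lemma block_factor_ge_1:
  assumes "2 \<le> w"
  shows "1 \<le> block_factor \<kappa> K w"
proof -
  have "1 * 1 \<le> 2 powr \<kappa> * (1 + K / ln (real w))"
    using pos assms by (intro mult_mono ge_one_powr_ge_zero) auto
  thus ?thesis by (simp add: block_factor_def)
qed

text \<open>The Bonferroni overshoot is an absolute error. Since the product over a block is at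
  least \<open>1 / Q\<close>, it becomes a relative error, and relative errors can be multiplied
  over the blocks.\<close>

lemma block_truncated_le:
  assumes w: "2 \<le> w" "2 * B \<le> real w"
  defines "Q \<equiv> block_factor \<kappa> K w"
  shows "truncated_sum h (2 * k) (sieve_block w d j)
    \<le> (\<Prod>p\<in>sieve_block w d j. 1 - h p) * (1 + Q * (ln Q ^ Suc (2 * k) / fact (Suc (2 * k))))"
proof -
  let ?P = "sieve_block w d j"
  have sub: "p \<in> ?P \<Longrightarrow> p \<in> sieve_range w d (Suc j)" for p
    using sieve_range_blocks[OF w(1), of d "Suc j"] by blast
  note bd = sieve_range_prime_bounds[OF w(2) sub]
  have wj: "real w \<le> real w ^ 2 ^ j" using w level_mono[of w 0 j] by (metis of_nat_le_iff of_nat_power power_0 power_one_right zero_le)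
  have inv: "(\<Prod>p\<in>?P. inverse (1 - h p)) \<le> Q"
  proof -
    have "(\<Prod>p\<in>?P. inverse (1 - h p))
        \<le> (ln (real w ^ 2 ^ Suc j) / ln (real w ^ 2 ^ j)) powr \<kappa> * (1 + K / ln (real w))"
    proof (rule inverse_prod_le)
      show "B < real w ^ 2 ^ j" using wj w pos by linarith
      show "real w ^ 2 ^ j < real w ^ 2 ^ Suc j" using w by (intro power_strict_increasing) auto
      show "?P \<subseteq> {p. prime p \<and> real w ^ 2 ^ j \<le> real p \<and> real p < real w ^ 2 ^ Suc j}"
        unfolding sieve_block_def by (auto simp flip: of_nat_power simp del: power_Suc)
    qed (use w wj in auto)
    also have "ln (real w ^ 2 ^ Suc j) / ln (real w ^ 2 ^ j) = 2"
      using w by (simp add: ln_realpow)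
    finally show ?thesis by (simp add: Q_def block_factor_def)
  qed
  have Q1: "1 \<le> Q" unfolding Q_def by (rule block_factor_ge_1[OF w(1)])
  have prod_pos: "0 < (\<Prod>p\<in>?P. 1 - h p)" using bd(4) by (intro prod_pos) force
  \<comment> \<open>From \<open>exp x \<le> 1 / (1 - x)\<close> the sum of \<open>h\<close> over a
    block is at most \<open>ln Q\<close>.\<close>
  have "exp (\<Sum>p\<in>?P. h p) = (\<Prod>p\<in>?P. exp (h p))" by (simp add: exp_sum)
  also have "\<dots> \<le> (\<Prod>p\<in>?P. inverse (1 - h p))"
  proof (intro prod_mono conjI)
    fix p assume p: "p \<in> ?P"
    have "1 + - h p \<le> exp (- h p)" by (rule exp_ge_add_one_self)
    hence "inverse (exp (- h p)) \<le> inverse (1 - h p)"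
      using bd(4)[OF p] by (intro le_imp_inverse_le) auto
    thus "exp (h p) \<le> inverse (1 - h p)" by (simp add: exp_minus)
  qed simp
  also note inv
  finally have "(\<Sum>p\<in>?P. h p) \<le> ln Q" using Q1 by (subst ln_ge_iff) auto
  hence "(\<Sum>p\<in>?P. h p) ^ Suc (2 * k) \<le> ln Q ^ Suc (2 * k)"
    using bd(3) by (intro power_mono sum_nonneg) auto
  moreover have "1 \<le> (\<Prod>p\<in>?P. 1 - h p) * Q"
  proof -
    have "inverse (\<Prod>p\<in>?P. 1 - h p) \<le> Q"
      using inv prod_inversef[of "\<lambda>p. 1 - h p" ?P] by (simp add: comp_def)
    hence "(\<Prod>p\<in>?P. 1 - h p) * inverse (\<Prod>p\<in>?P. 1 - h p) \<le> (\<Prod>p\<in>?P. 1 - h p) * Q"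
      using prod_pos by (intro mult_left_mono) auto
    moreover have "(\<Prod>p\<in>?P. 1 - h p) * inverse (\<Prod>p\<in>?P. 1 - h p) = 1"
      by (rule right_inverse) (use prod_pos in linarith)
    ultimately show ?thesis by linarith
  qed
  hence "1 * (ln Q ^ Suc (2 * k) / fact (Suc (2 * k)))
      \<le> ((\<Prod>p\<in>?P. 1 - h p) * Q) * (ln Q ^ Suc (2 * k) / fact (Suc (2 * k)))"
    using Q1 by (intro mult_right_mono divide_nonneg_pos zero_le_power ln_ge_zero) auto
  moreover have "truncated_sum h (2 * k) ?P
      \<le> (\<Prod>p\<in>?P. 1 - h p) + (\<Sum>p\<in>?P. h p) ^ Suc (2 * k) / fact (Suc (2 * k))"
    using bd(3,4) by (intro truncated_sum_even_le) force+
  ultimately show ?thesis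
    by (simp add: algebra_simps divide_right_mono del: power_Suc fact_Suc)
      (smt (verit) divide_right_mono fact_ge_zero)
qed

text \<open>The relative errors of the blocks are \<open>Q\<close> times distinct terms of the
  exponential series at \<open>ln Q\<close>, so the product of all \<open>1 + Q * ?x j\<close> is at
  most \<open>exp (Q * exp (ln Q))\<close>, whatever \<open>R\<close> is.\<close>

lemma sieve_main_term_le:
  assumes w: "2 \<le> w" "2 * B \<le> real w"
  defines "Q \<equiv> block_factor \<kappa> K w"
  shows "(\<Sum>S\<in>block_family (sieve_block w d) (\<lambda>j. R - j) R. \<Prod>p\<in>S. - h p)
    \<le> exp (Q * Q) * (\<Prod>p\<in>sieve_range w d R. 1 - h p)"
proof -
  have Q1: "1 \<le> Q" unfolding Q_def by (rule block_factor_ge_1[OF w(1)])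
  let ?x = "\<lambda>j. ln Q ^ Suc (2 * (R - j)) / fact (Suc (2 * (R - j)))"
  have x0: "0 \<le> ?x j" for j using Q1 by (intro divide_nonneg_pos zero_le_power ln_ge_zero) auto
  have sub: "p \<in> sieve_block w d j \<Longrightarrow> p \<in> sieve_range w d (Suc j)" for p j
    using sieve_range_blocks[OF w(1), of d "Suc j"] by blast
  have h01: "0 \<le> h p \<and> h p \<le> 1" if "p \<in> sieve_block w d j" for p j
    using sieve_range_prime_bounds(3,4)[OF w(2) sub[OF that]] by simp
  have prod0: "0 \<le> (\<Prod>p\<in>sieve_block w d j. 1 - h p)" for j
    using h01 by (intro prod_nonneg) simp
  have "(\<Sum>S\<in>block_family (sieve_block w d) (\<lambda>j. R - j) R. \<Prod>p\<in>S. - h p)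
      = (\<Prod>j<R. truncated_sum h (2 * (R - j)) (sieve_block w d j))"
    using w by (intro sum_block_family sieve_block_disjoint) auto
  also have "\<dots> \<le> (\<Prod>j<R. (\<Prod>p\<in>sieve_block w d j. 1 - h p) * (1 + Q * ?x j))"
  proof (intro prod_mono conjI)
    fix j
    show "0 \<le> truncated_sum h (2 * (R - j)) (sieve_block w d j)"
      using truncated_sum_even_ge[of "sieve_block w d j" h "R - j"] h01 prod0[of j]
      by (meson finite_sieve_block order_trans)
    show "truncated_sum h (2 * (R - j)) (sieve_block w d j)
        \<le> (\<Prod>p\<in>sieve_block w d j. 1 - h p) * (1 + Q * ?x j)"
      unfolding Q_def by (rule block_truncated_le[OF w])
  qed
  also have "\<dots> = (\<Prod>p\<in>sieve_range w d R. 1 - h p) * (\<Prod>j<R. 1 + Q * ?x j)"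
    unfolding prod.distrib sieve_range_blocks[OF w(1), symmetric]
    using sieve_block_disjoint[OF w(1)] by (subst prod.UNION_disjoint) auto
  also have "\<dots> \<le> (\<Prod>p\<in>sieve_range w d R. 1 - h p) * exp (Q * Q)"
  proof (intro mult_left_mono prod_nonneg)
    have "(\<Prod>j<R. 1 + Q * ?x j) \<le> (\<Prod>j<R. exp (Q * ?x j))"
      using x0 Q1 by (intro prod_mono conjI exp_ge_add_one_self add_nonneg_nonneg mult_nonneg_nonneg) auto
    also have "\<dots> = exp (Q * (\<Sum>j<R. ?x j))"
      by (simp add: exp_sum sum_distrib_left del: power_Suc fact_Suc)
    also have "\<dots> \<le> exp (Q * exp (ln Q))"
      using Q1 sum_odd_exp_terms_le[of "ln Q" R] by (simp del: power_Suc fact_Suc)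
    finally show "(\<Prod>j<R. 1 + Q * ?x j) \<le> exp (Q * Q)" using Q1 by simp
    show "0 \<le> 1 - h p" if "p \<in> sieve_range w d R" for p
      using sieve_range_prime_bounds(4)[OF w(2) that] by simp
  qed
  finally show ?thesis by (simp add: mult.commute)
qed

text \<open>Over all subsets the sum factorises into the
  \<open>h p + (1 - h p)^2 = 1 - h p + (h p)^2\<close>. For \<open>h p \<le> 1 / 2\<close> this is
  at most \<open>(1 - h p) * (1 + 2 * (h p)^2)\<close>, and the sum of
  \<open>(h p)^2 \<le> B^2 / p^2\<close> converges.\<close>

lemma sieve_error_product_le:
  assumes w: "2 * B \<le> real w"
  shows "(\<Sum>S\<in>Pow (sieve_range w d R). (\<Prod>p\<in>S. h p) * (\<Prod>p\<in>sieve_range w d R - S. (1 - h p)\<^sup>2))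
    \<le> exp (4 * B\<^sup>2) * (\<Prod>p\<in>sieve_range w d R. 1 - h p)"
proof -
  let ?P = "sieve_range w d R"
  note bd = sieve_range_prime_bounds[OF w]
  have "(\<Sum>S\<in>Pow ?P. (\<Prod>p\<in>S. h p) * (\<Prod>p\<in>?P - S. (1 - h p)\<^sup>2)) = (\<Prod>p\<in>?P. h p + (1 - h p)\<^sup>2)"
    by (simp add: prod_add)
  also have "\<dots> \<le> (\<Prod>p\<in>?P. exp (2 * B\<^sup>2 * (1 / (real p)\<^sup>2)) * (1 - h p))"
  proof (intro prod_mono conjI)
    fix p assume p: "p \<in> ?P"
    show "0 \<le> h p + (1 - h p)\<^sup>2" using bd(3)[OF p] by simp
    have "h p * (h p * h p) \<le> 1 / 2 * (h p * h p)" using bd(3,4)[OF p] by (intro mult_right_mono) auto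
    hence "h p + (1 - h p)\<^sup>2 \<le> (1 + 2 * (h p)\<^sup>2) * (1 - h p)"
      by (simp add: power2_eq_square algebra_simps)
    also have "(h p)\<^sup>2 \<le> (B / real p)\<^sup>2" using bd(3,5)[OF p] by (intro power_mono)
    hence "(1 + 2 * (h p)\<^sup>2) * (1 - h p) \<le> (1 + 2 * B\<^sup>2 * (1 / (real p)\<^sup>2)) * (1 - h p)"
      using bd(4)[OF p] by (intro mult_right_mono) (auto simp: power_divide)
    also have "\<dots> \<le> exp (2 * B\<^sup>2 * (1 / (real p)\<^sup>2)) * (1 - h p)"
      using bd(4)[OF p] by (intro mult_right_mono exp_ge_add_one_self) auto
    finally show "h p + (1 - h p)\<^sup>2 \<le> exp (2 * B\<^sup>2 * (1 / (real p)\<^sup>2)) * (1 - h p)" .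
  qed
  also have "\<dots> = exp (2 * B\<^sup>2 * (\<Sum>p\<in>?P. 1 / (real p)\<^sup>2)) * (\<Prod>p\<in>?P. 1 - h p)"
    by (simp add: prod.distrib exp_sum sum_distrib_left)
  also have "\<dots> \<le> exp (4 * B\<^sup>2) * (\<Prod>p\<in>?P. 1 - h p)"
  proof (intro mult_right_mono prod_nonneg)
    have "2 * B\<^sup>2 * (\<Sum>p\<in>?P. 1 / (real p)\<^sup>2) \<le> 2 * B\<^sup>2 * 2"
      using bd(1) by (intro mult_left_mono sum_primes_inverse_square_le) auto
    thus "exp (2 * B\<^sup>2 * (\<Sum>p\<in>?P. 1 / (real p)\<^sup>2)) \<le> exp (4 * B\<^sup>2)" by simp
    show "0 \<le> 1 - h p" if "p \<in> ?P" for p using bd(4)[OF that] by simp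
  qed
  finally show ?thesis .
qed

text \<open>Distinct sets of primes have distinct products, so the bound for the products also
  bounds the number of sets.\<close>

lemma sieve_family_bounds:
  fixes w d R :: nat
  assumes w: "2 \<le> w"
  defines "F \<equiv> block_family (sieve_block w d) (\<lambda>j. R - j) R"
  shows "\<And>S. S \<in> F \<Longrightarrow> S \<subseteq> sieve_range w d R"
    and "\<And>S. S \<in> F \<Longrightarrow> \<Prod>S \<le> (w ^ 2 ^ R) ^ 8"
    and "card F \<le> (w ^ 2 ^ R) ^ 8"
proof -
  show sub: "S \<subseteq> sieve_range w d R" if "S \<in> F" for S
    using that unfolding F_def block_family_def sieve_range_blocks[OF w] by auto
  show le: "\<Prod>S \<le> (w ^ 2 ^ R) ^ 8" if "S \<in> F" for S
  proof -
    have "\<Prod>S \<le> (\<Prod>j<R. (w ^ 2 ^ Suc j) ^ (2 * (R - j)))"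
      using that w unfolding F_def
      by (intro prod_block_family_le[where P = "sieve_block w d"] sieve_block_disjoint)
        (auto simp: sieve_block_def)
    also have "\<dots> = w ^ (\<Sum>j<R. 2 ^ Suc j * (2 * (R - j)))"
      by (simp only: power_mult[symmetric] power_sum)
    also have "\<dots> \<le> w ^ (2 ^ R * 8)"
      using w sieve_level_exponent[of R] by (intro power_increasing) auto
    finally show ?thesis by (simp add: power_mult)
  qed
  have prime: "prime p" if "S \<in> F" "p \<in> S" for S p
    using sub[OF that(1)] that(2) by (auto simp: sieve_range_def)
  have fin: "finite S" if "S \<in> F" for S by (rule finite_subset[OF sub[OF that]]) simp
  have "inj_on (\<lambda>S. \<Prod>S) F"
    by (intro inj_onI prod_primes_inj fin prime)
  moreover have "(\<lambda>S. \<Prod>S) ` F \<subseteq> {1..(w ^ 2 ^ R) ^ 8}"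
    using le prime prime_gt_0_nat by (auto simp: Suc_le_eq intro!: prod_pos)
  ultimately have "card F \<le> card {1..(w ^ 2 ^ R) ^ 8}" by (intro card_inj_on_le) auto
  thus "card F \<le> (w ^ 2 ^ R) ^ 8" by simp
qed

text \<open>
  Hooley's almost pure sieve: the product of the Bonferroni upper bounds over the blocks
  \<open>[w^(2^j), w^(2^(j+1)))\<close> is again an upper bound, its coefficients have modulus at most 1, and
  its main term factorises. Coefficients of modulus at most 1 are what the first error
  term tolerates.
\<close>

lemma sieve_bound:
  assumes w: "2 \<le> w" "2 * B \<le> real w" and d: "0 < d"
    and level: "real d * real (w ^ 2 ^ R) ^ 8 \<le> M powr \<theta>" "real (w ^ 2 ^ R) \<le> M"
  shows "(\<Sum>a | a \<in> Sp \<and> d dvd c a \<and> (\<forall>p\<in>sieve_range w d R. \<not> p dvd c a). \<chi> a)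
    \<le> sieve_const \<kappa> B K k1 w * h d * M * (\<Prod>p\<in>sieve_range w d R. 1 - h p)
      + k2 * real (w ^ 2 ^ R) ^ 8 * M powr (1 - \<xi>)"
proof -
  define F where "F = block_family (sieve_block w d) (\<lambda>j. R - j) R"
  define P where "P = sieve_range w d R"
  define E where "E = M powr (1 - \<xi>)"
  let ?cs = "\<lambda>n. \<Sum>a | a \<in> Sp \<and> n dvd c a. \<chi> a"
  have finP: "finite P" by (simp add: P_def)
  have finF: "finite F" by (simp add: F_def)
  note Fb = sieve_family_bounds[OF w(1), where d = d and R = R, folded F_def P_def]
  have bd: "p \<in> P \<Longrightarrow> prime p \<and> B < real p \<and> 0 \<le> h p \<and> h p \<le> 1 / 2 \<and> real p \<le> M \<and> \<not> p dvd d" for p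
    using sieve_range_prime_bounds[OF w(2), of p d R] level(2)
    unfolding P_def by (auto simp: sieve_range_def simp flip: of_nat_power)
  \<comment> \<open>Bonferroni with the 0-1 weights \<open>of_bool (p dvd n)\<close>; the same
    family with the weights \<open>h p\<close> later gives the main term.\<close>
  have indicator: "(of_bool (\<forall>p\<in>P. \<not> p dvd n) :: real) \<le> (\<Sum>S\<in>F. (-1) ^ card S * of_bool (\<Prod>S dvd n))" (is "?lhs \<le> _")
    for n :: nat
  proof -
    let ?g = "\<lambda>p. of_bool (p dvd n) :: real"
    have "?lhs = (\<Prod>p\<in>P. 1 - ?g p)"
      using finP by (auto simp: of_bool_def intro!: prod.neutral[symmetric] prod_zero[symmetric])
    also have "\<dots> = (\<Prod>j<R. \<Prod>p\<in>sieve_block w d j. 1 - ?g p)"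
      unfolding P_def sieve_range_blocks[OF w(1), symmetric]
      using sieve_block_disjoint[OF w(1)] by (subst prod.UNION_disjoint) auto
    also have "\<dots> \<le> (\<Prod>j<R. truncated_sum ?g (2 * (R - j)) (sieve_block w d j))"
      by (intro prod_mono conjI prod_nonneg truncated_sum_even_ge) auto
    also have "\<dots> = (\<Sum>S\<in>F. \<Prod>p\<in>S. - ?g p)"
      unfolding F_def using w by (intro sum_block_family[symmetric] sieve_block_disjoint) auto
    also have "\<dots> = (\<Sum>S\<in>F. (-1) ^ card S * of_bool (\<Prod>S dvd n))"
    proof (intro sum.cong refl)
      fix S assume S: "S \<in> F"
      have fin: "finite S" by (rule finite_subset[OF Fb(1)[OF S] finP])
      have iff: "\<Prod>S dvd n \<longleftrightarrow> (\<forall>p\<in>S. p dvd n)"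
        using fin Fb(1)[OF S] bd by (intro prod_primes_dvd_iff) auto
      have "(\<Prod>p\<in>S. ?g p) = of_bool (\<Prod>S dvd n)"
        unfolding iff using fin by (auto simp: of_bool_def intro!: prod.neutral prod_zero)
      thus "(\<Prod>p\<in>S. - ?g p) = (-1) ^ card S * of_bool (\<Prod>S dvd n)"
        using fin by (simp add: prod_uminus)
    qed
    finally show ?thesis .
  qed
  have "(\<Sum>a | a \<in> Sp \<and> d dvd c a \<and> (\<forall>p\<in>P. \<not> p dvd c a). \<chi> a)
      = (\<Sum>a | a \<in> Sp \<and> d dvd c a. \<chi> a * of_bool (\<forall>p\<in>P. \<not> p dvd c a))"
    using finite_Sp by (intro sum.mono_neutral_cong_left) auto
  also have "\<dots> \<le> (\<Sum>a | a \<in> Sp \<and> d dvd c a. \<chi> a * (\<Sum>S\<in>F. (-1) ^ card S * of_bool (\<Prod>S dvd c a)))"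
    using weight_nonneg by (intro sum_mono mult_left_mono indicator) auto
  also have "\<dots> = (\<Sum>S\<in>F. \<Sum>a | a \<in> Sp \<and> d dvd c a. (-1) ^ card S * (\<chi> a * of_bool (\<Prod>S dvd c a)))"
    unfolding sum_distrib_left by (subst sum.swap) (simp add: mult_ac)
  also have "\<dots> = (\<Sum>S\<in>F. (-1) ^ card S * ?cs (d * \<Prod>S))"
  proof (intro sum.cong refl)
    fix S assume S: "S \<in> F"
    have fin: "finite S" by (rule finite_subset[OF Fb(1)[OF S] finP])
    have "coprime d (\<Prod>S)"
    proof (rule prod_coprime_right)
      fix p assume "p \<in> S"
      hence "prime p" "\<not> p dvd d" using Fb(1)[OF S] bd by auto
      thus "coprime d p" by (metis coprime_commute prime_imp_coprime)
    qed
    hence iff: "d * \<Prod>S dvd n \<longleftrightarrow> d dvd n \<and> \<Prod>S dvd n" for n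
      by (rule coprime_mult_dvd_iff)
    have "(\<Sum>a | a \<in> Sp \<and> d dvd c a. \<chi> a * of_bool (\<Prod>S dvd c a)) = ?cs (d * \<Prod>S)"
      unfolding iff using finite_Sp by (intro sum.mono_neutral_cong_right) auto
    thus "(\<Sum>a | a \<in> Sp \<and> d dvd c a. (-1) ^ card S * (\<chi> a * of_bool (\<Prod>S dvd c a)))
        = (-1) ^ card S * ?cs (d * \<Prod>S)"
      by (simp add: sum_distrib_left[symmetric])
  qed
  also have "\<dots> \<le> (\<Sum>S\<in>F. h d * M * (\<Prod>p\<in>S. - h p)
      + h d * M * k1 * ((\<Prod>p\<in>S. h p) * (\<Prod>p\<in>P - S. (1 - h p)\<^sup>2)) + k2 * E)"
  proof (intro sum_mono)
    fix S assume S: "S \<in> F"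
    have SP: "S \<subseteq> P" by (rule Fb(1)[OF S])
    have fin: "finite S" by (rule finite_subset[OF SP finP])
    have Spos: "0 < \<Prod>S" using SP bd prime_gt_0_nat by (intro prod_pos) auto
    have "real (d * \<Prod>S) \<le> real d * real (w ^ 2 ^ R) ^ 8"
      using Fb(2)[OF S] by (simp only: of_nat_mult of_nat_power[symmetric] of_nat_le_iff mult_left_mono of_nat_0_le_iff)
    hence "real (d * \<Prod>S) \<le> M powr \<theta>" using level by linarith
    \<comment> \<open>Sieving primes outside \<open>S\<close> do not divide the modulus, so their
      squares survive in the error term; \<open>P - S\<close> is the set \<open>Q\<close> of
      \<open>congruence_sum_dist\<close>.\<close>
    moreover have "P - S \<subseteq> {p. prime p \<and> B < real p \<and> real p \<le> M \<and> \<not> p dvd d * \<Prod>S}"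
    proof
      fix p assume p: "p \<in> P - S"
      have "\<not> p dvd \<Prod>S"
      proof
        assume "p dvd \<Prod>S"
        then obtain q where "q \<in> S" "p dvd q"
          using p bd fin by (auto simp: prime_dvd_prod_iff)
        thus False using p SP bd by (metis DiffD1 DiffD2 primes_dvd_imp_eq subsetD)
      qed
      thus "p \<in> {p. prime p \<and> B < real p \<and> real p \<le> M \<and> \<not> p dvd d * \<Prod>S}"
        using p bd by (auto simp: prime_dvd_mult_iff)
    qed
    ultimately have "\<bar>?cs (d * \<Prod>S) - h (d * \<Prod>S) * M\<bar>
        \<le> h (d * \<Prod>S) * M * k1 * (\<Prod>p\<in>P - S. (1 - h p)\<^sup>2) + k2 * E"
      unfolding E_def using d Spos by (intro congruence_sum_dist) auto
    moreover have "h (d * \<Prod>S) = h d * (\<Prod>p\<in>S. h p)"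
      using SP bd fin d by (intro density_prod_primes[OF h_density]) auto
    moreover have "(-1) ^ card S * ?cs (d * \<Prod>S)
        \<le> (-1) ^ card S * (h (d * \<Prod>S) * M) + \<bar>?cs (d * \<Prod>S) - h (d * \<Prod>S) * M\<bar>"
      by (cases "even (card S)") auto
    moreover have "(\<Prod>p\<in>S. - h p) = (-1) ^ card S * (\<Prod>p\<in>S. h p)"
      by (rule prod_uminus)
    ultimately show "(-1) ^ card S * ?cs (d * \<Prod>S) \<le> h d * M * (\<Prod>p\<in>S. - h p)
        + h d * M * k1 * ((\<Prod>p\<in>S. h p) * (\<Prod>p\<in>P - S. (1 - h p)\<^sup>2)) + k2 * E"
      by (simp add: mult_ac)
  qed
  also have "\<dots> = h d * M * (\<Sum>S\<in>F. \<Prod>p\<in>S. - h p)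
      + h d * M * k1 * (\<Sum>S\<in>F. (\<Prod>p\<in>S. h p) * (\<Prod>p\<in>P - S. (1 - h p)\<^sup>2)) + real (card F) * (k2 * E)"
    by (simp add: sum.distrib sum_distrib_left)
  also have "\<dots> \<le> h d * M * (exp (block_factor \<kappa> K w * block_factor \<kappa> K w) * (\<Prod>p\<in>P. 1 - h p))
      + h d * M * k1 * (exp (4 * B\<^sup>2) * (\<Prod>p\<in>P. 1 - h p)) + real (w ^ 2 ^ R) ^ 8 * (k2 * E)"
  proof (intro add_mono mult_left_mono mult_right_mono)
    show "(\<Sum>S\<in>F. \<Prod>p\<in>S. - h p) \<le> exp (block_factor \<kappa> K w * block_factor \<kappa> K w) * (\<Prod>p\<in>P. 1 - h p)"
      unfolding F_def P_def by (rule sieve_main_term_le[OF w])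
    \<comment> \<open>Positivity allows all subsets of \<open>P\<close> in place of the truncated
      family, and over all subsets the sum factorises.\<close>
    have "(\<Sum>S\<in>F. (\<Prod>p\<in>S. h p) * (\<Prod>p\<in>P - S. (1 - h p)\<^sup>2))
        \<le> (\<Sum>S\<in>Pow P. (\<Prod>p\<in>S. h p) * (\<Prod>p\<in>P - S. (1 - h p)\<^sup>2))"
      using finP Fb(1) bd
      by (intro sum_mono2 mult_nonneg_nonneg prod_nonneg) auto
    also have "\<dots> \<le> exp (4 * B\<^sup>2) * (\<Prod>p\<in>P. 1 - h p)"
      unfolding P_def by (rule sieve_error_product_le[OF w(2)])
    finally show "(\<Sum>S\<in>F. (\<Prod>p\<in>S. h p) * (\<Prod>p\<in>P - S. (1 - h p)\<^sup>2)) \<le> exp (4 * B\<^sup>2) * (\<Prod>p\<in>P. 1 - h p)" .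
    have "real (card F) \<le> real ((w ^ 2 ^ R) ^ 8)" using Fb(3) by (simp only: of_nat_le_iff)
    thus "real (card F) \<le> real (w ^ 2 ^ R) ^ 8" by simp
  qed (use h_nonneg[OF d] M_ge pos in \<open>auto simp: E_def\<close>)
  finally show ?thesis unfolding P_def E_def sieve_const_def by (simp add: algebra_simps)
qed

end

subsection \<open>Rankin-type bounds for weighted sums\<close>

lemma growth_classD:
  assumes "f \<in> growth_class A \<epsilon> C"
  shows "\<And>n. 0 < n \<Longrightarrow> 0 \<le> f n"
    and "\<And>m n. 0 < m \<Longrightarrow> 0 < n \<Longrightarrow> coprime m n \<Longrightarrow>
      f (m * n) \<le> f m * min (A ^ big_omega n) (C * real n powr \<epsilon>)"
    and "\<And>m n. 0 < m \<Longrightarrow> 0 < n \<Longrightarrow> coprime m n \<Longrightarrow> f (m * n) \<le> f m * A ^ big_omega n"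
    and "\<And>n. 0 < n \<Longrightarrow> f n \<le> f 1 * (C * real n powr \<epsilon>)"
proof -
  show nn: "0 \<le> f n" if "0 < n" for n using assms that by (simp add: growth_class_def)
  show le: "f (m * n) \<le> f m * min (A ^ big_omega n) (C * real n powr \<epsilon>)"
    if "0 < m" "0 < n" "coprime m n" for m n
    using assms that by (simp add: growth_class_def)
  show "f (m * n) \<le> f m * A ^ big_omega n" if "0 < m" "0 < n" "coprime m n" for m n
    using le[OF that] nn[OF that(1)] by (smt (verit) min.cobounded1 mult_left_mono)
  show "f n \<le> f 1 * (C * real n powr \<epsilon>)" if "0 < n" for n
    using le[of 1 n] nn[of 1] that by (smt (verit) coprime_1_left min.cobounded2 mult_1 mult_left_mono zero_less_one)
qed

lemma big_omega_prime_power: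
  assumes "prime p"
  shows "big_omega (p ^ e) = e"
proof (cases "e = 0")
  case False
  have "prime_factors (p ^ e) = {p}"
    using assms False by (auto simp: prime_factors_dvd dest: prime_dvd_power primes_dvd_imp_eq prime_gt_0_nat)
  thus ?thesis using assms by (simp add: big_omega_def multiplicity_prime_power)
qed (simp add: big_omega_def)

lemma power_big_omega_le:
  assumes "0 < b" "\<And>p. prime p \<Longrightarrow> p dvd b \<Longrightarrow> y \<le> p"
  shows "y ^ big_omega b \<le> b"
proof -
  have "y ^ big_omega b = (\<Prod>p\<in>prime_factors b. y ^ multiplicity p b)"
    by (simp add: big_omega_def power_sum)
  also have "\<dots> \<le> (\<Prod>p\<in>prime_factors b. p ^ multiplicity p b)"
    using assms(2) by (intro prod_mono conjI power_mono) auto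
  also have "\<dots> = b" using prime_factorization_nat[OF assms(1)] by simp
  finally show ?thesis .
qed

text \<open>Bounds the factor gained by \<open>f * h\<close> when \<open>p ^ e\<close> is attached
  to an integer prime to \<open>p\<close>; it plays \<phi> in \<open>sum_perturb\<close>. The bound
  \<open>A ^ e\<close> serves small exponents, the other one the tail.\<close>

definition euler_bound :: "real \<Rightarrow> real \<Rightarrow> real \<Rightarrow> (nat \<Rightarrow> real) \<Rightarrow> nat \<Rightarrow> nat \<Rightarrow> real" where
  "euler_bound A C \<epsilon> h p e = h (p ^ e) * min (A ^ e) (C * real (p ^ e) powr \<epsilon>)"

text \<open>Plays \<gamma> in \<open>sum_perturb\<close>. The power of \<open>p ^ e\<close> is
  Rankin's weight; \<open>1 + 2 * B / p\<close> pays for a prime divisor of \<open>d\<close>, at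
  which one cannot sieve.\<close>

definition local_weight :: "real \<Rightarrow> real \<Rightarrow> nat \<Rightarrow> nat \<Rightarrow> real" where
  "local_weight B \<delta> p e = (if e = 0 then 1 else (1 + 2 * B / real p) * real (p ^ e) powr \<delta>)"

lemma exp_minus_1_le: "exp x - 1 \<le> x * exp (x::real)"
proof -
  have "(1 + - x) * exp x \<le> exp (- x) * exp x"
    by (intro mult_right_mono exp_ge_add_one_self) simp
  also have "\<dots> = 1" by (simp flip: exp_add)
  finally show ?thesis by (simp add: algebra_simps)
qed

lemma local_weight_ge_1:
  assumes "prime p" "0 \<le> \<delta>" "0 < B"
  shows "1 \<le> local_weight B \<delta> p e"
proof (cases "e = 0")
  case False
  have "1 \<le> real p" using prime_ge_1_nat[OF assms(1)] by simp
  hence "1 \<le> real (p ^ e)" by (simp add: one_le_power)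
  hence "1 * 1 \<le> (1 + 2 * B / real p) * real (p ^ e) powr \<delta>"
    using assms by (intro mult_mono ge_one_powr_ge_zero) auto
  thus ?thesis using False by (simp add: local_weight_def)
qed (simp add: local_weight_def)

text \<open>The twist deviates from 1 by a constant times \<open>1 / p + \<delta> * ln p\<close>. A
  factor \<open>p\<close> is pulled out because \<open>h (p ^ e)\<close> will supply
  \<open>1 / p\<close>.\<close>

lemma local_weight_le:
  assumes "prime p" "0 \<le> \<delta>" "0 < B" "0 < e" "e \<le> E" "\<delta> * ln (real p) \<le> N" "0 \<le> N"
  shows "local_weight B \<delta> p e - 1
    \<le> exp (real E * N) * (real E + 2 * B) * real p * (1 / (real p)\<^sup>2 + \<delta> * ln (real p) / real p)"
proof -
  have p: "2 \<le> real p" using prime_ge_2_nat[OF assms(1)] by simp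
  define x where "x = real e * (\<delta> * ln (real p))"
  have lp: "0 \<le> \<delta> * ln (real p)" using assms(2) p by simp
  have x: "0 \<le> x" "x \<le> real E * (\<delta> * ln (real p))"
    unfolding x_def using lp assms(5) by (auto intro!: mult_right_mono)
  have xN: "x \<le> real E * N" using x(2) assms(6) by (smt (verit) mult_left_mono of_nat_0_le_iff)
  have pow: "real (p ^ e) powr \<delta> = exp x"
    using p by (simp add: x_def powr_def ln_realpow mult_ac)
  have "local_weight B \<delta> p e - 1 = (exp x - 1) + 2 * B / real p * exp x"
    using assms(4) unfolding local_weight_def pow by (simp add: algebra_simps)
  also have "\<dots> \<le> x * exp x + 2 * B / real p * exp x"
    using exp_minus_1_le[of x] by simp
  also have "\<dots> = (x + 2 * B / real p) * exp x" by (simp add: algebra_simps)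
  also have "\<dots> \<le> (x + 2 * B / real p) * exp (real E * N)"
    using x xN assms(3) by (intro mult_left_mono) auto
  also have "\<dots> \<le> (real E * (\<delta> * ln (real p)) + 2 * B / real p) * exp (real E * N)"
    using x by (intro mult_right_mono) auto
  also have "real E * (\<delta> * ln (real p)) + 2 * B / real p
      \<le> (real E + 2 * B) * (1 / real p + \<delta> * ln (real p))"
  proof -
    have "0 \<le> real E * (1 / real p)" "0 \<le> 2 * B * (\<delta> * ln (real p))"
      using lp assms(3) by (auto intro!: mult_nonneg_nonneg)
    thus ?thesis by (simp add: algebra_simps)
  qed
  also have "(1 / real p + \<delta> * ln (real p)) = real p * (1 / (real p)\<^sup>2 + \<delta> * ln (real p) / real p)"
    using p by (simp add: field_simps power2_eq_square)
  finally show ?thesis by (simp add: mult_ac)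
qed

text \<open>For \<open>p \<le> B\<close> the last condition on \<open>h\<close> gives at most
  \<open>p powr l2\<close>, that is \<open>p powr (l2 + 1) / p\<close>, and the numerator is bounded
  by a constant.\<close>

lemma density_prime_power_le:
  assumes h: "h \<in> density_class \<kappa> l1 l2 B K" and "0 < l1" "0 < l2" "0 < B" "prime p" "1 \<le> e"
  shows "h (p ^ e) \<le> max B (B powr (l2 + 1)) / real p"
proof -
  have p: "2 \<le> real p" using prime_ge_2_nat[OF assms(5)] by simp
  show ?thesis
  proof (cases "B < real p")
    case True
    hence "h (p ^ e) \<le> B / real p" using density_classD(5)[OF h] assms by auto
    also have "\<dots> \<le> max B (B powr (l2 + 1)) / real p" using p by (intro divide_right_mono) auto
    finally show ?thesis .
  next
    case False
    have "h (p ^ e) \<le> real p powr (- real e * l1 + l2)"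
      using density_classD(6)[OF h] assms by auto
    also have "\<dots> \<le> real p powr l2" using p assms by (intro powr_mono) auto
    also have "\<dots> = real p powr (l2 + 1) / real p" using p by (simp add: powr_add)
    also have "\<dots> \<le> B powr (l2 + 1) / real p"
      using False p assms by (intro divide_right_mono powr_mono2) auto
    also have "\<dots> \<le> max B (B powr (l2 + 1)) / real p" using p by (intro divide_right_mono) auto
    finally show ?thesis .
  qed
qed

text \<open>\<open>h\<close> decays like \<open>p^(- e l1)\<close>, while the growth of
  \<open>f\<close> and the twist cost at most \<open>p^(e l1 / 4)\<close> each. The remaining
  \<open>p^(l2 - e l1 / 2)\<close> splits into \<open>p^(-2)\<close>, to be summed over
  \<open>p\<close>, and a geometric factor in \<open>e\<close> in which \<open>p\<close> is replaced
  by 2.\<close>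

lemma euler_bound_tail_le:
  assumes h: "h \<in> density_class \<kappa> l1 l2 B K" and pos: "0 < l1" "0 < B" "0 \<le> C"
    and p: "prime p" and \<delta>: "0 \<le> \<delta>" "\<delta> \<le> l1 / 4" and e: "1 \<le> e" "E < e"
    and E: "l2 + 2 \<le> real (Suc E) * (l1 / 2)"
  shows "euler_bound A C (l1 / 4) h p e * local_weight B \<delta> p e
    \<le> C * (1 + 2 * B) * (1 / (real p)\<^sup>2) * ((2 powr (- l1 / 2)) ^ e / (2 powr (- l1 / 2)) ^ Suc E)"
proof -
  have p2: "2 \<le> real p" using prime_ge_2_nat[OF p] by simp
  have h0: "0 \<le> h (p ^ e)" using density_classD(3)[OF h, of "p ^ e"] prime_gt_0_nat[OF p] by simp
  have pe: "real (p ^ e) powr s = real p powr (real e * s)" for s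
    using p2 by (simp add: powr_powr powr_realpow[symmetric])
  have "euler_bound A C (l1 / 4) h p e \<le> h (p ^ e) * (C * real p powr (real e * (l1 / 4)))"
    unfolding euler_bound_def pe using h0 by (intro mult_left_mono) auto
  also have "\<dots> \<le> real p powr (- real e * l1 + l2) * (C * real p powr (real e * (l1 / 4)))"
    using pos density_classD(6)[OF h p e(1)] by (intro mult_right_mono) auto
  finally have eb: "euler_bound A C (l1 / 4) h p e
      \<le> real p powr (- real e * l1 + l2) * (C * real p powr (real e * (l1 / 4)))" .
  have "local_weight B \<delta> p e = (1 + 2 * B / real p) * real p powr (real e * \<delta>)"
    unfolding local_weight_def pe using e by simp
  also have "\<dots> \<le> (1 + 2 * B) * real p powr (real e * (l1 / 4))"
    using p2 pos \<delta> by (intro mult_mono powr_mono mult_left_mono) (auto simp: divide_le_eq)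
  finally have lw: "local_weight B \<delta> p e \<le> (1 + 2 * B) * real p powr (real e * (l1 / 4))" .
  have "euler_bound A C (l1 / 4) h p e * local_weight B \<delta> p e
      \<le> (real p powr (- real e * l1 + l2) * (C * real p powr (real e * (l1 / 4))))
        * ((1 + 2 * B) * real p powr (real e * (l1 / 4)))"
    using eb lw pos by (intro mult_mono) (auto simp: local_weight_def)
  also have "\<dots> = C * (1 + 2 * B) * (real p powr (- real e * l1 + l2)
      * real p powr (real e * (l1 / 4)) * real p powr (real e * (l1 / 4)))"
    by (simp add: mult_ac)
  also have "real p powr (- real e * l1 + l2) * real p powr (real e * (l1 / 4)) * real p powr (real e * (l1 / 4))
      = real p powr (l2 - real e * (l1 / 2))"
    unfolding powr_add[symmetric] by (intro arg_cong[where f = "\<lambda>t. real p powr t"]) (simp add: field_simps)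
  also have "C * (1 + 2 * B) * \<dots> \<le> C * (1 + 2 * B) * (real p powr (- 2) * 2 powr (- (real e - real (Suc E)) * (l1 / 2)))"
  proof (rule mult_left_mono)
    have "real p powr (l2 - real e * (l1 / 2)) \<le> real p powr (- 2 + - (real e - real (Suc E)) * (l1 / 2))"
      using E p2 by (intro powr_mono) (auto simp: algebra_simps)
    also have "\<dots> = real p powr (- 2) * real p powr (- (real e - real (Suc E)) * (l1 / 2))"
      by (rule powr_add)
    also have "\<dots> \<le> real p powr (- 2) * 2 powr (- (real e - real (Suc E)) * (l1 / 2))"
      using p2 e pos by (intro mult_left_mono powr_mono2') (auto simp: mult_nonpos_nonneg)
    finally show "real p powr (l2 - real e * (l1 / 2))
        \<le> real p powr (- 2) * 2 powr (- (real e - real (Suc E)) * (l1 / 2))" .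
  qed (use pos in auto)
  also have "real p powr (- 2) = 1 / (real p)\<^sup>2"
    using p2 by (simp add: powr_minus_divide powr_realpow[of "real p" 2, simplified])
  also have "2 powr (- (real e - real (Suc E)) * (l1 / 2))
      = (2 powr (- l1 / 2)) ^ e / (2 powr (- l1 / 2)) ^ Suc E"
    unfolding powr_power powr_diff[symmetric]
    by (simp add: powr_diff[symmetric] powr_power algebra_simps del: of_nat_Suc power_Suc)
  finally show ?thesis by (simp add: mult.assoc)
qed

text \<open>Exponents up to a constant \<open>E\<close> use \<open>h (p ^ e) \<le> const / p\<close>
  and the bound \<open>A ^ E\<close>; larger ones use the geometric decay. The constant is chosen
  before \<open>h\<close>, \<open>p\<close>, \<delta> and \<open>n\<close>, which gives the
  uniformity.\<close>

lemma local_factor_bound: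
  assumes "0 < l1" "0 < l2" "0 < B" "1 \<le> A" "0 \<le> C" "0 \<le> N"
  obtains c :: real where "0 < c" and "\<And>h \<kappa> K p \<delta> n. h \<in> density_class \<kappa> l1 l2 B K \<Longrightarrow> prime p \<Longrightarrow>
    0 \<le> \<delta> \<Longrightarrow> \<delta> \<le> l1 / 4 \<Longrightarrow> \<delta> * ln (real p) \<le> N \<Longrightarrow>
    (\<Sum>e=1..n. euler_bound A C (l1 / 4) h p e * (local_weight B \<delta> p e - 1))
      \<le> c * (1 / (real p)\<^sup>2 + \<delta> * ln (real p) / real p)"
proof -
  \<comment> \<open>From \<open>Suc E\<close> on, \<open>p^(l2 - e l1 / 2)\<close> is at most
    \<open>p^(-2)\<close>.\<close>
  obtain E where E0: "(l2 + 2) / (l1 / 2) \<le> real E" using real_arch_simple by blast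
  hence E: "l2 + 2 \<le> real (Suc E) * (l1 / 2)" using assms by (simp add: divide_le_eq algebra_simps)
  define \<rho> where "\<rho> = 2 powr (- l1 / 2)"
  have \<rho>: "0 < \<rho>" "\<rho> < 1" unfolding \<rho>_def using assms by (auto simp: powr_less_one)
  define B' where "B' = max B (B powr (l2 + 1))"
  define c1 where "c1 = B' * A ^ E * exp (real E * N) * (real E + 2 * B)"
  define c2 where "c2 = C * (1 + 2 * B) / \<rho> ^ Suc E"
  have B': "0 < B'" unfolding B'_def using assms by auto
  have c1: "0 \<le> c1" unfolding c1_def using B' assms by auto
  have c2: "0 \<le> c2" unfolding c2_def using \<rho> assms by auto
  show ?thesis
  proof (rule that[of "real E * c1 + c2 / (1 - \<rho>) + 1"])
    show "0 < real E * c1 + c2 / (1 - \<rho>) + 1" using c1 c2 \<rho> by (simp add: add_nonneg_pos)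
  next
    fix h \<kappa> K p \<delta> n
    assume h: "h \<in> density_class \<kappa> l1 l2 B K" and p: "prime (p::nat)"
      and \<delta>: "0 \<le> \<delta>" "\<delta> \<le> l1 / 4" "\<delta> * ln (real p) \<le> N"
    have p2: "2 \<le> real p" using prime_ge_2_nat[OF p] by simp
    define x where "x = 1 / (real p)\<^sup>2 + \<delta> * ln (real p) / real p"
    have x: "0 \<le> x" "1 / (real p)\<^sup>2 \<le> x" unfolding x_def using \<delta> p2 by auto
    have eb0: "0 \<le> euler_bound A C (l1 / 4) h p e" for e
      unfolding euler_bound_def using density_classD(3)[OF h, of "p ^ e"] prime_gt_0_nat[OF p] assms
      by (intro mult_nonneg_nonneg) auto
    have "(\<Sum>e=1..n. euler_bound A C (l1 / 4) h p e * (local_weight B \<delta> p e - 1))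
        \<le> (\<Sum>e=1..n. c1 * x * of_bool (e \<le> E) + c2 * x * \<rho> ^ e)"
    proof (intro sum_mono)
      fix e assume e: "e \<in> {1..n}"
      show "euler_bound A C (l1 / 4) h p e * (local_weight B \<delta> p e - 1)
          \<le> c1 * x * of_bool (e \<le> E) + c2 * x * \<rho> ^ e"
      proof (cases "e \<le> E")
        case True
        have "euler_bound A C (l1 / 4) h p e \<le> B' / real p * A ^ E"
          unfolding euler_bound_def B'_def
        proof (intro mult_mono)
          show "h (p ^ e) \<le> max B (B powr (l2 + 1)) / real p"
            using e assms by (intro density_prime_power_le[OF h]) (auto simp: p)
          have "A ^ e \<le> A ^ E" using True assms by (intro power_increasing) auto
          thus "min (A ^ e) (C * real (p ^ e) powr (l1 / 4)) \<le> A ^ E" by linarith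
        qed (use assms p2 in auto)
        moreover have "local_weight B \<delta> p e - 1 \<le> exp (real E * N) * (real E + 2 * B) * real p * x"
          unfolding x_def using e by (intro local_weight_le[OF p \<delta>(1) assms(3) _ True \<delta>(3) assms(6)]) auto
        ultimately have "euler_bound A C (l1 / 4) h p e * (local_weight B \<delta> p e - 1)
            \<le> (B' / real p * A ^ E) * (exp (real E * N) * (real E + 2 * B) * real p * x)"
          using local_weight_ge_1[OF p \<delta>(1) assms(3), of e] B' p2 assms
          by (intro mult_mono) auto
        also have "\<dots> = c1 * x" using p2 by (simp add: c1_def)
        also have "\<dots> \<le> c1 * x * of_bool (e \<le> E) + c2 * x * \<rho> ^ e" using True c2 x \<rho> by simp
        finally show ?thesis .
      next
        case False
        have "euler_bound A C (l1 / 4) h p e * (local_weight B \<delta> p e - 1)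
            \<le> euler_bound A C (l1 / 4) h p e * local_weight B \<delta> p e"
          using eb0 by (intro mult_left_mono) auto
        also have "\<dots> \<le> C * (1 + 2 * B) * (1 / (real p)\<^sup>2) * (\<rho> ^ e / \<rho> ^ Suc E)"
          unfolding \<rho>_def using False e assms \<delta> E
          by (intro euler_bound_tail_le[OF h]) (auto simp: p)
        also have "\<dots> = c2 * (1 / (real p)\<^sup>2) * \<rho> ^ e" by (simp add: c2_def)
        also have "\<dots> \<le> c2 * x * \<rho> ^ e" using c2 x \<rho> by (intro mult_right_mono mult_left_mono) auto
        also have "\<dots> \<le> c1 * x * of_bool (e \<le> E) + c2 * x * \<rho> ^ e" using c1 x by simp
        finally show ?thesis .
      qed
    qed
    also have "\<dots> = c1 * x * (\<Sum>e=1..n. of_bool (e \<le> E)) + c2 * x * (\<Sum>e=1..n. \<rho> ^ e)"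
      by (simp add: sum.distrib sum_distrib_left)
    also have "\<dots> \<le> c1 * x * real E + c2 * x * (1 / (1 - \<rho>))"
    proof (intro add_mono mult_left_mono)
      have "(\<Sum>e=1..n. of_bool (e \<le> E) :: real) = real (card {e\<in>{1..n}. e \<le> E})"
        by (simp add: of_bool_def sum.inter_filter[symmetric])
      also have "card {e\<in>{1..n}. e \<le> E} \<le> card {1..E}" by (intro card_mono) auto
      finally show "(\<Sum>e=1..n. of_bool (e \<le> E) :: real) \<le> real E" by simp
      have "(\<Sum>e=1..n. \<rho> ^ e) \<le> (\<Sum>e. \<rho> ^ e)"
        using \<rho> by (intro sum_le_suminf summable_geometric) auto
      also have "\<dots> = 1 / (1 - \<rho>)" using \<rho> by (intro suminf_geometric) auto
      finally show "(\<Sum>e=1..n. \<rho> ^ e) \<le> 1 / (1 - \<rho>)" .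
    qed (use c1 c2 x in auto)
    also have "\<dots> \<le> (real E * c1 + c2 / (1 - \<rho>) + 1) * x" using x by (simp add: algebra_simps)
    finally show "(\<Sum>e=1..n. euler_bound A C (l1 / 4) h p e * (local_weight B \<delta> p e - 1))
      \<le> (real E * c1 + c2 / (1 - \<rho>) + 1) * (1 / (real p)\<^sup>2 + \<delta> * ln (real p) / real p)"
      unfolding x_def .
  qed
qed

text \<open>At \<open>\<delta> = 0\<close> this is the loss from the primes of \<open>d\<close>
  missing in the sieve; a positive \<delta> adds Rankin's weight.\<close>

definition global_weight :: "real \<Rightarrow> real \<Rightarrow> nat \<Rightarrow> real" where
  "global_weight B \<delta> d = (\<Prod>p\<in>prime_factors d. 1 + 2 * B / real p) * real d powr \<delta>"

lemma global_weight_eq: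
  assumes "0 < d" "finite P" "prime_factors d \<subseteq> P" "\<And>p. p \<in> P \<Longrightarrow> prime p"
  shows "global_weight B \<delta> d = (\<Prod>p\<in>P. local_weight B \<delta> p (multiplicity p d))"
proof -
  have "real d powr \<delta> = (\<Prod>p\<in>prime_factors d. real (p ^ multiplicity p d) powr \<delta>)"
    by (subst (1) prime_factorization_nat[OF assms(1)]) (simp add: prod_powr_distrib)
  hence "global_weight B \<delta> d = (\<Prod>p\<in>prime_factors d. (1 + 2 * B / real p) * real (p ^ multiplicity p d) powr \<delta>)"
    unfolding global_weight_def by (simp only: prod.distrib)
  also have "\<dots> = (\<Prod>p\<in>prime_factors d. local_weight B \<delta> p (multiplicity p d))"
    by (intro prod.cong refl) (auto simp: local_weight_def prime_factors_multiplicity)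
  also have "\<dots> = (\<Prod>p\<in>P. local_weight B \<delta> p (multiplicity p d))"
    using assms(2-4) by (intro prod.mono_neutral_left)
      (auto simp: local_weight_def prime_factors_multiplicity)
  finally show ?thesis .
qed

section \<open>Twisted sums over smooth numbers\<close>

definition smooth_upto :: "nat \<Rightarrow> real \<Rightarrow> nat set" where
  "smooth_upto y Z = {d. 0 < d \<and> real d \<le> Z \<and> (\<forall>p. prime p \<longrightarrow> p dvd d \<longrightarrow> p < y)}"

lemma finite_smooth_upto [simp]: "finite (smooth_upto y Z)"
  unfolding smooth_upto_def by (rule finite_subset[of _ "{..nat \<lfloor>Z\<rfloor>}"]) (auto simp: le_nat_floor)

text \<open>\<open>sum_perturb\<close> for \<open>f * h\<close>. The sum of
  \<open>\<delta> * ln p / p\<close> over \<open>p < y\<close> is at most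
  \<open>2 * \<delta> * ln y \<le> 2 * N\<close>, so the twist costs only a constant as long as
  \<open>\<delta> \<le> N / ln y\<close>.\<close>

lemma weighted_sum_bound:
  assumes h: "h \<in> density_class \<kappa> l1 l2 B K" and f: "f \<in> growth_class A (l1 / 4) C"
    and pos: "0 < B" "0 < c" "0 \<le> N" "1 \<le> A" "0 \<le> C" and \<delta>: "0 \<le> \<delta>" "\<delta> \<le> l1 / 4" "\<delta> * ln (real y) \<le> N"
    and y: "1 \<le> y"
    and local: "\<And>p n. prime p \<Longrightarrow> \<delta> * ln (real p) \<le> N \<Longrightarrow>
      (\<Sum>e=1..n. euler_bound A C (l1 / 4) h p e * (local_weight B \<delta> p e - 1))
      \<le> c * (1 / (real p)\<^sup>2 + \<delta> * ln (real p) / real p)"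
  shows "(\<Sum>d\<in>smooth_upto y Z. f d * h d * global_weight B \<delta> d)
    \<le> exp (c * (2 + 2 * N)) * (\<Sum>d\<in>smooth_upto y Z. f d * h d)"
proof -
  let ?D = "smooth_upto y Z" and ?P = "{p. prime p \<and> p < y}"
  define n where "n = nat \<lfloor>Z\<rfloor>"
  have nn: "0 \<le> f d * h d" if "d \<in> ?D" for d
    using that growth_classD(1)[OF f] density_classD(3)[OF h] by (auto simp: smooth_upto_def)
  have eb0: "0 \<le> euler_bound A C (l1 / 4) h p e" if "prime p" for p e
    unfolding euler_bound_def using density_classD(3)[OF h, of "p ^ e"] prime_gt_0_nat[OF that] pos
    by (intro mult_nonneg_nonneg) auto
  have lw: "1 \<le> local_weight B \<delta> p e" if "prime p" for p e
    by (rule local_weight_ge_1[OF that \<delta>(1) pos(1)])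
  have finP: "finite ?P" by simp
  have "(\<Sum>d\<in>?D. f d * h d * global_weight B \<delta> d)
      = (\<Sum>d\<in>?D. f d * h d * (\<Prod>p\<in>?P. local_weight B \<delta> p (multiplicity p d)))"
  proof (intro sum.cong refl)
    fix d assume "d \<in> ?D"
    hence "global_weight B \<delta> d = (\<Prod>p\<in>?P. local_weight B \<delta> p (multiplicity p d))"
      by (intro global_weight_eq) (auto simp: smooth_upto_def prime_factors_dvd)
    thus "f d * h d * global_weight B \<delta> d
        = f d * h d * (\<Prod>p\<in>?P. local_weight B \<delta> p (multiplicity p d))" by simp
  qed
  also have "\<dots> \<le> (\<Prod>p\<in>?P. 1 + (\<Sum>e=1..n. euler_bound A C (l1 / 4) h p e * (local_weight B \<delta> p e - 1)))
      * (\<Sum>d\<in>?D. f d * h d)"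
  proof (rule sum_perturb)
    fix p d assume p: "prime (p::nat)" and d: "d \<in> ?D"
    have d0: "0 < d" using d by (simp add: smooth_upto_def)
    have dvd: "p ^ multiplicity p d dvd d" by (rule multiplicity_dvd)
    hence dd: "d div p ^ multiplicity p d dvd d" by (metis dvd_div_mult_self dvd_triv_left)
    hence "d div p ^ multiplicity p d \<le> d" "0 < d div p ^ multiplicity p d"
      using d0 by (auto intro: dvd_imp_le dvd_pos_nat)
    moreover from this(1) have "real (d div p ^ multiplicity p d) \<le> real d" by (simp only: of_nat_le_iff)
    moreover have "real d \<le> Z" using d by (simp add: smooth_upto_def)
    ultimately have "0 < d div p ^ multiplicity p d" "real (d div p ^ multiplicity p d) \<le> Z" by linarith+
    thus "d div p ^ multiplicity p d \<in> ?D"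
      using d dd unfolding smooth_upto_def by (auto intro: dvd_trans)
    have "multiplicity p d < 2 ^ multiplicity p d" by (rule less_exp)
    also have "\<dots> \<le> p ^ multiplicity p d" using prime_ge_2_nat[OF p] by (intro power_mono) auto
    also have "\<dots> \<le> d" using dvd d0 by (intro dvd_imp_le)
    also have "\<dots> \<le> n" unfolding n_def using d by (auto simp: smooth_upto_def le_nat_floor)
    finally show "multiplicity p d \<le> n" by simp
  next
    fix p m e :: nat assume p: "prime p" and m: "m \<in> ?D" "0 < e" "\<not> p dvd m"
    have m0: "0 < m" using m by (simp add: smooth_upto_def)
    have cop: "coprime m (p ^ e)" using p m(3) by (metis coprime_commute coprime_power_right_iff prime_imp_coprime)
    have p0: "0 < p ^ e" using prime_gt_0_nat[OF p] by simp
    have "f (m * p ^ e) \<le> f m * min (A ^ e) (C * real (p ^ e) powr (l1 / 4))"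
      using growth_classD(2)[OF f m0 p0 cop] by (simp add: big_omega_prime_power[OF p])
    hence "f (m * p ^ e) * (h m * h (p ^ e))
        \<le> f m * min (A ^ e) (C * real (p ^ e) powr (l1 / 4)) * (h m * h (p ^ e))"
      using density_classD(3)[OF h] m0 p0 by (intro mult_right_mono) auto
    thus "f (m * p ^ e) * h (m * p ^ e) \<le> f m * h m * euler_bound A C (l1 / 4) h p e"
      using density_classD(2)[OF h m0 p0 cop] by (simp add: euler_bound_def mult_ac)
  next
    show "0 \<notin> ?D" by (simp add: smooth_upto_def)
  qed (use lw nn eb0 in \<open>auto simp: local_weight_def\<close>)
  also have "\<dots> \<le> exp (c * (2 + 2 * N)) * (\<Sum>d\<in>?D. f d * h d)"
  proof (intro mult_right_mono sum_nonneg nn)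
    have "(\<Prod>p\<in>?P. 1 + (\<Sum>e=1..n. euler_bound A C (l1 / 4) h p e * (local_weight B \<delta> p e - 1)))
        \<le> (\<Prod>p\<in>?P. exp (c * (1 / (real p)\<^sup>2 + \<delta> * ln (real p) / real p)))"
    proof (intro prod_mono conjI)
      fix p assume p: "p \<in> ?P"
      show "0 \<le> 1 + (\<Sum>e=1..n. euler_bound A C (l1 / 4) h p e * (local_weight B \<delta> p e - 1))"
        using eb0 lw p by (intro add_nonneg_nonneg sum_nonneg mult_nonneg_nonneg) auto
      have "\<delta> * ln (real p) \<le> \<delta> * ln (real y)"
        using p \<delta> prime_gt_0_nat[of p] by (intro mult_left_mono) auto
      hence "(\<Sum>e=1..n. euler_bound A C (l1 / 4) h p e * (local_weight B \<delta> p e - 1))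
          \<le> c * (1 / (real p)\<^sup>2 + \<delta> * ln (real p) / real p)"
        using local[of p n] p \<delta> by simp
      also have "1 + \<dots> \<le> exp \<dots>" by (rule exp_ge_add_one_self)
      finally show "1 + (\<Sum>e=1..n. euler_bound A C (l1 / 4) h p e * (local_weight B \<delta> p e - 1))
          \<le> exp (c * (1 / (real p)\<^sup>2 + \<delta> * ln (real p) / real p))" by simp
    qed
    also have "\<dots> = exp (c * ((\<Sum>p\<in>?P. 1 / (real p)\<^sup>2) + \<delta> * (\<Sum>p\<in>?P. ln (real p) / real p)))"
      by (simp add: exp_sum[symmetric] sum_distrib_left sum.distrib[symmetric])
    also have "\<dots> \<le> exp (c * (2 + 2 * N))"
    proof -
      have "(\<Sum>p\<in>?P. ln (real p) / real p) \<le> (\<Sum>p | prime p \<and> p \<le> y. ln (real p) / real p)"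
        using prime_ge_1_nat by (intro sum_mono2) (auto intro!: divide_nonneg_nonneg ln_ge_zero)
      also have "\<dots> \<le> 2 * ln (real y)" by (rule sum_ln_prime_div_le[OF y])
      finally have "\<delta> * (\<Sum>p\<in>?P. ln (real p) / real p) \<le> \<delta> * (2 * ln (real y))"
        using \<delta> by (intro mult_left_mono)
      moreover have "(\<Sum>p\<in>?P. 1 / (real p)\<^sup>2) \<le> 2" by (rule sum_primes_inverse_square_le) auto
      ultimately show ?thesis using pos \<delta> by (auto intro!: mult_left_mono)
    qed
    finally show "(\<Prod>p\<in>?P. 1 + (\<Sum>e=1..n. euler_bound A C (l1 / 4) h p e * (local_weight B \<delta> p e - 1)))
        \<le> exp (c * (2 + 2 * N))" .
  qed
  finally show ?thesis .
qed

subsection \<open>Sieving a fixed divisor; large prime powers\<close>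

lemma sum_UN_le:
  fixes g :: "'a \<Rightarrow> real"
  assumes "finite I" "\<And>i. i \<in> I \<Longrightarrow> finite (T i)" "\<And>i a. i \<in> I \<Longrightarrow> a \<in> T i \<Longrightarrow> 0 \<le> g a"
    and "U \<subseteq> (\<Union>i\<in>I. T i)"
  shows "sum g U \<le> (\<Sum>i\<in>I. sum g (T i))"
proof -
  have "sum g U \<le> (\<Sum>(i, a)\<in>(SIGMA i:I. T i). g a)"
  proof (rule sum_le_included[where i = snd])
    show "finite U" using assms by (meson finite_UN finite_subset)
    show "\<forall>a\<in>U. \<exists>x\<in>(SIGMA i:I. T i). snd x = a \<and> g a \<le> (case x of (i, a) \<Rightarrow> g a)"
    proof
      fix a assume "a \<in> U"
      then obtain i where "i \<in> I" "a \<in> T i" using assms(4) by blast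
      thus "\<exists>x\<in>(SIGMA i:I. T i). snd x = a \<and> g a \<le> (case x of (i, a) \<Rightarrow> g a)"
        by (intro bexI[of _ "(i, a)"]) auto
    qed
  qed (use assms in auto)
  also have "\<dots> = (\<Sum>i\<in>I. sum g (T i))" using assms by (simp add: sum.Sigma)
  finally show ?thesis .
qed

context weighted_sequence
begin

text \<open>Restoring the factors at the primes of \<open>d\<close> costs
  \<open>1 / (1 - h p) \<le> 1 + 2 * h p\<close> each, by \<open>h p \<le> 1 / 2\<close>.\<close>

lemma sieve_product_le:
  assumes w: "2 * B \<le> real w" and d: "0 < d"
  shows "(\<Prod>p\<in>sieve_range w d R. 1 - h p)
    \<le> (\<Prod>p\<in>sieve_range w 1 R. 1 - h p) * (\<Prod>p\<in>prime_factors d. 1 + 2 * B / real p)"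
proof -
  let ?P = "sieve_range w 1 R" and ?Q = "sieve_range w d R"
  let ?T = "{p\<in>?P. p dvd d}"
  note bd = sieve_range_prime_bounds[OF w]
  have un: "?P = ?Q \<union> ?T" by (auto simp: sieve_range_def)
  have T_pf: "?T \<subseteq> prime_factors d" using d by (auto simp: prime_factors_dvd sieve_range_def)
  have Q0: "0 \<le> (\<Prod>p\<in>?Q. 1 - h p)"
  proof (intro prod_nonneg)
    show "0 \<le> 1 - h p" if "p \<in> ?Q" for p using bd(4)[OF that] by simp
  qed
  have "1 \<le> (\<Prod>p\<in>?T. (1 - h p) * (1 + 2 * B / real p))"
  proof (intro prod_ge_1)
    fix p assume "p \<in> ?T"
    hence p: "p \<in> ?P" by simp
    have "h p * h p \<le> 1 / 2 * h p" using bd(3,4)[OF p] by (intro mult_right_mono)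
    hence "1 \<le> (1 - h p) * (1 + 2 * h p)" by (simp add: algebra_simps)
    also have "\<dots> \<le> (1 - h p) * (1 + 2 * (B / real p))"
      using bd(4,5)[OF p] by (intro mult_left_mono) auto
    finally show "1 \<le> (1 - h p) * (1 + 2 * B / real p)" by simp
  qed
  also have "\<dots> = (\<Prod>p\<in>?T. 1 - h p) * (\<Prod>p\<in>?T. 1 + 2 * B / real p)" by (rule prod.distrib)
  also have "\<dots> \<le> (\<Prod>p\<in>?T. 1 - h p) * (\<Prod>p\<in>prime_factors d. 1 + 2 * B / real p)"
  proof (intro mult_left_mono prod_nonneg prod_mono2)
    show "0 \<le> 1 - h p" if "p \<in> ?T" for p using bd(4)[of p 1 R] that by simp
  qed (use T_pf pos in auto)
  finally have "(\<Prod>p\<in>?Q. 1 - h p) * 1 \<le> (\<Prod>p\<in>?Q. 1 - h p)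
      * ((\<Prod>p\<in>?T. 1 - h p) * (\<Prod>p\<in>prime_factors d. 1 + 2 * B / real p))"
    using Q0 by (intro mult_left_mono)
  moreover have "(\<Prod>p\<in>?P. 1 - h p) = (\<Prod>p\<in>?Q. 1 - h p) * (\<Prod>p\<in>?T. 1 - h p)"
    by (subst un, rule prod.union_disjoint) (auto simp: sieve_range_def)
  ultimately show ?thesis by (simp add: mult.assoc)
qed

definition sieved_part :: "nat set \<Rightarrow> nat \<Rightarrow> 'a set" where
  "sieved_part D z = {a \<in> Sp. \<exists>d\<in>D. \<exists>b. c a = d * b \<and> coprime d b \<and> (\<forall>p. prime p \<longrightarrow> p dvd b \<longrightarrow> z \<le> p)}"

text \<open>\<open>D\<close> is left open because it is applied to all \<open>d \<le> Z\<close> and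
  to the smooth \<open>d > sqrt Z\<close>. Several \<open>d\<close> may claim the same
  \<open>a\<close>; as the terms are nonnegative, a union bound suffices.\<close>

lemma sieved_part_bound:
  assumes w: "2 \<le> w" "2 * B \<le> real w" and f: "f \<in> growth_class A \<epsilon> C" and A: "1 \<le> A"
    and D: "finite D" "\<And>d. d \<in> D \<Longrightarrow> 0 < d \<and> real d \<le> Z"
    and level: "Z * real (w ^ 2 ^ R) ^ 8 \<le> M powr \<theta>" "real (w ^ 2 ^ R) \<le> M"
    and X: "1 \<le> X" "\<And>a. a \<in> Sp \<Longrightarrow> real (c a) \<le> X"
  shows "(\<Sum>a\<in>sieved_part D (w ^ 2 ^ R). \<chi> a * f (c a))
    \<le> A powr (ln X / ln (real (w ^ 2 ^ R))) *
      (sieve_const \<kappa> B K k1 w * M * (\<Prod>p\<in>sieve_range w 1 R. 1 - h p) * (\<Sum>d\<in>D. f d * h d * global_weight B 0 d)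
       + k2 * real (w ^ 2 ^ R) ^ 8 * M powr (1 - \<xi>) * (\<Sum>d\<in>D. f d))"
proof -
  define z where "z = w ^ 2 ^ R"
  define W where "W = A powr (ln X / ln (real z))"
  define V where "V = (\<Prod>p\<in>sieve_range w 1 R. 1 - h p)"
  have z2: "2 \<le> z" unfolding z_def using level_mono[OF w(1), of 0 R] w(1) by simp
  have f0: "0 \<le> f d" if "d \<in> D" for d using growth_classD(1)[OF f] D(2) that by blast
  let ?T = "\<lambda>d. {a \<in> Sp. \<exists>b. c a = d * b \<and> coprime d b \<and> (\<forall>p. prime p \<longrightarrow> p dvd b \<longrightarrow> z \<le> p)}"
  let ?U = "\<lambda>d. {a \<in> Sp. d dvd c a \<and> (\<forall>p\<in>sieve_range w d R. \<not> p dvd c a)}"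
  have sc: "0 \<le> sieve_const \<kappa> B K k1 w" unfolding sieve_const_def using pos by simp
  have "(\<Sum>a\<in>sieved_part D z. \<chi> a * f (c a)) \<le> (\<Sum>d\<in>D. \<Sum>a\<in>?T d. \<chi> a * f (c a))"
    using D finite_Sp weight_nonneg growth_classD(1)[OF f] c_pos
    by (intro sum_UN_le) (auto simp: sieved_part_def)
  also have "\<dots> \<le> (\<Sum>d\<in>D. W * f d * (\<Sum>a\<in>?U d. \<chi> a))"
  proof (intro sum_mono)
    fix d assume d: "d \<in> D"
    have d0: "0 < d" using D(2)[OF d] by simp
    have "(\<Sum>a\<in>?T d. \<chi> a * f (c a)) \<le> (\<Sum>a\<in>?T d. \<chi> a * (W * f d))"
    proof (intro sum_mono mult_left_mono)
      fix a assume "a \<in> ?T d"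
      then obtain b where a: "a \<in> Sp" and b: "c a = d * b" "coprime d b"
        "\<And>p. prime p \<Longrightarrow> p dvd b \<Longrightarrow> z \<le> p" by blast
      have b0: "0 < b" using c_pos[OF a] b(1) by (cases b) auto
      have "z ^ big_omega b \<le> b" by (rule power_big_omega_le[OF b0 b(3)])
      also have "b \<le> c a" using b(1) d0 by simp
      finally have "real (z ^ big_omega b) \<le> X" using X(2)[OF a] by linarith
      hence "real z ^ big_omega b \<le> X" by simp
      hence "ln (real z ^ big_omega b) \<le> ln X" using z2 X(1) by (subst ln_le_cancel_iff) auto
      hence "real (big_omega b) \<le> ln X / ln (real z)" using z2 by (simp add: ln_realpow pos_le_divide_eq)
      hence "A powr real (big_omega b) \<le> W" unfolding W_def using A by (intro powr_mono) auto
      hence "A ^ big_omega b \<le> W" using A by (simp add: powr_realpow)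
      hence "f d * A ^ big_omega b \<le> f d * W" using f0[OF d] by (rule mult_left_mono)
      thus "f (c a) \<le> W * f d" using growth_classD(3)[OF f d0 b0 b(2)] b(1) by (simp add: mult.commute)
      show "0 \<le> \<chi> a" by (rule weight_nonneg[OF a])
    qed
    also have "\<dots> = W * f d * (\<Sum>a\<in>?T d. \<chi> a)" by (simp add: sum_distrib_left mult_ac)
    also have "\<dots> \<le> W * f d * (\<Sum>a\<in>?U d. \<chi> a)"
    proof (intro mult_left_mono sum_mono2)
      show "?T d \<subseteq> ?U d"
      proof
        fix a assume "a \<in> ?T d"
        then obtain b where a: "a \<in> Sp" and b: "c a = d * b"
          "\<And>p. prime p \<Longrightarrow> p dvd b \<Longrightarrow> z \<le> p" by blast
        have "\<not> p dvd c a" if "p \<in> sieve_range w d R" for p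
          using that b(2)[of p] unfolding b(1) sieve_range_def z_def by (auto simp: prime_dvd_mult_iff)
        thus "a \<in> ?U d" using a b(1) by auto
      qed
    qed (use finite_Sp weight_nonneg f0[OF d] in \<open>auto simp: W_def\<close>)
    finally show "(\<Sum>a\<in>?T d. \<chi> a * f (c a)) \<le> W * f d * (\<Sum>a\<in>?U d. \<chi> a)" .
  qed
  also have "\<dots> \<le> (\<Sum>d\<in>D. W * f d * (sieve_const \<kappa> B K k1 w * h d * M * (V * global_weight B 0 d)
      + k2 * real z ^ 8 * M powr (1 - \<xi>)))"
  proof (intro sum_mono mult_left_mono)
    fix d assume d: "d \<in> D"
    have d0: "0 < d" using D(2)[OF d] by simp
    have "real d * real (w ^ 2 ^ R) ^ 8 \<le> Z * real (w ^ 2 ^ R) ^ 8"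
      using D(2)[OF d] by (intro mult_right_mono) auto
    hence "(\<Sum>a\<in>?U d. \<chi> a) \<le> sieve_const \<kappa> B K k1 w * h d * M * (\<Prod>p\<in>sieve_range w d R. 1 - h p)
        + k2 * real z ^ 8 * M powr (1 - \<xi>)"
      using level unfolding z_def by (intro sieve_bound[OF w d0]) auto
    also have "sieve_const \<kappa> B K k1 w * h d * M * (\<Prod>p\<in>sieve_range w d R. 1 - h p)
        \<le> sieve_const \<kappa> B K k1 w * h d * M * (V * global_weight B 0 d)"
      using sieve_product_le[OF w(2) d0, of R] sc h_nonneg[OF d0] M_ge d0
      unfolding V_def global_weight_def by (intro mult_left_mono mult_nonneg_nonneg) auto
    finally show "(\<Sum>a\<in>?U d. \<chi> a) \<le> sieve_const \<kappa> B K k1 w * h d * M * (V * global_weight B 0 d)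
        + k2 * real z ^ 8 * M powr (1 - \<xi>)" by simp
    show "0 \<le> W * f d" using f0[OF d] by (simp add: W_def)
  qed
  also have "\<dots> = W * (sieve_const \<kappa> B K k1 w * M * V * (\<Sum>d\<in>D. f d * h d * global_weight B 0 d)
       + k2 * real z ^ 8 * M powr (1 - \<xi>) * (\<Sum>d\<in>D. f d))"
    by (simp add: sum_distrib_left sum_distrib_right sum.distrib algebra_simps)
  finally show ?thesis unfolding z_def W_def V_def .
qed

definition prime_power_part :: "nat \<Rightarrow> real \<Rightarrow> 'a set" where
  "prime_power_part y Y = {a \<in> Sp. \<exists>q e. prime q \<and> q < y \<and> q ^ e dvd c a \<and> Y < real (q ^ e)}"

text \<open>For each \<open>q\<close> one passes to its least power exceeding \<open>Y\<close>: it
  still divides \<open>c a\<close>, and being at most \<open>Y * y\<close> it is within reach of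
  equidistribution. The decay of \<open>h\<close> at prime powers then gives
  \<open>Y powr (- l1)\<close>.\<close>

lemma prime_power_part_bound:
  assumes Y: "1 \<le> Y" "Y * real y \<le> M powr \<theta>"
  shows "(\<Sum>a\<in>prime_power_part y Y. \<chi> a)
    \<le> real y * ((1 + k1) * M * real y powr l2 * Y powr (- l1) + k2 * M powr (1 - \<xi>))"
proof -
  define m where "m q = (LEAST e. Y < real (q ^ e))" for q :: nat
  let ?Q = "{q. prime q \<and> q < y}"
  let ?T = "\<lambda>q. {a. a \<in> Sp \<and> q ^ m q dvd c a}"
  have fin: "finite ?Q" by simp
  have m: "Y < real (q ^ m q)" "1 \<le> m q" "real (q ^ m q) \<le> Y * real y" if q: "q \<in> ?Q" for q
  proof -
    have q2: "2 \<le> q" "q < y" using q prime_ge_2_nat by auto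
    obtain e where "Y < real q ^ e" using real_arch_pow[of "real q" Y] q2 by auto
    hence "Y < real (q ^ e)" by simp
    thus Ym: "Y < real (q ^ m q)" unfolding m_def by (rule LeastI)
    thus m1: "1 \<le> m q" using Y by (cases "m q") auto
    then obtain k where k: "m q = Suc k" by (cases "m q") auto
    have "\<not> Y < real (q ^ k)" using not_less_Least[of k "\<lambda>e. Y < real (q ^ e)"] k by (simp add: m_def)
    hence "real (q ^ k) * real q \<le> Y * real y" using q2 Y by (intro mult_mono) auto
    thus "real (q ^ m q) \<le> Y * real y" using k by (simp add: mult.commute)
  qed
  have "(\<Sum>a\<in>prime_power_part y Y. \<chi> a) \<le> (\<Sum>q\<in>?Q. \<Sum>a\<in>?T q. \<chi> a)"
  proof (rule sum_UN_le)
    show "prime_power_part y Y \<subseteq> (\<Union>q\<in>?Q. ?T q)"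
    proof
      fix a assume "a \<in> prime_power_part y Y"
      then obtain q e where a: "a \<in> Sp" and q: "q \<in> ?Q" and e: "q ^ e dvd c a" "Y < real (q ^ e)"
        unfolding prime_power_part_def by blast
      have "m q \<le> e" unfolding m_def using e(2) by (rule Least_le)
      hence "q ^ m q dvd c a" using e(1) le_imp_power_dvd dvd_trans by blast
      thus "a \<in> (\<Union>q\<in>?Q. ?T q)" using a q by auto
    qed
  qed (use finite_Sp weight_nonneg in auto)
  also have "\<dots> \<le> (\<Sum>q\<in>?Q. (1 + k1) * M * real y powr l2 * Y powr (- l1) + k2 * M powr (1 - \<xi>))"
  proof (intro sum_mono)
    fix q assume q: "q \<in> ?Q"
    have q0: "0 < q" using q prime_gt_0_nat by auto
    have "(\<Sum>a\<in>?T q. \<chi> a) \<le> (1 + k1) * h (q ^ m q) * M + k2 * M powr (1 - \<xi>)"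
      using m[OF q] q0 Y(2) by (intro congruence_sum_le) auto
    moreover have "h (q ^ m q) \<le> real y powr l2 * Y powr (- l1)"
    proof -
      have "h (q ^ m q) \<le> real q powr (- real (m q) * l1 + l2)"
        using density_classD(6)[OF h_density] q m(2)[OF q] by auto
      also have "\<dots> = real (q ^ m q) powr (- l1) * real q powr l2"
        using q0 unfolding powr_add by (simp add: powr_powr powr_realpow[symmetric])
      also have "\<dots> \<le> Y powr (- l1) * real y powr l2"
        using m(1)[OF q] Y pos q q0 by (intro mult_mono powr_mono2 powr_mono2') auto
      finally show ?thesis by (simp add: mult.commute)
    qed
    hence "(1 + k1) * M * h (q ^ m q) \<le> (1 + k1) * M * (real y powr l2 * Y powr (- l1))"
      using pos M_ge by (intro mult_left_mono) auto
    ultimately show "(\<Sum>a\<in>?T q. \<chi> a) \<le> (1 + k1) * M * real y powr l2 * Y powr (- l1) + k2 * M powr (1 - \<xi>)"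
      by (simp add: mult_ac)
  qed
  also have "\<dots> = real (card ?Q) * ((1 + k1) * M * real y powr l2 * Y powr (- l1) + k2 * M powr (1 - \<xi>))" by simp
  also have "\<dots> \<le> real y * ((1 + k1) * M * real y powr l2 * Y powr (- l1) + k2 * M powr (1 - \<xi>))"
  proof (intro mult_right_mono)
    have "card ?Q \<le> card {..<y}" by (intro card_mono) auto
    thus "real (card ?Q) \<le> real y" by simp
  qed (use pos M_ge in \<open>auto intro!: add_nonneg_nonneg mult_nonneg_nonneg\<close>)
  finally show ?thesis .
qed

end

subsection \<open>The bound for large \<open>M\<close>\<close>

text \<open>A lower bound, independent of \<open>h\<close>, for the factors of the full product at
  primes below the sieve range.\<close>

definition small_product :: "real \<Rightarrow> nat \<Rightarrow> real" where
  "small_product B w = (\<Prod>p | prime p \<and> B < real p \<and> p < w. 1 - B / real p)"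

lemma small_product_pos:
  assumes "0 < B"
  shows "0 < small_product B w"
  unfolding small_product_def using assms by (intro prod_pos) (auto simp: prime_gt_0_nat)

context weighted_sequence
begin

definition full_product :: real where
  "full_product = (\<Prod>p | prime p \<and> B < real p \<and> real p \<le> M. 1 - h p)"

lemma full_product_nonneg: "0 \<le> full_product"
  unfolding full_product_def using h_prime_less_1 by (intro prod_nonneg) (auto simp: less_imp_le)

text \<open>Completes the sieved product to all primes in \<open>(B, M]\<close>: those below
  \<open>w\<close> cost a constant, those from the level up to \<open>M\<close> a power of
  \<open>ln M / ln z\<close>.\<close>

lemma sieve_range_product_le:
  assumes w: "2 \<le> w" "2 * B \<le> real w" and M2: "2 \<le> M" and level: "real (w ^ 2 ^ r) \<le> M"
  shows "(\<Prod>p\<in>sieve_range w 1 r. 1 - h p) * small_product B w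
    \<le> full_product * ((2 * ln M / ln (real (w ^ 2 ^ r))) powr \<kappa> * (1 + K / ln (real w)))"
proof -
  define z where "z = w ^ 2 ^ r"
  have wz: "w \<le> z" unfolding z_def using level_mono[OF w(1), of 0 r] by simp
  have w0: "B < real w" using w pos by linarith
  let ?S1 = "{p. prime p \<and> B < real p \<and> p < w}" and ?S2 = "sieve_range w 1 r"
  let ?S3 = "{p. prime p \<and> z \<le> p \<and> real p \<le> M}"
  have S2: "?S2 = {p. prime p \<and> w \<le> p \<and> p < z}"
    unfolding sieve_range_def z_def by auto
  have fin3: "finite ?S3"
    by (rule finite_subset[of _ "{..nat \<lfloor>M\<rfloor>}"]) (auto simp: le_nat_floor)
  have fin1: "finite ?S1" by simp
  have zM: "real z \<le> M" using level by (simp add: z_def)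
  have eq: "{p. prime p \<and> B < real p \<and> real p \<le> M} = ?S1 \<union> (?S2 \<union> ?S3)" (is "?L = ?R")
  proof (intro equalityI subsetI)
    fix p assume "p \<in> ?L"
    thus "p \<in> ?R" unfolding S2 by auto
  next
    fix p assume "p \<in> ?R"
    hence "p \<in> ?S1 \<or> (prime p \<and> w \<le> p \<and> p < z) \<or> p \<in> ?S3" unfolding S2 by blast
    thus "p \<in> ?L"
    proof (elim disjE)
      assume p: "p \<in> ?S1"
      hence "real p \<le> real z" using wz by simp
      thus ?thesis using p zM by simp
    next
      assume p: "prime p \<and> w \<le> p \<and> p < z"
      hence "real w \<le> real p" "real p \<le> real z" by auto
      thus ?thesis using p zM w0 by simp
    next
      assume p: "p \<in> ?S3"
      hence "real w \<le> real p" using wz by auto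
      thus ?thesis using p w0 by simp
    qed
  qed
  have full: "full_product = (\<Prod>p\<in>?S1. 1 - h p) * ((\<Prod>p\<in>?S2. 1 - h p) * (\<Prod>p\<in>?S3. 1 - h p))"
    unfolding full_product_def eq S2 using fin1 fin3 wz
    by (subst prod.union_disjoint; (subst prod.union_disjoint)?) auto
  have small: "small_product B w \<le> (\<Prod>p\<in>?S1. 1 - h p)"
    unfolding small_product_def using h_prime_le pos
    by (intro prod_mono) (auto simp: prime_gt_0_nat)
  have V0: "0 \<le> (\<Prod>p\<in>?S2. 1 - h p)"
    using sieve_range_prime_bounds(4)[OF w(2)] by (intro prod_nonneg) force
  have B3: "B < real p" if "p \<in> ?S3" for p
  proof -
    have "real w \<le> real p" using that wz by auto
    thus ?thesis using w0 by linarith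
  qed
  have P3: "0 \<le> (\<Prod>p\<in>?S3. 1 - h p)"
  proof (rule prod_nonneg)
    show "0 \<le> 1 - h p" if "p \<in> ?S3" for p using h_prime_less_1(2)[of p] B3[OF that] that by simp
  qed
  have "small_product B w * ((\<Prod>p\<in>?S2. 1 - h p) * (\<Prod>p\<in>?S3. 1 - h p)) \<le> full_product"
    unfolding full using small V0 P3 by (intro mult_right_mono mult_nonneg_nonneg)
  hence ge: "(\<Prod>p\<in>?S2. 1 - h p) * small_product B w * (\<Prod>p\<in>?S3. 1 - h p) \<le> full_product"
    by (simp only: mult_ac)
  have inv: "(\<Prod>p\<in>?S3. inverse (1 - h p)) \<le> (2 * ln M / ln (real z)) powr \<kappa> * (1 + K / ln (real w))"
  proof -
    \<comment> \<open>The range in \<open>inverse_prod_le\<close> is half-open; the end point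
      \<open>M + 1\<close> includes \<open>p = M\<close> and costs a factor 2 in the
      logarithm.\<close>
    have "(\<Prod>p\<in>?S3. inverse (1 - h p)) \<le> (ln (M + 1) / ln (real z)) powr \<kappa> * (1 + K / ln (real w))"
      using w0 wz w zM by (intro inverse_prod_le) auto
    also have "\<dots> \<le> (2 * ln M / ln (real z)) powr \<kappa> * (1 + K / ln (real w))"
    proof (intro mult_right_mono powr_mono2 divide_right_mono)
      have "M + 1 \<le> M * M" using M2 mult_mono[of 2 M M M] by linarith
      hence "ln (M + 1) \<le> ln (M * M)" using M2 by simp
      thus "ln (M + 1) \<le> 2 * ln M" using M2 by (simp add: ln_mult)
    qed (use w wz M2 pos in auto)
    finally show ?thesis .
  qed
  have "(\<Prod>p\<in>?S3. 1 - h p) * (\<Prod>p\<in>?S3. inverse (1 - h p)) = (\<Prod>p\<in>?S3. 1)"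
    unfolding prod.distrib[symmetric]
  proof (rule prod.cong)
    fix p assume "p \<in> ?S3"
    thus "(1 - h p) * inverse (1 - h p) = 1" using h_prime_less_1(2)[of p] B3 by simp
  qed simp
  hence "(\<Prod>p\<in>?S2. 1 - h p) * small_product B w = (\<Prod>p\<in>?S2. 1 - h p) * small_product B w
      * (\<Prod>p\<in>?S3. 1 - h p) * (\<Prod>p\<in>?S3. inverse (1 - h p))"
    by (simp add: mult.assoc)
  also have "\<dots> \<le> full_product * (\<Prod>p\<in>?S3. inverse (1 - h p))"
  proof (intro mult_right_mono ge prod_nonneg)
    show "0 \<le> inverse (1 - h p)" if "p \<in> ?S3" for p
      using h_prime_less_1(2)[of p] B3[OF that] that by simp
  qed
  also have "\<dots> \<le> full_product * ((2 * ln M / ln (real z)) powr \<kappa> * (1 + K / ln (real w)))"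
    using inv full_product_nonneg by (rule mult_left_mono)
  finally show ?thesis by (simp add: z_def)
qed

end

text \<open>With \<open>t powr \<kappa> \<le> exp (\<kappa> * t)\<close> the three exponents add up
  to exactly \<open>- t\<close> for this \<open>N\<close>. At \<open>t = 2 ^ (R - r)\<close> the
  bound \<open>1 / t\<close> can be summed over the levels.\<close>

lemma exp_decay_le:
  fixes t :: real
  assumes "1 \<le> t" "1 \<le> A" "0 \<le> \<kappa>" and N: "N = 4 * (N1 * ln A + \<kappa> + 1)"
  shows "A powr (N1 * t) * t powr \<kappa> * exp (- N * t / 4) \<le> 1 / t"
proof -
  have "A powr (N1 * t) = exp (N1 * t * ln A)" using assms by (simp add: powr_def)
  moreover have "t powr \<kappa> \<le> exp (\<kappa> * t)"
    using assms ln_le_minus_one[of t] by (auto simp: powr_def intro!: mult_left_mono)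
  moreover have "exp (N1 * t * ln A) * exp (\<kappa> * t) * exp (- N * t / 4) = exp (- t)"
    unfolding exp_add[symmetric] N by (simp add: field_simps)
  ultimately have "A powr (N1 * t) * t powr \<kappa> * exp (- N * t / 4) \<le> exp (- t)"
    by (metis exp_ge_zero mult_left_mono mult_right_mono)
  also have "\<dots> \<le> 1 / t"
  proof -
    have "t \<le> exp t" using exp_ge_add_one_self[of t] by linarith
    thus ?thesis using assms(1) by (simp add: exp_minus inverse_eq_divide frac_le)
  qed
  finally show ?thesis .
qed

lemma sum_half_powers_le: "(\<Sum>r<R. 1 / 2 ^ (R - r)) \<le> (1::real)"
proof -
  have "(\<Sum>r<R. 1 / 2 ^ (R - r)) = 1 - 1 / (2::real) ^ R"
  proof (induction R)
    case (Suc R)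
    have "(\<Sum>r<R. 1 / 2 ^ (Suc R - r)) = (\<Sum>r<R. 1 / (2::real) ^ (R - r)) / 2"
      unfolding sum_divide_distrib by (intro sum.cong refl) (simp add: Suc_diff_le)
    thus ?case using Suc by (simp add: field_simps)
  qed simp
  thus ?thesis by simp
qed

text \<open>
  The level \<open>z R = w^(2^R)\<close> lies between \<open>M^(\<eta>/2)\<close> and \<open>M^\<eta>\<close>, so that a number \<open>\<le> M^(\<alpha>+1)\<close> has at most
  \<open>N1 2^(R-r)\<close> prime factors \<open>\<ge> z r\<close>. The constant \<open>N\<close> makes Rankin's saving \<open>exp (- N 2^(R-r) / 4)\<close> beat
  the loss \<open>A^(N1 2^(R-r)) (2^(R-r))^\<kappa>\<close> from \<open>f\<close> and from sieving only up to \<open>z r\<close>, and \<open>M^\<tau>\<close> is the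
  power of \<open>M\<close> saved in all error terms.
\<close>

locale large_parameter = weighted_sequence Sp \<chi> c M h \<theta> \<xi> \<kappa> l1 l2 B K k1 k2
  for Sp :: "'a set" and \<chi> c M h \<theta> \<xi> \<kappa> l1 l2 B K k1 k2 +
  fixes f :: "nat \<Rightarrow> real" and A \<alpha> C0 C1 cl N1 N \<theta>1 \<eta> \<tau> :: real and w R :: nat
  assumes f_C0: "f \<in> growth_class A (l1 / 4) C0" and f_C1: "f \<in> growth_class A (\<tau> / (\<alpha> + 1)) C1"
    and A: "1 \<le> A" and \<alpha>: "0 < \<alpha>" and C0: "0 \<le> C0" and C1: "0 \<le> C1" and cl: "0 < cl"
    and local_bound: "\<And>p \<delta> n. prime p \<Longrightarrow> 0 \<le> \<delta> \<Longrightarrow> \<delta> \<le> l1 / 4 \<Longrightarrow> \<delta> * ln (real p) \<le> N \<Longrightarrow>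
      (\<Sum>e=1..n. euler_bound A C0 (l1 / 4) h p e * (local_weight B \<delta> p e - 1))
        \<le> cl * (1 / (real p)\<^sup>2 + \<delta> * ln (real p) / real p)"
    and N1: "N1 = 2 * (\<alpha> + 1) / \<eta>" and N: "N = 4 * (N1 * ln A + \<kappa> + 1)"
    and \<theta>1: "0 < \<theta>1" "\<theta>1 \<le> 1" "8 * \<theta>1 \<le> \<theta>" "8 * \<theta>1 \<le> \<xi>"
    and \<eta>: "0 < \<eta>" "16 * \<eta> \<le> \<theta>1" "16 * (\<eta> * (1 + l2)) \<le> \<theta>1 * l1"
    and \<tau>: "0 < \<tau>" "\<tau> \<le> 1" "4 * \<tau> * real w \<le> \<theta>1 * l1" "4 * \<tau> \<le> \<xi>"
    and w: "2 \<le> w" "2 * B \<le> real w" "1 \<le> ln (real w)" "4 * N \<le> l1 * ln (real w)" "N1 * ln A \<le> ln (real w)"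
    and R: "real (w ^ 2 ^ R) \<le> M powr \<eta>" "M powr \<eta> < (real (w ^ 2 ^ R))\<^sup>2"
    and c_le: "\<And>a. a \<in> Sp \<Longrightarrow> real (c a) \<le> M powr (\<alpha> + 1)"
begin

section \<open>Sizes of the levels and the budget of exponents\<close>

definition Z :: real where "Z = M powr \<theta>1"
definition z :: "nat \<Rightarrow> nat" where "z r = w ^ 2 ^ r"
definition S :: real where "S = (\<Sum>a | 0 < a \<and> real a \<le> M. f a * h a)"
definition E0 :: real where "E0 = exp (cl * (2 + 2 * N))"
definition H :: real where "H = (4 / \<eta>) powr \<kappa> * (1 + K / ln (real w)) / small_product B w"
definition sc :: real where "sc = sieve_const \<kappa> B K k1 w"

lemma f_nonneg: "0 < n \<Longrightarrow> 0 \<le> f n" by (rule growth_classD(1)[OF f_C0])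

lemma M2: "2 \<le> M"
proof -
  have "real w \<le> real (w ^ 2 ^ R)" using level_mono[OF w(1), of 0 R] by (simp only: of_nat_le_iff) simp
  also note R(1)
  also have "M powr \<eta> \<le> M powr 1" using M_ge \<eta> \<theta>1 by (intro powr_mono) auto
  finally show ?thesis using w(1) M_ge by simp
qed

lemma N1_N: "0 < N1" "0 < N"
proof -
  show "0 < N1" using N1 \<alpha> \<eta> by simp
  hence "0 \<le> N1 * ln A" using A by simp
  thus "0 < N" using pos(3) unfolding N by (simp add: add_nonneg_pos)
qed

lemma z_mono: "r \<le> s \<Longrightarrow> z r \<le> z s"
  unfolding z_def by (rule level_mono[OF w(1)])

lemma z_bounds: assumes "r \<le> R" shows "w \<le> z r" "real (z r) \<le> real (z R)" "real (z r) \<le> M powr \<eta>" "real (z r) \<le> M"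
proof -
  show "w \<le> z r" using z_mono[of 0 r] by (simp add: z_def)
  show zR: "real (z r) \<le> real (z R)" using z_mono[OF assms] by simp
  also have "real (z R) \<le> M powr \<eta>" using R(1) by (simp add: z_def)
  finally show "real (z r) \<le> M powr \<eta>" .
  also have "M powr \<eta> \<le> M powr 1" using M_ge \<eta> \<theta>1 by (intro powr_mono) auto
  finally show "real (z r) \<le> M" using M_ge by simp
qed

lemma ln_z: "ln (real (z r)) = 2 ^ r * ln (real w)"
  using w(1) by (simp add: z_def ln_realpow)

lemma ln_z_top: assumes "r \<le> R" shows "ln (real (z R)) = 2 ^ (R - r) * ln (real (z r))"
  using assms by (simp add: ln_z power_add[symmetric] mult.assoc[symmetric])

lemma ln_M_le: "\<eta> * ln M \<le> 2 * ln (real (z R))"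
proof -
  have "0 < real (z R)" using w(1) by (simp add: z_def)
  have "ln (M powr \<eta>) \<le> ln ((real (z R))\<^sup>2)"
    using R(2) M2 \<open>0 < real (z R)\<close> by (subst ln_le_cancel_iff) (auto simp: z_def)
  thus ?thesis using M2 \<open>0 < real (z R)\<close> by (simp add: ln_powr ln_realpow)
qed

lemma ln_z_pos: "0 < ln (real (z r))"
  using w(3) by (simp add: ln_z)

lemma ln_M_ratio:
  assumes "r \<le> R"
  shows "ln M / ln (real (z r)) \<le> (2 / \<eta>) * 2 ^ (R - r)"
proof -
  have "\<eta> * ln M \<le> 2 * (2 ^ (R - r) * ln (real (z r)))" using ln_M_le ln_z_top[OF assms] by simp
  thus ?thesis using ln_z_pos[of r] \<eta> by (simp add: field_simps)
qed

lemma growth_exponent_le: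
  assumes "r \<le> R"
  shows "A powr (ln (M powr (\<alpha> + 1)) / ln (real (z r))) \<le> A powr (N1 * 2 ^ (R - r))"
proof (intro powr_mono A)
  have "ln (M powr (\<alpha> + 1)) / ln (real (z r)) = (\<alpha> + 1) * (ln M / ln (real (z r)))"
    using M2 by (simp add: ln_powr)
  also have "\<dots> \<le> (\<alpha> + 1) * ((2 / \<eta>) * 2 ^ (R - r))"
    using \<alpha> by (intro mult_left_mono ln_M_ratio assms) auto
  also have "\<dots> = N1 * 2 ^ (R - r)" by (simp add: N1)
  finally show "ln (M powr (\<alpha> + 1)) / ln (real (z r)) \<le> N1 * 2 ^ (R - r)" .
qed

text \<open>For the error terms only: one power of the top level absorbs the loss from
  \<open>f\<close>, since \<open>w\<close> was taken with
  \<open>N1 * ln A \<le> ln w\<close>.\<close>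

lemma growth_factor_le: "A powr (N1 * 2 ^ (R - r)) \<le> real (z R)"
proof -
  have z0: "0 < real (z R)" using w(1) by (simp add: z_def)
  have "N1 * ln A * 2 ^ (R - r) \<le> N1 * ln A * 2 ^ R"
    using N1_N A by (intro mult_left_mono power_increasing) auto
  also have "\<dots> \<le> ln (real w) * 2 ^ R" using w(5) by (intro mult_right_mono) auto
  also have "\<dots> = ln (real (z R))" by (simp add: ln_z)
  finally have "exp (N1 * ln A * 2 ^ (R - r)) \<le> real (z R)"
    using z0 by (metis exp_le_cancel_iff exp_ln)
  thus ?thesis using A by (simp add: powr_def mult_ac)
qed

lemma Z_facts: "1 \<le> Z" "Z \<le> M" "0 < Z"
proof -
  show Z1: "1 \<le> Z" unfolding Z_def using M_ge \<theta>1 by (intro ge_one_powr_ge_zero) auto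
  have "Z \<le> M powr 1" unfolding Z_def using M_ge \<theta>1 by (intro powr_mono) auto
  thus "Z \<le> M" using M_ge by simp
  show "0 < Z" using Z1 by simp
qed

lemma z_power_le: "r \<le> R \<Longrightarrow> real (z r) ^ n \<le> M powr (real n * \<eta>)"
proof -
  assume "r \<le> R"
  hence "real (z r) ^ n \<le> (M powr \<eta>) ^ n" using z_bounds(3) by (intro power_mono) auto
  also have "\<dots> = M powr (real n * \<eta>)" using M2 by (simp add: powr_power mult.commute)
  finally show ?thesis .
qed

lemma level_le: "r \<le> R \<Longrightarrow> Z * real (z r) ^ 8 \<le> M powr \<theta>"
proof -
  assume "r \<le> R"
  hence "Z * real (z r) ^ 8 \<le> Z * M powr (real 8 * \<eta>)"
    using Z_facts z_power_le[of r 8] by (intro mult_left_mono) auto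
  also have "\<dots> = M powr (\<theta>1 + 8 * \<eta>)" by (simp add: Z_def powr_add)
  also have "\<dots> \<le> M powr \<theta>" using M_ge \<theta>1 \<eta> by (intro powr_mono) auto
  finally show ?thesis .
qed

text \<open>The loss \<open>2 ^ (R - r)\<close> is the ratio of \<open>ln (z R)\<close> and
  \<open>ln (z r)\<close>; stopping the sieve at level \<open>r\<close> costs its \<kappa>-th
  power.\<close>

lemma V_le:
  assumes "r \<le> R"
  shows "(\<Prod>p\<in>sieve_range w 1 r. 1 - h p) \<le> full_product * H * (2 ^ (R - r)) powr \<kappa>"
proof -
  have "(\<Prod>p\<in>sieve_range w 1 r. 1 - h p) * small_product B w
      \<le> full_product * ((2 * ln M / ln (real (w ^ 2 ^ r))) powr \<kappa> * (1 + K / ln (real w)))"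
    using z_bounds(4)[OF assms] by (intro sieve_range_product_le w M2) (simp add: z_def)
  also have "\<dots> \<le> full_product * (((4 / \<eta>) * 2 ^ (R - r)) powr \<kappa> * (1 + K / ln (real w)))"
  proof (intro mult_left_mono mult_right_mono powr_mono2 full_product_nonneg)
    show "2 * ln M / ln (real (w ^ 2 ^ r)) \<le> 4 / \<eta> * 2 ^ (R - r)"
      using ln_M_ratio[OF assms] unfolding z_def by simp
    show "0 \<le> 2 * ln M / ln (real (w ^ 2 ^ r))" using M2 ln_z_pos[of r] by (simp add: z_def)
  qed (use pos w(3) in auto)
  also have "\<dots> = full_product * H * (2 ^ (R - r)) powr \<kappa> * small_product B w"
  proof -
    have split: "((4 / \<eta>) * 2 ^ (R - r)) powr \<kappa> = (4 / \<eta>) powr \<kappa> * (2 ^ (R - r)) powr \<kappa>"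
      by (rule powr_mult)
    have Hs: "H * small_product B w = (4 / \<eta>) powr \<kappa> * (1 + K / ln (real w))"
      using small_product_pos[of B w] pos by (simp add: H_def)
    have "full_product * H * (2 ^ (R - r)) powr \<kappa> * small_product B w
        = full_product * (2 ^ (R - r)) powr \<kappa> * (H * small_product B w)" by (simp only: mult_ac)
    thus ?thesis unfolding split Hs by (simp only: mult_ac)
  qed
  finally show ?thesis
    by (rule mult_right_le_imp_le) (rule small_product_pos[OF pos(6)])
qed

text \<open>The term at 1. As \<open>f n\<close> is bounded by \<open>f 1\<close> times a small
  power of \<open>n\<close>, this lets power-saving errors be absorbed into the main term.\<close>

lemma S_ge: "f 1 \<le> S" and S_nonneg: "0 \<le> S"
proof -
  have fin: "finite {a. 0 < a \<and> real a \<le> M}"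
    by (rule finite_subset[of _ "{..nat \<lfloor>M\<rfloor>}"]) (auto simp: le_nat_floor)
  have "(\<Sum>a\<in>{1}. f a * h a) \<le> S"
    unfolding S_def using fin M_ge f_nonneg h_nonneg by (intro sum_mono2) auto
  thus "f 1 \<le> S" using density_classD(1)[OF h_density] by simp
  thus "0 \<le> S" using f_nonneg[of 1] by simp
qed

lemma smooth_sum_le_S: "(\<Sum>d\<in>smooth_upto y Z. f d * h d) \<le> S"
  unfolding S_def
proof (rule sum_mono2)
  show "finite {a. 0 < a \<and> real a \<le> M}"
    by (rule finite_subset[of _ "{..nat \<lfloor>M\<rfloor>}"]) (auto simp: le_nat_floor)
  show "smooth_upto y Z \<subseteq> {a. 0 < a \<and> real a \<le> M}" using Z_facts by (auto simp: smooth_upto_def)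
qed (use f_nonneg h_nonneg in auto)

lemma weighted_smooth_sum_le:
  assumes "0 \<le> \<delta>" "\<delta> \<le> l1 / 4" "\<delta> * ln (real y) \<le> N" "1 \<le> y"
  shows "(\<Sum>d\<in>smooth_upto y Z. f d * h d * global_weight B \<delta> d) \<le> E0 * S"
proof -
  have "(\<Sum>d\<in>smooth_upto y Z. f d * h d * global_weight B \<delta> d)
      \<le> E0 * (\<Sum>d\<in>smooth_upto y Z. f d * h d)"
    unfolding E0_def using assms N1_N pos cl A C0 local_bound
    by (intro weighted_sum_bound[OF h_density f_C0]) auto
  also have "\<dots> \<le> E0 * S" using smooth_sum_le_S by (intro mult_left_mono) (auto simp: E0_def)
  finally show ?thesis .
qed

lemma f_sum_le:
  assumes "D \<subseteq> {d. 0 < d \<and> real d \<le> Z}"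
  shows "(\<Sum>d\<in>D. f d) \<le> f 1 * C1 * Z\<^sup>2"
proof -
  have fle: "f d \<le> f 1 * C1 * Z" if "d \<in> D" for d
  proof -
    have d: "0 < d" "real d \<le> Z" using that assms by auto
    have "f d \<le> f 1 * (C1 * real d powr (\<tau> / (\<alpha> + 1)))" by (rule growth_classD(4)[OF f_C1 d(1)])
    also have "real d powr (\<tau> / (\<alpha> + 1)) \<le> real d powr 1"
      using d \<tau> \<alpha> by (intro powr_mono) (auto simp: divide_le_eq)
    hence "f 1 * (C1 * real d powr (\<tau> / (\<alpha> + 1))) \<le> f 1 * (C1 * Z)"
      using d f_nonneg[of 1] C1 by (intro mult_left_mono) auto
    finally show ?thesis by simp
  qed
  have card: "real (card D) \<le> Z"
  proof -
    have "D \<subseteq> {1..nat \<lfloor>Z\<rfloor>}" using assms by (auto simp: le_nat_floor Suc_le_eq)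
    hence "card D \<le> card {1..nat \<lfloor>Z\<rfloor>}" by (intro card_mono) auto
    thus ?thesis using Z_facts by simp linarith
  qed
  have "(\<Sum>d\<in>D. f d) \<le> real (card D) * (f 1 * C1 * Z)" using fle by (intro sum_bounded_above) auto
  also have "\<dots> \<le> Z * (f 1 * C1 * Z)"
    using card f_nonneg[of 1] C1 Z_facts by (intro mult_right_mono) auto
  finally show ?thesis by (simp add: power2_eq_square mult_ac)
qed

text \<open>Eight powers of the level come from the sieve, one from \<open>growth_factor_le\<close>,
  one from the number of levels; \<open>Z^2\<close> comes from \<open>f_sum_le\<close>. All
  exponents fit because \<open>10 * \<eta> + 2 * \<theta>1 + \<tau> \<le> \<xi>\<close>.\<close>

lemma M_powr_error: "real (z R) ^ 10 * M powr (1 - \<xi>) * Z\<^sup>2 \<le> M powr (1 - \<tau>)"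
proof -
  have "real (z R) ^ 10 * M powr (1 - \<xi>) * Z\<^sup>2 \<le> M powr (real 10 * \<eta>) * M powr (1 - \<xi>) * Z\<^sup>2"
    using z_power_le[of R 10] by (intro mult_right_mono) auto
  also have "\<dots> = M powr (10 * \<eta> + (1 - \<xi>) + 2 * \<theta>1)"
  proof -
    have "Z\<^sup>2 = M powr (2 * \<theta>1)"
      unfolding Z_def using M2 by (simp add: powr_power mult.commute)
    thus ?thesis by (simp add: powr_add)
  qed
  also have "\<dots> \<le> M powr (1 - \<tau>)" using M_ge \<eta> \<theta>1 \<tau> by (intro powr_mono) auto
  finally show ?thesis .
qed

section \<open>The four cases of the decomposition\<close>

definition Y :: real where "Y = Z powr (1 / (2 * real w))"
text \<open>Smoothness up to \<open>Suc (nat \<lfloor>Z\<rfloor>)\<close> holds for every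
  \<open>d \<le> Z\<close>; in this form the smooth sums apply with
  \<open>\<delta> = 0\<close>.\<close>

definition DI :: "nat set" where "DI = smooth_upto (Suc (nat \<lfloor>Z\<rfloor>)) Z"
definition DR :: "nat \<Rightarrow> nat set" where "DR r = {d \<in> smooth_upto (z (Suc r)) Z. sqrt Z < real d}"

lemma Sp_cover: "Sp \<subseteq> sieved_part DI (z R) \<union> prime_power_part (z R) (sqrt Z) \<union> prime_power_part w Y
  \<union> (\<Union>r<R. sieved_part (DR r) (z r))"
proof
  fix a assume a: "a \<in> Sp"
  have ca: "0 < c a" by (rule c_pos[OF a])
  have dpos: "0 < d" if "c a = d * b" for d b using that ca by (cases d) auto
  from shiu_decomposition[OF ca Z_facts(1) w(1), of R]
  show "a \<in> sieved_part DI (z R) \<union> prime_power_part (z R) (sqrt Z) \<union> prime_power_part w Y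
      \<union> (\<Union>r<R. sieved_part (DR r) (z r))"
  proof (elim disjE)
    assume "\<exists>d b. c a = d * b \<and> coprime d b \<and> real d \<le> Z \<and> (\<forall>p. prime p \<longrightarrow> p dvd b \<longrightarrow> w ^ 2 ^ R \<le> p)"
    then obtain d b where d: "c a = d * b" "coprime d b" "real d \<le> Z"
      "\<forall>p. prime p \<longrightarrow> p dvd b \<longrightarrow> w ^ 2 ^ R \<le> p" by blast
    have "d \<in> DI" unfolding DI_def smooth_upto_def
      using d(3) dpos[OF d(1)] by (auto simp: less_Suc_eq_le le_nat_floor dest!: dvd_imp_le)
    thus ?thesis using a d unfolding sieved_part_def z_def by blast
  next
    assume "\<exists>q e. prime q \<and> q < w ^ 2 ^ R \<and> q ^ e dvd c a \<and> sqrt Z < real (q ^ e)"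
    thus ?thesis using a unfolding prime_power_part_def z_def by blast
  next
    assume "\<exists>q e. prime q \<and> q < w \<and> q ^ e dvd c a \<and> Z powr (1 / (2 * real w)) < real (q ^ e)"
    thus ?thesis using a unfolding prime_power_part_def Y_def by blast
  next
    assume "\<exists>r<R. \<exists>d b. c a = d * b \<and> coprime d b \<and> sqrt Z < real d \<and> real d \<le> Z \<and>
      (\<forall>p. prime p \<longrightarrow> p dvd d \<longrightarrow> p < w ^ 2 ^ Suc r) \<and> (\<forall>p. prime p \<longrightarrow> p dvd b \<longrightarrow> w ^ 2 ^ r \<le> p)"
    then obtain r d b where r: "r < R" and d: "c a = d * b" "coprime d b" "sqrt Z < real d" "real d \<le> Z"
      "\<forall>p. prime p \<longrightarrow> p dvd d \<longrightarrow> p < w ^ 2 ^ Suc r" "\<forall>p. prime p \<longrightarrow> p dvd b \<longrightarrow> w ^ 2 ^ r \<le> p" by blast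
    have "d \<in> DR r" unfolding DR_def smooth_upto_def z_def using d dpos[OF d(1)] by blast
    hence "a \<in> sieved_part (DR r) (z r)" using a d unfolding sieved_part_def z_def by blast
    thus ?thesis using r by blast
  qed
qed

lemma sc_nonneg: "0 \<le> sc" unfolding sc_def sieve_const_def using pos by simp

lemma H_nonneg: "0 \<le> H"
  unfolding H_def using small_product_pos[of B w] pos w(3) by simp

lemma sieved_part_le:
  assumes r: "r \<le> R" and D: "D \<subseteq> {d. 0 < d \<and> real d \<le> Z}"
    and W: "(\<Sum>d\<in>D. f d * h d * global_weight B 0 d) \<le> X" "0 \<le> X"
  shows "(\<Sum>a\<in>sieved_part D (z r). \<chi> a * f (c a))
    \<le> sc * H * (M * full_product * X) * (A powr (N1 * 2 ^ (R - r)) * (2 ^ (R - r)) powr \<kappa>)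
      + k2 * (f 1 * C1) * (real (z R) ^ 9 * M powr (1 - \<xi>) * Z\<^sup>2)"
proof -
  have X1: "1 \<le> M powr (\<alpha> + 1)" using M_ge \<alpha> by (intro ge_one_powr_ge_zero) auto
  have finD: "finite D"
    by (rule finite_subset[OF D], rule finite_subset[of _ "{..nat \<lfloor>Z\<rfloor>}"]) (auto simp: le_nat_floor)
  let ?W = "A powr (ln (M powr (\<alpha> + 1)) / ln (real (z r)))"
  have V0: "0 \<le> (\<Prod>p\<in>sieve_range w 1 r. 1 - h p)"
    using sieve_range_prime_bounds(4)[OF w(2)] by (intro prod_nonneg) force
  have sumf: "0 \<le> (\<Sum>d\<in>D. f d)" using D f_nonneg by (intro sum_nonneg) auto
  have sumW: "0 \<le> (\<Sum>d\<in>D. f d * h d * global_weight B 0 d)"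
    using D f_nonneg h_nonneg pos unfolding global_weight_def
    by (intro sum_nonneg mult_nonneg_nonneg prod_nonneg) auto
  have "(\<Sum>a\<in>sieved_part D (z r). \<chi> a * f (c a))
      \<le> ?W * (sc * M * (\<Prod>p\<in>sieve_range w 1 r. 1 - h p) * (\<Sum>d\<in>D. f d * h d * global_weight B 0 d)
       + k2 * real (z r) ^ 8 * M powr (1 - \<xi>) * (\<Sum>d\<in>D. f d))"
    unfolding z_def sc_def
    using level_le[OF r] z_bounds(4)[OF r] D c_le X1
    by (intro sieved_part_bound[OF w(1,2) f_C0 A finD]) (auto simp: z_def)
  also have "\<dots> \<le> A powr (N1 * 2 ^ (R - r)) * (sc * M * (full_product * H * (2 ^ (R - r)) powr \<kappa>) * X
       + k2 * real (z R) ^ 8 * M powr (1 - \<xi>) * (f 1 * C1 * Z\<^sup>2))"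
    using growth_exponent_le[OF r] V_le[OF r] W(1) f_sum_le[OF D] z_bounds(2)[OF r] V0 sumf sumW
      sc_nonneg M_ge pos H_nonneg full_product_nonneg
    by (intro mult_mono add_mono mult_nonneg_nonneg add_nonneg_nonneg power_mono) auto
  also have "\<dots> = sc * H * (M * full_product * X) * (A powr (N1 * 2 ^ (R - r)) * (2 ^ (R - r)) powr \<kappa>)
      + A powr (N1 * 2 ^ (R - r)) * (k2 * real (z R) ^ 8 * M powr (1 - \<xi>) * (f 1 * C1 * Z\<^sup>2))"
    by (simp add: algebra_simps)
  also have "A powr (N1 * 2 ^ (R - r)) * (k2 * real (z R) ^ 8 * M powr (1 - \<xi>) * (f 1 * C1 * Z\<^sup>2))
      \<le> real (z R) * (k2 * real (z R) ^ 8 * M powr (1 - \<xi>) * (f 1 * C1 * Z\<^sup>2))"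
    using growth_factor_le pos f_nonneg[of 1] C1 by (intro mult_right_mono) auto
  also have "\<dots> = k2 * (f 1 * C1) * (real (z R) ^ 9 * M powr (1 - \<xi>) * Z\<^sup>2)"
    by (simp add: eval_nat_numeral mult_ac)
  finally show ?thesis by simp
qed

lemma error9_le: "real (z R) ^ 9 * M powr (1 - \<xi>) * Z\<^sup>2 * real (z R) \<le> M powr (1 - \<tau>)"
  using M_powr_error by (simp add: eval_nat_numeral mult_ac)

text \<open>At the top level \<open>2 ^ (R - r) = 1\<close>, so all losses are constants and the
  untwisted sum over \<open>d\<close> suffices.\<close>

lemma case_I: "(\<Sum>a\<in>sieved_part DI (z R). \<chi> a * f (c a))
    \<le> A powr N1 * (sc * H * E0) * (M * full_product * S) + k2 * (f 1 * C1) * M powr (1 - \<tau>)"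
proof -
  have "(\<Sum>d\<in>DI. f d * h d * global_weight B 0 d) \<le> E0 * S"
    unfolding DI_def using pos N1_N by (intro weighted_smooth_sum_le) auto
  hence "(\<Sum>a\<in>sieved_part DI (z R). \<chi> a * f (c a))
      \<le> sc * H * (M * full_product * (E0 * S)) * (A powr (N1 * 2 ^ (R - R)) * (2 ^ (R - R)) powr \<kappa>)
      + k2 * (f 1 * C1) * (real (z R) ^ 9 * M powr (1 - \<xi>) * Z\<^sup>2)"
    using S_nonneg by (intro sieved_part_le) (auto simp: DI_def smooth_upto_def E0_def)
  also have "k2 * (f 1 * C1) * (real (z R) ^ 9 * M powr (1 - \<xi>) * Z\<^sup>2) \<le> k2 * (f 1 * C1) * M powr (1 - \<tau>)"
  proof (intro mult_left_mono)
    have "1 \<le> real (z R)" using w(1) by (simp add: z_def one_le_power)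
    hence "real (z R) ^ 9 * M powr (1 - \<xi>) * Z\<^sup>2 * 1 \<le> real (z R) ^ 9 * M powr (1 - \<xi>) * Z\<^sup>2 * real (z R)"
      by (intro mult_left_mono) auto
    thus "real (z R) ^ 9 * M powr (1 - \<xi>) * Z\<^sup>2 \<le> M powr (1 - \<tau>)" using error9_le by linarith
  qed (use pos f_nonneg[of 1] C1 in auto)
  finally show ?thesis by (simp add: mult_ac)
qed

text \<open>\<open>\<delta> = N / ln (z (Suc r))\<close> is the largest exponent for which the twist
  costs only a constant. From \<open>d > sqrt Z\<close> and \<open>z R \<le> Z\<close> one gets
  \<open>d powr \<delta> \<ge> exp (N * 2 ^ (R - r) / 4)\<close>.\<close>

lemma rankin_sum_le:
  assumes r: "r < R"
  shows "(\<Sum>d\<in>DR r. f d * h d * global_weight B 0 d) \<le> exp (- N * 2 ^ (R - r) / 4) * (E0 * S)"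
proof -
  define \<delta> where "\<delta> = N / ln (real (z (Suc r)))"
  have lz: "0 < ln (real (z (Suc r)))" by (rule ln_z_pos)
  have \<delta>0: "0 \<le> \<delta>" unfolding \<delta>_def using lz N1_N by simp
  have "ln (real w) \<le> ln (real (z (Suc r)))" using z_bounds(1)[of "Suc r"] r w(1) by simp
  hence "4 * N \<le> l1 * ln (real (z (Suc r)))" using w(4) pos by (smt (verit) mult_left_mono)
  hence \<delta>l: "\<delta> \<le> l1 / 4" unfolding \<delta>_def using lz by (simp add: field_simps)
  have "\<eta> * ln M \<le> \<theta>1 * ln M" using \<eta> \<theta>1 M2 by (intro mult_right_mono) auto
  moreover have "ln (real (z R)) \<le> ln (M powr \<eta>)"
    using z_bounds(3)[of R] w(1) M2 by (subst ln_le_cancel_iff) (auto simp: z_def)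
  moreover have "ln (M powr \<eta>) = \<eta> * ln M" "ln Z = \<theta>1 * ln M"
    using M2 by (simp_all add: Z_def ln_powr)
  ultimately have lnZ: "ln (real (z R)) \<le> ln Z" by linarith
  \<comment> \<open>One level is lost because \<open>DR r\<close> is smooth with respect to
    \<open>z (Suc r)\<close>.\<close>
  have "2 ^ (R - r) = 2 * (2::real) ^ (R - Suc r)" using r by (simp add: Suc_diff_Suc flip: power_Suc)
  hence "ln (real (z R)) * 2 = 2 ^ (R - r) * ln (real (z (Suc r)))" using ln_z_top[of "Suc r"] r by simp
  hence "2 ^ (R - r) * ln (real (z (Suc r))) \<le> 2 * ln Z" using lnZ by linarith
  hence "2 ^ (R - r) * ln (real (z (Suc r))) * \<delta> \<le> 2 * ln Z * \<delta>" using \<delta>0 by (intro mult_right_mono)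
  hence expo: "N * 2 ^ (R - r) \<le> 2 * ln Z * \<delta>" unfolding \<delta>_def using lz by (simp add: mult_ac)
  have "(\<Sum>d\<in>DR r. f d * h d * global_weight B 0 d)
      \<le> (\<Sum>d\<in>DR r. exp (- N * 2 ^ (R - r) / 4) * (f d * h d * global_weight B \<delta> d))"
  proof (intro sum_mono)
    fix d assume "d \<in> DR r"
    hence d: "0 < d" "sqrt Z < real d" by (auto simp: DR_def smooth_upto_def)
    have "ln (sqrt Z) \<le> ln (real d)" using d Z_facts by (subst ln_le_cancel_iff) auto
    hence "ln Z / 2 \<le> ln (real d)" using Z_facts by (simp add: ln_sqrt)
    hence "\<delta> * (ln Z / 2) \<le> \<delta> * ln (real d)" using \<delta>0 by (intro mult_left_mono)
    hence "N * 2 ^ (R - r) / 4 \<le> \<delta> * ln (real d)" using expo by (simp add: mult_ac)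
    hence "exp (N * 2 ^ (R - r) / 4) \<le> real d powr \<delta>" using d by (simp add: powr_def)
    hence "exp (- (N * 2 ^ (R - r) / 4)) * exp (N * 2 ^ (R - r) / 4) \<le> exp (- (N * 2 ^ (R - r) / 4)) * real d powr \<delta>"
      by (intro mult_left_mono) auto
    hence one: "1 \<le> exp (- N * 2 ^ (R - r) / 4) * real d powr \<delta>" by (simp flip: exp_add)
    have "0 \<le> f d * h d * (\<Prod>p\<in>prime_factors d. 1 + 2 * B / real p)"
      using d f_nonneg h_nonneg pos by (intro mult_nonneg_nonneg prod_nonneg) auto
    from mult_left_mono[OF one this]
    show "f d * h d * global_weight B 0 d \<le> exp (- N * 2 ^ (R - r) / 4) * (f d * h d * global_weight B \<delta> d)"
      using d by (simp add: global_weight_def mult_ac)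
  qed
  also have "\<dots> = exp (- N * 2 ^ (R - r) / 4) * (\<Sum>d\<in>DR r. f d * h d * global_weight B \<delta> d)"
    by (simp add: sum_distrib_left)
  also have "\<dots> \<le> exp (- N * 2 ^ (R - r) / 4) * (E0 * S)"
  proof (intro mult_left_mono)
    have "(\<Sum>d\<in>DR r. f d * h d * global_weight B \<delta> d) \<le> (\<Sum>d\<in>smooth_upto (z (Suc r)) Z. f d * h d * global_weight B \<delta> d)"
    proof (rule sum_mono2)
      show "DR r \<subseteq> smooth_upto (z (Suc r)) Z" by (auto simp: DR_def)
      fix d assume "d \<in> smooth_upto (z (Suc r)) Z - DR r"
      hence "0 < d" by (simp add: smooth_upto_def)
      thus "0 \<le> f d * h d * global_weight B \<delta> d"
        using f_nonneg h_nonneg pos unfolding global_weight_def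
        by (intro mult_nonneg_nonneg prod_nonneg) auto
    qed simp
    also have "\<dots> \<le> E0 * S"
      using \<delta>0 \<delta>l lz w(1) N1_N by (intro weighted_smooth_sum_le) (auto simp: \<delta>_def z_def)
    finally show "(\<Sum>d\<in>DR r. f d * h d * global_weight B \<delta> d) \<le> E0 * S" .
  qed simp
  finally show ?thesis .
qed

text \<open>Rankin's saving leaves \<open>1 / 2 ^ (R - r)\<close> at level \<open>r\<close>, which
  sums to at most 1. The error terms do not decay in \<open>r\<close>, but their number
  \<open>R\<close> is less than \<open>z R\<close>.\<close>

lemma case_IV: "(\<Sum>r<R. \<Sum>a\<in>sieved_part (DR r) (z r). \<chi> a * f (c a))
    \<le> sc * H * E0 * (M * full_product * S) + k2 * (f 1 * C1) * M powr (1 - \<tau>)"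
proof -
  let ?G = "sc * H * E0 * (M * full_product * S)"
  let ?e = "real (z R) ^ 9 * M powr (1 - \<xi>) * Z\<^sup>2"
  have G0: "0 \<le> ?G" using sc_nonneg H_nonneg M_ge full_product_nonneg S_nonneg by (auto simp: E0_def)
  have "(\<Sum>r<R. \<Sum>a\<in>sieved_part (DR r) (z r). \<chi> a * f (c a))
      \<le> (\<Sum>r<R. ?G * (1 / 2 ^ (R - r)) + k2 * (f 1 * C1) * ?e)"
  proof (intro sum_mono)
    fix r assume "r \<in> {..<R}"
    hence r: "r < R" by simp
    let ?t = "(2::real) ^ (R - r)"
    have "(\<Sum>a\<in>sieved_part (DR r) (z r). \<chi> a * f (c a))
        \<le> sc * H * (M * full_product * (exp (- N * ?t / 4) * (E0 * S))) * (A powr (N1 * ?t) * ?t powr \<kappa>)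
          + k2 * (f 1 * C1) * ?e"
      using r S_nonneg rankin_sum_le[OF r]
      by (intro sieved_part_le) (auto simp: DR_def smooth_upto_def E0_def)
    also have "sc * H * (M * full_product * (exp (- N * ?t / 4) * (E0 * S))) * (A powr (N1 * ?t) * ?t powr \<kappa>)
        = ?G * (A powr (N1 * ?t) * ?t powr \<kappa> * exp (- N * ?t / 4))"
      by (simp add: mult_ac)
    also have "\<dots> \<le> ?G * (1 / ?t)"
      using A pos by (intro mult_left_mono[OF _ G0] exp_decay_le[OF _ _ _ N]) auto
    finally show "(\<Sum>a\<in>sieved_part (DR r) (z r). \<chi> a * f (c a)) \<le> ?G * (1 / ?t) + k2 * (f 1 * C1) * ?e" by simp
  qed
  also have "\<dots> = ?G * (\<Sum>r<R. 1 / 2 ^ (R - r)) + k2 * (f 1 * C1) * (?e * real R)"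
    by (simp add: sum.distrib sum_distrib_left mult_ac)
  also have "\<dots> \<le> ?G * 1 + k2 * (f 1 * C1) * M powr (1 - \<tau>)"
  proof (intro add_mono mult_left_mono sum_half_powers_le G0)
    have "R < 2 ^ R" by (rule less_exp)
    also have "2 ^ R < z R"
    proof -
      have "(2::nat) ^ R < 2 ^ 2 ^ R" by (rule less_exp)
      also have "\<dots> \<le> w ^ 2 ^ R" using w(1) by (intro power_mono) auto
      finally show ?thesis by (simp add: z_def)
    qed
    finally have "?e * real R \<le> ?e * real (z R)" by (intro mult_left_mono) auto
    thus "?e * real R \<le> M powr (1 - \<tau>)" using error9_le by linarith
  qed (use pos f_nonneg[of 1] C1 in auto)
  finally show ?thesis by simp
qed

text \<open>The exponent \<open>\<tau> / (\<alpha> + 1)\<close> in \<open>f_C1\<close> is tuned to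
  \<open>c a \<le> M powr (\<alpha> + 1)\<close>.\<close>

lemma f_c_le: "a \<in> Sp \<Longrightarrow> f (c a) \<le> f 1 * C1 * M powr \<tau>"
proof -
  assume a: "a \<in> Sp"
  have "f (c a) \<le> f 1 * (C1 * real (c a) powr (\<tau> / (\<alpha> + 1)))"
    by (rule growth_classD(4)[OF f_C1 c_pos[OF a]])
  also have "\<dots> \<le> f 1 * (C1 * (M powr (\<alpha> + 1)) powr (\<tau> / (\<alpha> + 1)))"
    using c_le[OF a] f_nonneg[of 1] C1 \<tau> \<alpha> by (intro mult_left_mono powr_mono2) auto
  also have "(M powr (\<alpha> + 1)) powr (\<tau> / (\<alpha> + 1)) = M powr \<tau>"
    using \<alpha> by (simp add: powr_powr)
  finally show ?thesis by simp
qed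

text \<open>\<open>f\<close> costs \<open>M powr \<tau>\<close>, so sparse sets must save
  \<open>M powr (2 * \<tau>)\<close> for one \<tau> to remain.\<close>

lemma prime_power_part_le:
  assumes "(\<Sum>a\<in>prime_power_part y Y'. \<chi> a) \<le> G * M powr (1 - 2 * \<tau>)"
  shows "(\<Sum>a\<in>prime_power_part y Y'. \<chi> a * f (c a)) \<le> f 1 * C1 * G * M powr (1 - \<tau>)"
proof -
  have "(\<Sum>a\<in>prime_power_part y Y'. \<chi> a * f (c a)) \<le> (\<Sum>a\<in>prime_power_part y Y'. \<chi> a * (f 1 * C1 * M powr \<tau>))"
    using f_c_le weight_nonneg by (intro sum_mono mult_left_mono) (auto simp: prime_power_part_def)
  also have "\<dots> = (f 1 * C1 * M powr \<tau>) * (\<Sum>a\<in>prime_power_part y Y'. \<chi> a)"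
    by (simp add: sum_distrib_right mult.commute)
  also have "\<dots> \<le> (f 1 * C1 * M powr \<tau>) * (G * M powr (1 - 2 * \<tau>))"
    using assms f_nonneg[of 1] C1 by (intro mult_left_mono) auto
  also have "\<dots> = f 1 * C1 * G * (M powr \<tau> * M powr (1 - 2 * \<tau>))" by (simp add: mult_ac)
  also have "M powr \<tau> * M powr (1 - 2 * \<tau>) = M powr (1 - \<tau>)" by (simp flip: powr_add)
  finally show ?thesis .
qed

text \<open>Here \<open>q\<close> ranges up to \<open>M powr \<eta>\<close>, at a cost of exponent
  \<open>\<eta> * (1 + l2)\<close>; the saving \<open>\<theta>1 * l1 / 2\<close> from
  \<open>sqrt Z\<close> exceeds it by the choice of \<eta>.\<close>

lemma case_II: "(\<Sum>a\<in>prime_power_part (z R) (sqrt Z). \<chi> a * f (c a))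
    \<le> f 1 * C1 * (1 + k1 + k2) * M powr (1 - \<tau>)"
proof (rule prime_power_part_le)
  have sq: "sqrt Z = M powr (\<theta>1 / 2)"
    using Z_facts M2 by (simp add: Z_def powr_half_sqrt[symmetric] powr_powr)
  have zM: "real (z R) \<le> M powr \<eta>" using z_bounds(3) by simp
  have z0: "0 < real (z R)" using w(1) by (simp add: z_def)
  have wl: "\<tau> * 2 \<le> \<tau> * real w" using w(1) \<tau> by (intro mult_left_mono) auto
  have "sqrt Z * real (z R) \<le> M powr (\<theta>1 / 2) * M powr \<eta>"
    unfolding sq using zM by (intro mult_left_mono) auto
  also have "\<dots> \<le> M powr \<theta>" unfolding powr_add[symmetric] using M_ge \<theta>1 \<eta> by (intro powr_mono) auto
  finally have "(\<Sum>a\<in>prime_power_part (z R) (sqrt Z). \<chi> a)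
      \<le> real (z R) * ((1 + k1) * M * real (z R) powr l2 * sqrt Z powr (- l1) + k2 * M powr (1 - \<xi>))"
    using Z_facts by (intro prime_power_part_bound) auto
  also have "\<dots> \<le> M powr \<eta> * ((1 + k1) * M * (M powr \<eta>) powr l2 * sqrt Z powr (- l1) + k2 * M powr (1 - \<xi>))"
    using zM z0 pos M_ge
    by (intro mult_mono add_mono powr_mono2 mult_nonneg_nonneg add_nonneg_nonneg order_refl) auto
  also have "\<dots> = (1 + k1) * (M powr \<eta> * M powr 1 * (M powr \<eta>) powr l2 * sqrt Z powr (- l1)) + k2 * (M powr \<eta> * M powr (1 - \<xi>))"
    using M_ge by (simp add: algebra_simps)
  also have "M powr \<eta> * M powr 1 * (M powr \<eta>) powr l2 * sqrt Z powr (- l1) = M powr (\<eta> + 1 + \<eta> * l2 + \<theta>1 / 2 * (- l1))"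
    unfolding sq powr_powr powr_add by simp
  also have "M powr \<eta> * M powr (1 - \<xi>) = M powr (\<eta> + (1 - \<xi>))" by (simp add: powr_add)
  also have "(1 + k1) * M powr (\<eta> + 1 + \<eta> * l2 + \<theta>1 / 2 * (- l1)) + k2 * M powr (\<eta> + (1 - \<xi>))
      \<le> (1 + k1) * M powr (1 - 2 * \<tau>) + k2 * M powr (1 - 2 * \<tau>)"
  proof (intro add_mono mult_left_mono powr_mono M_ge)
    show "\<eta> + 1 + \<eta> * l2 + \<theta>1 / 2 * - l1 \<le> 1 - 2 * \<tau>"
    proof -
      have "\<eta> + \<eta> * l2 \<le> \<theta>1 * l1 / 16" using \<eta>(3) by (simp add: algebra_simps)
      moreover have "2 * \<tau> \<le> \<theta>1 * l1 / 4" using wl \<tau>(3) by linarith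
      moreover have "0 < \<theta>1 * l1" using \<theta>1 pos by simp
      ultimately show ?thesis by (simp add: algebra_simps)
    qed
    show "\<eta> + (1 - \<xi>) \<le> 1 - 2 * \<tau>" using \<eta> \<theta>1 \<tau> by linarith
  qed (use pos in auto)
  finally show "(\<Sum>a\<in>prime_power_part (z R) (sqrt Z). \<chi> a) \<le> (1 + k1 + k2) * M powr (1 - 2 * \<tau>)"
    by (simp add: algebra_simps)
qed

text \<open>Powers of \<open>w\<close> are constants here, but \<open>Y\<close> is only
  \<open>M powr (\<theta>1 / (2 * w))\<close>. This small saving is what ties \<tau> to
  \<open>w\<close>.\<close>

lemma case_III: "(\<Sum>a\<in>prime_power_part w Y. \<chi> a * f (c a))
    \<le> f 1 * C1 * ((1 + k1) * real w powr (1 + l2) + k2 * real w) * M powr (1 - \<tau>)"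
proof (rule prime_power_part_le)
  have YM: "Y = M powr (\<theta>1 / (2 * real w))" by (simp add: Y_def Z_def powr_powr)
  have Y1: "1 \<le> Y" unfolding YM using M_ge \<theta>1 by (intro ge_one_powr_ge_zero) auto
  have "\<theta>1 / (2 * real w) \<le> \<theta>1 / 1" using \<theta>1 w(1) by (intro divide_left_mono) auto
  hence YZ: "Y \<le> M powr \<theta>1" unfolding YM using M_ge by (intro powr_mono) auto
  have wM: "real w \<le> M powr \<eta>" using z_bounds(1,3)[of R] by (meson of_nat_le_iff order_refl order_trans)
  have w0: "0 < real w" using w(1) by simp
  have "Y * real w \<le> M powr \<theta>1 * M powr \<eta>" using YZ wM by (intro mult_mono) auto
  also have "\<dots> \<le> M powr \<theta>" unfolding powr_add[symmetric] using M_ge \<theta>1 \<eta> by (intro powr_mono) auto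
  finally have "(\<Sum>a\<in>prime_power_part w Y. \<chi> a)
      \<le> real w * ((1 + k1) * M * real w powr l2 * Y powr (- l1) + k2 * M powr (1 - \<xi>))"
    using Y1 by (intro prime_power_part_bound) auto
  also have "\<dots> = (1 + k1) * real w powr (1 + l2) * (M powr 1 * Y powr (- l1)) + k2 * real w * M powr (1 - \<xi>)"
    using M_ge w0 by (simp add: powr_add algebra_simps)
  also have "M powr 1 * Y powr (- l1) = M powr (1 + \<theta>1 / (2 * real w) * (- l1))"
    unfolding YM powr_powr powr_add by simp
  also have "(1 + k1) * real w powr (1 + l2) * \<dots> + k2 * real w * M powr (1 - \<xi>)
      \<le> (1 + k1) * real w powr (1 + l2) * M powr (1 - 2 * \<tau>) + k2 * real w * M powr (1 - 2 * \<tau>)"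
  proof (intro add_mono mult_left_mono powr_mono M_ge)
    have "2 * \<tau> \<le> \<theta>1 / (2 * real w) * l1" using \<tau>(3) w0 by (simp add: field_simps)
    thus "1 + \<theta>1 / (2 * real w) * (- l1) \<le> 1 - 2 * \<tau>" by simp
  qed (use pos \<tau> in auto)
  finally show "(\<Sum>a\<in>prime_power_part w Y. \<chi> a)
      \<le> ((1 + k1) * real w powr (1 + l2) + k2 * real w) * M powr (1 - 2 * \<tau>)"
    by (simp add: algebra_simps)
qed

definition J :: real where
  "J = (2 * \<kappa> / \<tau>) powr \<kappa> * (1 + K / ln (real w)) / small_product B w"

text \<open>The full product is at least a constant times a negative power of \<open>ln M\<close>:
  take the empty sieve range \<open>r = 0\<close> in \<open>sieve_range_product_le\<close>. Hence
  \<open>M powr \<tau>\<close> outweighs it.\<close>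

lemma error_le: "M powr (1 - \<tau>) \<le> J * (M * full_product)"
proof -
  have s0: "0 < small_product B w" using pos by (intro small_product_pos)
  have "real (w ^ 2 ^ 0) \<le> M" using z_bounds(4)[of 0] by (simp add: z_def)
  moreover have empty: "sieve_range w 1 0 = {}" by (auto simp: sieve_range_def)
  ultimately have "1 * small_product B w
      \<le> full_product * ((2 * ln M / ln (real (w ^ 2 ^ 0))) powr \<kappa> * (1 + K / ln (real w)))"
    using sieve_range_product_le[OF w(1,2) M2, of 0] by (simp only: empty prod.empty)
  hence "small_product B w \<le> full_product * ((2 * ln M / ln (real w)) powr \<kappa> * (1 + K / ln (real w)))"
    by simp
  also have "\<dots> \<le> full_product * ((2 * \<kappa> / \<tau>) powr \<kappa> * M powr \<tau> * (1 + K / ln (real w)))"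
  proof (intro mult_left_mono mult_right_mono full_product_nonneg)
    have "2 * ln M / ln (real w) \<le> 2 * ln M / 1"
      using w(3) M2 by (intro divide_left_mono) auto
    \<comment> \<open>Raised to the power \<kappa>, this turns the logarithms into
      \<open>M powr \<tau>\<close> and produces the constant in \<open>J\<close>.\<close>
    also have "ln M \<le> M powr (\<tau> / \<kappa>) / (\<tau> / \<kappa>)"
      using M2 pos \<tau> by (intro ln_powr_bound) auto
    finally have "2 * ln M / ln (real w) \<le> (2 * \<kappa> / \<tau>) * M powr (\<tau> / \<kappa>)" by (simp add: mult_ac)
    hence "(2 * ln M / ln (real w)) powr \<kappa> \<le> ((2 * \<kappa> / \<tau>) * M powr (\<tau> / \<kappa>)) powr \<kappa>"
      using pos M2 w(3) by (intro powr_mono2) auto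
    also have "\<dots> = (2 * \<kappa> / \<tau>) powr \<kappa> * M powr \<tau>"
      using pos by (subst powr_mult) (simp add: powr_powr)
    finally show "(2 * ln M / ln (real w)) powr \<kappa> \<le> (2 * \<kappa> / \<tau>) powr \<kappa> * M powr \<tau>" .
  qed (use pos w(3) in auto)
  finally have "1 \<le> J * full_product * M powr \<tau>"
    unfolding J_def using s0 by (simp add: field_simps)
  hence "M powr (1 - \<tau>) * 1 \<le> M powr (1 - \<tau>) * (J * full_product * M powr \<tau>)"
    by (intro mult_left_mono) auto
  also have "\<dots> = J * full_product * (M powr (1 - \<tau>) * M powr \<tau>)" by (simp add: mult_ac)
  also have "M powr (1 - \<tau>) * M powr \<tau> = M" using M_ge by (simp flip: powr_add)
  finally show ?thesis by (simp add: mult_ac)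
qed

text \<open>The two main terms stem from cases I and IV; the coefficient 3 of \<open>k2\<close>
  collects one share each from cases I, II and IV.\<close>

lemma main_bound:
  "(\<Sum>a\<in>Sp. \<chi> a * f (c a)) \<le> ((A powr N1 + 1) * (sc * H * E0)
    + C1 * (1 + k1 + 3 * k2 + (1 + k1) * real w powr (1 + l2) + k2 * real w) * J) * (M * full_product * S)"
proof -
  let ?g = "\<lambda>a. \<chi> a * f (c a)"
  let ?I = "sieved_part DI (z R)" and ?II = "prime_power_part (z R) (sqrt Z)" and ?III = "prime_power_part w Y"
    and ?IV = "\<Union>r<R. sieved_part (DR r) (z r)"
  let ?C = "1 + k1 + 3 * k2 + (1 + k1) * real w powr (1 + l2) + k2 * real w"
  have g0: "0 \<le> ?g a" if "a \<in> Sp" for a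
    using weight_nonneg[OF that] f_nonneg[OF c_pos[OF that]] by simp
  have sub: "sieved_part D y \<subseteq> Sp" "prime_power_part q u \<subseteq> Sp" for D y q u
    by (auto simp: sieved_part_def prime_power_part_def)
  have Un: "sum ?g (U \<union> V) \<le> sum ?g U + sum ?g V" if "U \<subseteq> Sp" "V \<subseteq> Sp" for U V
  proof -
    have "finite U" "finite V" using that finite_Sp finite_subset by auto
    moreover have "0 \<le> sum ?g (U \<inter> V)" using that g0 by (intro sum_nonneg) auto
    ultimately show ?thesis by (simp add: sum_Un)
  qed
  have IV: "?IV \<subseteq> Sp" using sub by blast
  have "sum ?g Sp \<le> sum ?g (?I \<union> ?II \<union> ?III \<union> ?IV)"
  proof (intro sum_mono2)
    show "finite (?I \<union> ?II \<union> ?III \<union> ?IV)"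
      by (rule finite_subset[OF _ finite_Sp]) (use sub IV in blast)
    show "0 \<le> ?g a" if "a \<in> (?I \<union> ?II \<union> ?III \<union> ?IV) - Sp" for a using that sub IV by blast
  qed (rule Sp_cover)
  also have "\<dots> \<le> sum ?g (?I \<union> ?II \<union> ?III) + sum ?g ?IV" using sub IV by (intro Un) auto
  also have "sum ?g (?I \<union> ?II \<union> ?III) \<le> sum ?g (?I \<union> ?II) + sum ?g ?III" using sub by (intro Un) auto
  also have "sum ?g (?I \<union> ?II) \<le> sum ?g ?I + sum ?g ?II" using sub by (intro Un) auto
  also have "sum ?g ?IV \<le> (\<Sum>r<R. sum ?g (sieved_part (DR r) (z r)))"
  proof (rule sum_UN_le)
    show "finite (sieved_part (DR r) (z r))" for r by (rule finite_subset[OF sub(1) finite_Sp])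
    show "0 \<le> ?g a" if "a \<in> sieved_part (DR r) (z r)" for r a using that sub g0 by blast
  qed auto
  finally have "sum ?g Sp \<le> (A powr N1 + 1) * (sc * H * E0) * (M * full_product * S)
      + f 1 * C1 * ?C * M powr (1 - \<tau>)"
    using case_I case_II case_III case_IV by (simp add: algebra_simps)
  also have "f 1 * C1 * ?C * M powr (1 - \<tau>) \<le> S * C1 * ?C * (J * (M * full_product))"
  proof -
    have "0 \<le> ?C" using pos by (intro add_nonneg_nonneg mult_nonneg_nonneg) auto
    thus ?thesis using S_ge S_nonneg f_nonneg[of 1] C1 error_le
      by (intro mult_mono) auto
  qed
  finally show ?thesis by (simp add: algebra_simps)
qed

end

subsection \<open>The uniform bound\<close>

text \<open>Trivial estimates: the modulus 1 bounds the total weight by a multiple of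
  \<open>M\<close>, each \<open>f (c a)\<close> is at most a constant times \<open>f 1\<close>, and
  on the right \<open>full_product\<close> exceeds \<open>small_product B w\<close> and the sum
  exceeds \<open>f 1\<close>.\<close>

lemma (in weighted_sequence) bounded_parameter_bound:
  assumes f: "f \<in> growth_class A \<epsilon> C" and C: "0 \<le> C" and \<epsilon>: "0 \<le> \<epsilon>"
    and c_le: "\<And>a. a \<in> Sp \<Longrightarrow> real (c a) \<le> X" and w: "M < real w" and X: "0 \<le> X"
  shows "(\<Sum>a\<in>Sp. \<chi> a * f (c a)) \<le> C * X powr \<epsilon> * (1 + k1 + k2) / small_product B w
    * (M * full_product * (\<Sum>a | 0 < a \<and> real a \<le> M. f a * h a))"
proof -
  let ?S = "\<Sum>a | 0 < a \<and> real a \<le> M. f a * h a"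
  have f0: "0 \<le> f n" if "0 < n" for n using growth_classD(1)[OF f that] .
  have s0: "0 < small_product B w" using pos by (intro small_product_pos)
  have fin: "finite {a. 0 < a \<and> real a \<le> M}"
    by (rule finite_subset[of _ "{..nat \<lfloor>M\<rfloor>}"]) (auto simp: le_nat_floor)
  have "(\<Sum>a\<in>{1}. f a * h a) \<le> ?S"
    using fin M_ge f0 h_nonneg by (intro sum_mono2) auto
  hence S: "f 1 \<le> ?S" using density_classD(1)[OF h_density] by simp
  have full: "small_product B w \<le> full_product"
  proof -
    let ?P = "{p. prime p \<and> B < real p \<and> real p \<le> M}" and ?W = "{p. prime p \<and> B < real p \<and> p < w}"
    have "small_product B w = (\<Prod>p\<in>?W - ?P. 1 - B / real p) * (\<Prod>p\<in>?P. 1 - B / real p)"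
      unfolding small_product_def using w by (intro prod.subset_diff) auto
    also have "\<dots> \<le> 1 * (\<Prod>p\<in>?P. 1 - B / real p)"
      using pos by (intro mult_right_mono prod_le_1 prod_nonneg) (auto simp: prime_gt_0_nat)
    also have "(\<Prod>p\<in>?P. 1 - B / real p) \<le> full_product"
      unfolding full_product_def using h_prime_le pos
      by (intro prod_mono) (auto simp: prime_gt_0_nat)
    finally show ?thesis by simp
  qed
  have "M powr (1 - \<xi>) \<le> M powr 1" using M_ge pos by (intro powr_mono) auto
  hence "k2 * M powr (1 - \<xi>) \<le> k2 * M" using pos M_ge by (intro mult_left_mono) auto
  moreover have "(\<Sum>a | a \<in> Sp \<and> 1 dvd c a. \<chi> a) \<le> (1 + k1) * h 1 * M + k2 * M powr (1 - \<xi>)"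
    using M_ge pos by (intro congruence_sum_le) (auto intro: ge_one_powr_ge_zero)
  ultimately have total: "(\<Sum>a\<in>Sp. \<chi> a) \<le> (1 + k1 + k2) * M"
    using density_classD(1)[OF h_density] by (simp add: algebra_simps)
  have "(\<Sum>a\<in>Sp. \<chi> a * f (c a)) \<le> (\<Sum>a\<in>Sp. \<chi> a * (f 1 * (C * X powr \<epsilon>)))"
  proof (intro sum_mono mult_left_mono)
    fix a assume a: "a \<in> Sp"
    have "f (c a) \<le> f 1 * (C * real (c a) powr \<epsilon>)" by (rule growth_classD(4)[OF f c_pos[OF a]])
    also have "\<dots> \<le> f 1 * (C * X powr \<epsilon>)"
      using c_le[OF a] f0[of 1] C \<epsilon> by (intro mult_left_mono powr_mono2) auto
    finally show "f (c a) \<le> f 1 * (C * X powr \<epsilon>)" .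
  qed (rule weight_nonneg)
  also have "\<dots> = f 1 * (C * X powr \<epsilon>) * (\<Sum>a\<in>Sp. \<chi> a)" by (simp add: sum_distrib_right mult.commute)
  also have "\<dots> \<le> f 1 * (C * X powr \<epsilon>) * ((1 + k1 + k2) * M)"
    using total f0[of 1] C by (intro mult_left_mono) auto
  also have "\<dots> = (C * X powr \<epsilon> * (1 + k1 + k2) * M / small_product B w) * (small_product B w * f 1)"
    using s0 by simp
  also have "\<dots> \<le> (C * X powr \<epsilon> * (1 + k1 + k2) * M / small_product B w) * (full_product * ?S)"
    using full S s0 f0[of 1] C pos M_ge by (intro mult_left_mono mult_mono divide_nonneg_pos) auto
  finally show ?thesis by (simp add: mult_ac)
qed

text \<open>Each level is the square of the preceding one; take the last that does not exceed
  \<open>x\<close>.\<close>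

lemma level_bracket:
  fixes x :: real
  assumes "2 \<le> w" "real w \<le> x"
  obtains R where "real (w ^ 2 ^ R) \<le> x" "x < (real (w ^ 2 ^ R))\<^sup>2"
proof -
  obtain n where n: "x < 2 ^ n" using real_arch_pow[of 2 x] by auto
  have "(2::nat) ^ n \<le> 2 ^ 2 ^ n" using less_exp[of n] by (intro power_increasing) auto
  also have "\<dots> \<le> w ^ 2 ^ n" using assms(1) by (intro power_mono) auto
  finally have "real (2 ^ n) \<le> real (w ^ 2 ^ n)" by (simp only: of_nat_le_iff)
  hence ex: "x < real (w ^ 2 ^ n)" using n by simp
  define m where "m = (LEAST n. x < real (w ^ 2 ^ n))"
  have m: "x < real (w ^ 2 ^ m)" unfolding m_def using ex by (rule LeastI)
  have "m \<noteq> 0" using m assms(2) by (cases m) auto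
  then obtain R where R: "m = Suc R" by (cases m) auto
  have "\<not> x < real (w ^ 2 ^ R)"
    using not_less_Least[of R "\<lambda>n. x < real (w ^ 2 ^ n)"] R by (simp add: m_def)
  moreover have "real (w ^ 2 ^ m) = (real (w ^ 2 ^ R))\<^sup>2"
    by (simp add: R power_mult[symmetric] mult.commute)
  ultimately show ?thesis using m by (intro that[of R]) linarith+
qed

lemma weighted_sequence_bound:
  fixes \<theta> \<xi> \<kappa> l1 l2 B K k1 k2 A \<alpha> Bt :: real and f :: "nat \<Rightarrow> real"
  assumes A: "1 < A" and \<alpha>: "0 < \<alpha>" and Bt: "0 < Bt"
    and f: "\<forall>\<epsilon>>0. \<exists>C>0. f \<in> growth_class A \<epsilon> C"
    and pos: "0 < \<theta>" "0 < \<xi>" "0 < \<kappa>" "0 < l1" "0 < l2" "0 < B" "0 < K" "0 \<le> k1" "0 \<le> k2" "max \<theta> \<xi> < 1"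
  shows "\<exists>G>0. \<forall>(Sp :: 'a set) \<chi> c M h. weighted_sequence Sp \<chi> c M h \<theta> \<xi> \<kappa> l1 l2 B K k1 k2 \<longrightarrow>
    (\<forall>a\<in>Sp. real (c a) \<le> Bt * M powr \<alpha>) \<longrightarrow>
    (\<Sum>a\<in>Sp. \<chi> a * f (c a)) \<le> G * (M * (\<Prod>p | prime p \<and> B < real p \<and> real p \<le> M. 1 - h p)
      * (\<Sum>a | 0 < a \<and> real a \<le> M. f a * h a))"
proof -
  define \<theta>1 where "\<theta>1 = min \<theta> \<xi> / 8"
  \<comment> \<open>The first bound keeps the sieve moduli below \<open>M powr \<theta>\<close>, the
    second serves the large prime powers in case II.\<close>
  define \<eta> where "\<eta> = min (\<theta>1 / 16) (\<theta>1 * l1 / (16 * (1 + l2)))"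
  define N1 where "N1 = 2 * (\<alpha> + 1) / \<eta>"
  define N where "N = 4 * (N1 * ln A + \<kappa> + 1)"
  have \<theta>1: "0 < \<theta>1" "\<theta>1 \<le> 1" "8 * \<theta>1 \<le> \<theta>" "8 * \<theta>1 \<le> \<xi>" unfolding \<theta>1_def using pos by auto
  have \<eta>: "0 < \<eta>" "16 * \<eta> \<le> \<theta>1" unfolding \<eta>_def using \<theta>1 pos by auto
  have "\<eta> \<le> \<theta>1 * l1 / (16 * (1 + l2))" unfolding \<eta>_def by simp
  hence \<eta>3: "16 * (\<eta> * (1 + l2)) \<le> \<theta>1 * l1" using pos by (simp add: field_simps)
  have N1: "0 < N1" unfolding N1_def using \<alpha> \<eta> by simp
  have "0 < N1 * ln A" using N1 A by simp
  hence N: "0 < N" unfolding N_def using pos by (simp add: add_pos_pos)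
  obtain C0 where C0: "0 < C0" "f \<in> growth_class A (l1 / 4) C0" using f pos by (meson divide_pos_pos zero_less_numeral)
  obtain cl where cl: "0 < cl" "\<And>h \<kappa> K p \<delta> n. h \<in> density_class \<kappa> l1 l2 B K \<Longrightarrow> prime p \<Longrightarrow>
    0 \<le> \<delta> \<Longrightarrow> \<delta> \<le> l1 / 4 \<Longrightarrow> \<delta> * ln (real p) \<le> N \<Longrightarrow>
    (\<Sum>e=1..n. euler_bound A C0 (l1 / 4) h p e * (local_weight B \<delta> p e - 1))
      \<le> cl * (1 / (real p)\<^sup>2 + \<delta> * ln (real p) / real p)"
    using local_factor_bound[of l1 l2 B A C0 N] pos A C0 N by auto
  \<comment> \<open>\<open>exp (4 * N / l1)\<close> ensures \<open>\<delta> \<le> l1 / 4\<close> in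
    Rankin's trick, and \<open>exp (N1 * ln A)\<close> serves
    \<open>growth_factor_le\<close>.\<close>
  obtain w :: nat where "max (max 2 (2 * B)) (max (exp 1) (max (exp (4 * N / l1)) (exp (N1 * ln A)))) \<le> real w"
    using real_arch_simple by blast
  hence wb: "2 \<le> real w" "2 * B \<le> real w" "exp 1 \<le> real w" "exp (4 * N / l1) \<le> real w" "exp (N1 * ln A) \<le> real w"
    by auto
  have w: "2 \<le> w" "1 \<le> ln (real w)" "4 * N / l1 \<le> ln (real w)" "N1 * ln A \<le> ln (real w)"
    using wb by (auto simp: ln_ge_iff)
  have w4: "4 * N \<le> l1 * ln (real w)" using w(3) pos by (simp add: field_simps)
  define \<tau> where "\<tau> = min 1 (min (\<xi> / 4) (\<theta>1 * l1 / (4 * real w)))"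
  have \<tau>: "0 < \<tau>" "\<tau> \<le> 1" "4 * \<tau> \<le> \<xi>" unfolding \<tau>_def using pos \<theta>1 w(1) by auto
  have "\<tau> \<le> \<theta>1 * l1 / (4 * real w)" unfolding \<tau>_def by simp
  hence \<tau>3: "4 * \<tau> * real w \<le> \<theta>1 * l1" using w(1) by (simp add: field_simps)
  have "0 < \<tau> / (\<alpha> + 1)" using \<tau> \<alpha> by simp
  then obtain C1 where C1: "0 < C1" "f \<in> growth_class A (\<tau> / (\<alpha> + 1)) C1" using f by blast
  \<comment> \<open>From \<open>M0\<close> on, \<open>w \<le> M powr \<eta>\<close>, so a top level
    exists, and \<open>Bt \<le> M\<close>, so that
    \<open>Bt * M powr \<alpha> \<le> M powr (\<alpha> + 1)\<close>.\<close>
  define M0 where "M0 = max (real w powr (1 / \<eta>)) (max Bt 1)"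
  obtain v :: nat where v: "M0 < real v" using reals_Archimedean2 by blast
  define H where "H = (4 / \<eta>) powr \<kappa> * (1 + K / ln (real w)) / small_product B w"
  define J where "J = (2 * \<kappa> / \<tau>) powr \<kappa> * (1 + K / ln (real w)) / small_product B w"
  define G1 where "G1 = (A powr N1 + 1) * (sieve_const \<kappa> B K k1 w * H * exp (cl * (2 + 2 * N)))
    + C1 * (1 + k1 + 3 * k2 + (1 + k1) * real w powr (1 + l2) + k2 * real w) * J"
  define G2 where "G2 = C1 * (Bt * M0 powr \<alpha>) powr (\<tau> / (\<alpha> + 1)) * (1 + k1 + k2) / small_product B v"
  have "(\<Sum>a\<in>Sp. \<chi> a * f (c a)) \<le> max 1 (max G1 G2)
      * (M * (\<Prod>p | prime p \<and> B < real p \<and> real p \<le> M. 1 - h p) * (\<Sum>a | 0 < a \<and> real a \<le> M. f a * h a))"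
    if ws: "weighted_sequence Sp \<chi> c M h \<theta> \<xi> \<kappa> l1 l2 B K k1 k2"
      and c: "\<forall>a\<in>Sp. real (c a) \<le> Bt * M powr \<alpha>" for Sp :: "'a set" and \<chi> c M h
  proof -
    interpret weighted_sequence Sp \<chi> c M h \<theta> \<xi> \<kappa> l1 l2 B K k1 k2 by (rule ws)
    let ?S = "\<Sum>a | 0 < a \<and> real a \<le> M. f a * h a"
    have S0: "0 \<le> ?S" using growth_classD(1)[OF C0(2)] h_nonneg by (intro sum_nonneg) auto
    have RHS0: "0 \<le> M * full_product * ?S" using M_ge full_product_nonneg S0 by simp
    have "(\<Sum>a\<in>Sp. \<chi> a * f (c a)) \<le> G1 * (M * full_product * ?S) \<or>
      (\<Sum>a\<in>Sp. \<chi> a * f (c a)) \<le> G2 * (M * full_product * ?S)"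
    proof (cases "M0 \<le> M")
      case True
      have "(real w powr (1 / \<eta>)) powr \<eta> \<le> M powr \<eta>"
        using True \<eta> unfolding M0_def by (intro powr_mono2) auto
      hence "real w \<le> M powr \<eta>" using \<eta> wb by (simp add: powr_powr)
      then obtain R where R: "real (w ^ 2 ^ R) \<le> M powr \<eta>" "M powr \<eta> < (real (w ^ 2 ^ R))\<^sup>2"
        using level_bracket w(1) by blast
      have c': "real (c a) \<le> M powr (\<alpha> + 1)" if "a \<in> Sp" for a
      proof -
        have "real (c a) \<le> Bt * M powr \<alpha>" using c that by blast
        also have "\<dots> \<le> M * M powr \<alpha>" using True unfolding M0_def by (intro mult_right_mono) auto
        also have "\<dots> = M powr (\<alpha> + 1)" using M_ge by (simp add: powr_add)
        finally show ?thesis .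
      qed
      interpret L: large_parameter Sp \<chi> c M h \<theta> \<xi> \<kappa> l1 l2 B K k1 k2 f A \<alpha> C0 C1 cl N1 N \<theta>1 \<eta> \<tau> w R
        by unfold_locales
          (use C0 C1 A \<alpha> cl(1) cl(2)[OF h_density] \<theta>1 \<eta> \<eta>3 \<tau> \<tau>3 w(1,2,4) wb(2) w4 R c'
            in \<open>simp_all add: N1_def N_def less_imp_le\<close>)
      show ?thesis
        using L.main_bound
        unfolding L.sc_def L.H_def L.E0_def L.J_def L.S_def G1_def H_def J_def by simp
    next
      case False
      have "real (c a) \<le> Bt * M0 powr \<alpha>" if "a \<in> Sp" for a
      proof -
        have "real (c a) \<le> Bt * M powr \<alpha>" using c that by blast
        also have "\<dots> \<le> Bt * M0 powr \<alpha>"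
          using False Bt \<alpha> M_ge by (intro mult_left_mono powr_mono2) auto
        finally show ?thesis .
      qed
      hence "(\<Sum>a\<in>Sp. \<chi> a * f (c a)) \<le> G2 * (M * full_product * ?S)"
        unfolding G2_def using C1 \<tau> \<alpha> Bt False v by (intro bounded_parameter_bound[OF C1(2)]) auto
      thus ?thesis by blast
    qed
    moreover have "G1 * (M * full_product * ?S) \<le> max 1 (max G1 G2) * (M * full_product * ?S)"
      "G2 * (M * full_product * ?S) \<le> max 1 (max G1 G2) * (M * full_product * ?S)"
      using RHS0 by (auto intro!: mult_right_mono)
    ultimately show ?thesis unfolding full_product_def by linarith
  qed
  thus ?thesis by (intro exI[of _ "max 1 (max G1 G2)"] conjI allI impI) auto
qed

theorem theorem1p9:
  fixes \<theta> \<xi> \<kappa> l1 l2 B K k1 k2 A \<alpha> Bt :: real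
    and f :: "nat \<Rightarrow> real"
  assumes "A > 1" and "\<alpha> > 0" and "Bt > 0"
    and "\<forall>\<epsilon>>0. \<exists>C>0. f \<in> growth_class A \<epsilon> C"
  shows "\<exists>G>0. \<forall>(\<A> :: 'a set) (\<chi> :: real \<Rightarrow> 'a \<Rightarrow> real) (c :: 'a \<Rightarrow> nat)
            (M :: real \<Rightarrow> real) (h :: real \<Rightarrow> nat \<Rightarrow> real).
     infinite \<A> \<longrightarrow>
     (\<forall>T\<ge>1. \<forall>a\<in>\<A>. \<chi> T a \<ge> 0) \<longrightarrow>
     (\<forall>T\<ge>1. finite (weight_support \<A> \<chi> T)) \<longrightarrow>
     filterlim (\<lambda>T. \<Sum>a\<in>weight_support \<A> \<chi> T. \<chi> T a) at_top at_top \<longrightarrow>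
     (\<forall>a\<in>\<A>. c a > 0) \<longrightarrow>
     equidistributed_wrt \<A> \<chi> c \<theta> \<xi> \<kappa> l1 l2 B K M h k1 k2 \<longrightarrow>
     (\<forall>T\<ge>1. real (SUP a\<in>weight_support \<A> \<chi> T. c a) \<le> Bt * M T powr \<alpha>) \<longrightarrow>
     (\<forall>T\<ge>1. (\<Sum>a\<in>weight_support \<A> \<chi> T. \<chi> T a * f (c a))
        \<le> G * (M T * (\<Prod>p | prime p \<and> B < real p \<and> real p \<le> M T. 1 - h T p)
              * (\<Sum>a | 0 < a \<and> real a \<le> M T. f a * h T a)))"
proof (cases "\<theta> > 0 \<and> \<xi> > 0 \<and> \<kappa> > 0 \<and> l1 > 0 \<and> l2 > 0 \<and> B > 0 \<and> K > 0 \<and> max \<theta> \<xi> < 1")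
  \<comment> \<open>The sign conditions are part of \<open>equidistributed_wrt\<close>, so the claim
    is vacuous and any positive \<open>G\<close> will do.\<close>
  case False
  hence "\<not> equidistributed_wrt \<A> \<chi> c \<theta> \<xi> \<kappa> l1 l2 B K M h k1 k2"
    for \<A> :: "'a set" and \<chi> c M h unfolding equidistributed_wrt_def by blast
  thus ?thesis by (intro exI[of _ 1]) simp
next
  case True
  \<comment> \<open>The implied constants are arbitrary reals; raising negative ones to 0 weakens
    the hypothesis and meets the sign conditions of the locale.\<close>
  define k1' k2' where "k1' = max 0 k1" and "k2' = max 0 k2"
  have k': "0 \<le> k1'" "0 \<le> k2'" "k1 \<le> k1'" "k2 \<le> k2'" by (auto simp: k1'_def k2'_def)
  obtain G where G: "G > 0" "\<And>(Sp :: 'a set) \<chi> c M h.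
    weighted_sequence Sp \<chi> c M h \<theta> \<xi> \<kappa> l1 l2 B K k1' k2' \<Longrightarrow>
    \<forall>a\<in>Sp. real (c a) \<le> Bt * M powr \<alpha> \<Longrightarrow>
    (\<Sum>a\<in>Sp. \<chi> a * f (c a)) \<le> G * (M * (\<Prod>p | prime p \<and> B < real p \<and> real p \<le> M. 1 - h p)
      * (\<Sum>a | 0 < a \<and> real a \<le> M. f a * h a))"
    using weighted_sequence_bound[OF assms, of \<theta> \<xi> \<kappa> l1 l2 B K k1' k2'] True k' by blast
  show ?thesis
  proof (intro exI[of _ G] conjI allI impI G(1))
    fix \<A> :: "'a set" and \<chi> :: "real \<Rightarrow> 'a \<Rightarrow> real" and c :: "'a \<Rightarrow> nat"
      and M :: "real \<Rightarrow> real" and h :: "real \<Rightarrow> nat \<Rightarrow> real" and T :: real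
    assume nn: "\<forall>T\<ge>1. \<forall>a\<in>\<A>. \<chi> T a \<ge> 0" and fin: "\<forall>T\<ge>1. finite (weight_support \<A> \<chi> T)"
      and c: "\<forall>a\<in>\<A>. c a > 0" and eq: "equidistributed_wrt \<A> \<chi> c \<theta> \<xi> \<kappa> l1 l2 B K M h k1 k2"
      and sup: "\<forall>T\<ge>1. real (SUP a\<in>weight_support \<A> \<chi> T. c a) \<le> Bt * M T powr \<alpha>" and T: "1 \<le> T"
    show "(\<Sum>a\<in>weight_support \<A> \<chi> T. \<chi> T a * f (c a))
        \<le> G * (M T * (\<Prod>p | prime p \<and> B < real p \<and> real p \<le> M T. 1 - h T p)
              * (\<Sum>a | 0 < a \<and> real a \<le> M T. f a * h T a))"
    proof (rule G(2))
      show "weighted_sequence (weight_support \<A> \<chi> T) (\<chi> T) c (M T) (h T) \<theta> \<xi> \<kappa> l1 l2 B K k1' k2'"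
      proof unfold_locales
        fix d :: nat assume d: "0 < d" "real d \<le> M T powr \<theta>"
        let ?\<Pi> = "\<Prod>p | prime p \<and> B < real p \<and> real p \<le> M T \<and> \<not> p dvd d. (1 - h T p)\<^sup>2"
        obtain E1 E2 where E: "congruence_sum \<A> \<chi> c d T = h T d * M T * (1 + E1) + E2"
          "\<bar>E1\<bar> \<le> k1 * ?\<Pi>" "\<bar>E2\<bar> \<le> k2 * M T powr (1 - \<xi>)"
          using eq T d unfolding equidistributed_wrt_def by blast
        have "k1 * ?\<Pi> \<le> k1' * ?\<Pi>" using k' by (intro mult_right_mono prod_nonneg) auto
        moreover have "k2 * M T powr (1 - \<xi>) \<le> k2' * M T powr (1 - \<xi>)" using k' by (intro mult_right_mono) auto
        ultimately show "\<exists>E1 E2. (\<Sum>a | a \<in> weight_support \<A> \<chi> T \<and> d dvd c a. \<chi> T a) = h T d * M T * (1 + E1) + E2 \<and>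
            \<bar>E1\<bar> \<le> k1' * ?\<Pi> \<and> \<bar>E2\<bar> \<le> k2' * M T powr (1 - \<xi>)"
          using E unfolding congruence_sum_def by (intro exI[of _ E1] exI[of _ E2]) auto
      qed (use True k' fin nn c eq T in \<open>auto simp: weight_support_def equidistributed_wrt_def\<close>)
      show "\<forall>a\<in>weight_support \<A> \<chi> T. real (c a) \<le> Bt * M T powr \<alpha>"
      proof
        fix a assume a: "a \<in> weight_support \<A> \<chi> T"
        \<comment> \<open>The supremum over naturals is a genuine upper bound because the support is
          finite.\<close>
        have "c a \<le> (SUP a\<in>weight_support \<A> \<chi> T. c a)"
          using a fin T by (intro cSUP_upper) auto
        hence "real (c a) \<le> real (SUP a\<in>weight_support \<A> \<chi> T. c a)" by (simp only: of_nat_le_iff)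
        thus "real (c a) \<le> Bt * M T powr \<alpha>" using sup T by force
      qed
    qed
  qed
qed

end
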